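(* Let $\mathbb{F}$ be a field of characteristic different from $2$ and let $\eta\in\{-1,1\}$. Let $b$ be a non-degenerate symmetric bilinear form on a finite-dimensional vector space $V$ over $\mathbb{F}$, and let $u$ be a nilpotent endomorphism of $V$ that is $b$-selfadjoint if $\eta=1$ and $b$-skew-selfadjoint if $\eta=-1$. The following conditions are equivalent: (i) there exist endomorphisms $a_1,a_2$ of $V$, both $b$-selfadjoint if $\eta=1$ and both $b$-skew-selfadjoint if $\eta=-1$, such that $a_1^2=a_2^2=0$ and $u=a_1+a_2$; (ii) for every integer $k\ge0$, the non-degenerate symmetric bilinear form $\eta^k(b,u)_{t,2k+1}$ Witt-simplifies the orthogonal direct sum $\underset{i>k}{\bot}\,\eta^i(b,u)_{t,2i+1}$.
   Context: $u$ is $b$-selfadjoint (resp. $b$-skew-selfadjoint) if $b(u(x),y)=b(x,u(y))$ (resp. $=-b(x,u(y))$) for all $x,y$. For $k\ge1$, $(b,u)_{t,k}$ is the non-degenerate bilinear form induced by $(x,y)\mapsto b(x,u^{k-1}(y))$ on the quotient space $\mathrm{Ker}\,u^k/\bigl(\mathrm{Ker}\,u^{k-1}+(\mathrm{Ker}\,u^k\cap\mathrm{Im}\,u)\bigr)$; it is symmetric when $k$ is odd. It is zero (on the zero space) for all large $k$. For a non-degenerate symmetric bilinear form $B$: its rank $\mathrm{rk}(B)$ is the dimension of its underlying space; its Witt index $\nu(B)$ is the greatest dimension of a totally $B$-isotropic subspace; $B$ is isometric to an orthogonal sum of a hyperbolic form of rank $2\nu(B)$ and of a nonisotropic form (one with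 no nonzero isotropic vector), unique up to equivalence and called a nonisotropic part of $B$. For non-degenerate symmetric bilinear forms $B,B'$ over $\mathbb{F}$, $B$ Witt-simplifies $B'$ if every nonisotropic part of $B'$ is equivalent to a subform of $-B$ (the restriction of $-B$ to some linear subspace); equivalently, $\nu(B')+\nu(B'\bot B)\ge\mathrm{rk}(B')$. *)

theory Defs
  imports "Jordan_Normal_Form.VS_Connect"
begin

text \<open>
  A bilinear space is a module record over the field \<^typ>\<open>'f\<close> (viewed as the ring \<^term>\<open>class_ring\<close>)
  together with a form on its carrier.
\<close>

record ('f, 'a) form_space = "('f, 'a) module" +
  form :: "'a \<Rightarrow> 'a \<Rightarrow> 'f"

definition with_form :: "('f, 'a) module \<Rightarrow> ('a \<Rightarrow> 'a \<Rightarrow> 'f) \<Rightarrow> ('f, 'a) form_space" where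
  "with_form M B = module.extend M (form_space.fields B)"

definition symmetric_form_space :: "('f::field, 'a) form_space \<Rightarrow> bool" where
  "symmetric_form_space B \<longleftrightarrow>
     vectorspace class_ring B \<and>
     (\<forall>x\<in>carrier B. \<forall>y\<in>carrier B. \<forall>z\<in>carrier B.
        form B (x \<oplus>\<^bsub>B\<^esub> y) z = form B x z + form B y z) \<and>
     (\<forall>c. \<forall>x\<in>carrier B. \<forall>y\<in>carrier B. form B (c \<odot>\<^bsub>B\<^esub> x) y = c * form B x y) \<and>
     (\<forall>x\<in>carrier B. \<forall>y\<in>carrier B. form B x y = form B y x)"

definition isometric :: "('f::field, 'a) form_space \<Rightarrow> ('f, 'b) form_space \<Rightarrow> bool" where
  "isometric A B \<longleftrightarrow>
     (\<exists>h \<in> LinearCombinations.module_hom class_ring A B. bij_betw h (carrier A) (carrier B) \<and>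
        (\<forall>x\<in>carrier A. \<forall>y\<in>carrier A. form B (h x) (h y) = form A x y))"

definition subform :: "('f, 'a) form_space \<Rightarrow> 'a set \<Rightarrow> ('f, 'a) form_space" where
  "subform B W = B\<lparr>carrier := W\<rparr>"

definition scale_form :: "'f::field \<Rightarrow> ('f, 'a) form_space \<Rightarrow> ('f, 'a) form_space" where
  "scale_form c B = B\<lparr>form := \<lambda>x y. c * form B x y\<rparr>"

definition orth_sum ::
  "('f::field, 'a) form_space \<Rightarrow> ('f, 'b) form_space \<Rightarrow> ('f, 'a \<times> 'b) form_space" where
  "orth_sum A B = with_form (direct_sum A B)
     (\<lambda>(x, y) (x', y'). form A x x' + form B y y')"

text \<open>
  The orthogonal direct sum of a possibly infinite family: its vectors are the families of finite
  support, in the convention of \<open>sum_group\<close> in \<open>HOL-Algebra\<close> (extensional functions on the index set).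
\<close>

definition orth_Sum ::
  "'i set \<Rightarrow> ('i \<Rightarrow> ('f::field, 'a) form_space) \<Rightarrow> ('f, 'i \<Rightarrow> 'a) form_space" where
  "orth_Sum I B =
     \<lparr> carrier = {x \<in> \<Pi>\<^sub>E i\<in>I. carrier (B i). finite {i \<in> I. x i \<noteq> \<zero>\<^bsub>B i\<^esub>}},
       mult = undefined, one = undefined,
       zero = (\<lambda>i\<in>I. \<zero>\<^bsub>B i\<^esub>),
       add = (\<lambda>x y. \<lambda>i\<in>I. x i \<oplus>\<^bsub>B i\<^esub> y i),
       smult = (\<lambda>c x. \<lambda>i\<in>I. c \<odot>\<^bsub>B i\<^esub> x i),
       form = (\<lambda>x y. \<Sum>i \<in> {i \<in> I. x i \<noteq> \<zero>\<^bsub>B i\<^esub> \<and> y i \<noteq> \<zero>\<^bsub>B i\<^esub>}. form (B i) (x i) (y i)) \<rparr>"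

definition totally_isotropic :: "('f::field, 'a) form_space \<Rightarrow> 'a set \<Rightarrow> bool" where
  "totally_isotropic B W \<longleftrightarrow> (\<forall>x\<in>W. \<forall>y\<in>W. form B x y = 0)"

definition nonisotropic :: "('f::field, 'a) form_space \<Rightarrow> bool" where
  "nonisotropic B \<longleftrightarrow> (\<forall>x\<in>carrier B. form B x x = 0 \<longrightarrow> x = \<zero>\<^bsub>B\<^esub>)"

definition witt_index :: "('f::field, 'a) form_space \<Rightarrow> nat" where
  "witt_index B = Max {vectorspace.dim class_ring (subform B W) | W.
     VectorSpace.subspace class_ring W B \<and> totally_isotropic B W}"

text \<open>The hyperbolic form of rank \<open>2n\<close>, i.e. the orthogonal sum of \<open>n\<close> hyperbolic planes.\<close>

definition hyperbolic_space :: "nat \<Rightarrow> ('f::field, 'f vec \<times> 'f vec) form_space" where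
  "hyperbolic_space n = with_form (direct_sum (module_vec TYPE('f) n) (module_vec TYPE('f) n))
     (\<lambda>(x, y) (x', y'). x \<bullet> y' + y \<bullet> x')"

definition nonisotropic_part ::
  "('f::field, 'a) form_space \<Rightarrow> ('f, 'b) form_space \<Rightarrow> bool" where
  "nonisotropic_part N B \<longleftrightarrow> symmetric_form_space N \<and> nonisotropic N \<and>
     isometric B (orth_sum (hyperbolic_space (witt_index B)) N)"

text \<open>
  In \<open>witt_simplifies B B'\<close> the bound variable \<open>N\<close> has the vector type of \<open>B'\<close>. This is no
  restriction: a nonisotropic part of \<open>B'\<close> is isometric to the restriction of \<open>B'\<close> to a subspace.
\<close>

definition witt_simplifies ::
  "('f::field, 'a) form_space \<Rightarrow> ('f, 'b) form_space \<Rightarrow> bool" where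
  "witt_simplifies B B' \<longleftrightarrow>
     (\<forall>N :: ('f, 'b) form_space. nonisotropic_part N B' \<longrightarrow>
        (\<exists>W. VectorSpace.subspace class_ring W (scale_form (-1) B) \<and>
             isometric N (subform (scale_form (-1) B) W)))"

definition bilinear_form ::
  "('f::field \<Rightarrow> 'v::ab_group_add \<Rightarrow> 'v) \<Rightarrow> ('v \<Rightarrow> 'v \<Rightarrow> 'f) \<Rightarrow> bool" where
  "bilinear_form scale b \<longleftrightarrow>
     (\<forall>x. Vector_Spaces.linear scale (*) (\<lambda>y. b x y)) \<and>
     (\<forall>y. Vector_Spaces.linear scale (*) (\<lambda>x. b x y))"

definition symmetric_form :: "('v \<Rightarrow> 'v \<Rightarrow> 'f) \<Rightarrow> bool" where
  "symmetric_form b \<longleftrightarrow> (\<forall>x y. b x y = b y x)"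

definition nondegenerate_form :: "('v::zero \<Rightarrow> 'v \<Rightarrow> 'f::zero) \<Rightarrow> bool" where
  "nondegenerate_form b \<longleftrightarrow>
     (\<forall>x. (\<forall>y. b x y = 0) \<longrightarrow> x = 0) \<and> (\<forall>y. (\<forall>x. b x y = 0) \<longrightarrow> y = 0)"

definition selfadjoint :: "('v \<Rightarrow> 'v \<Rightarrow> 'f) \<Rightarrow> ('v \<Rightarrow> 'v) \<Rightarrow> bool" where
  "selfadjoint b u \<longleftrightarrow> (\<forall>x y. b (u x) y = b x (u y))"

definition skew_selfadjoint :: "('v \<Rightarrow> 'v \<Rightarrow> 'f::uminus) \<Rightarrow> ('v \<Rightarrow> 'v) \<Rightarrow> bool" where
  "skew_selfadjoint b u \<longleftrightarrow> (\<forall>x y. b (u x) y = - b x (u y))"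

text \<open>The quotient \<open>U / W\<close> of two subspaces \<open>W \<subseteq> U\<close>, as a module of cosets.\<close>

definition quotient_module ::
  "('f \<Rightarrow> 'v::ab_group_add \<Rightarrow> 'v) \<Rightarrow> 'v set \<Rightarrow> 'v set \<Rightarrow> ('f, 'v set) module" where
  "quotient_module scale U W =
     \<lparr> carrier = (\<lambda>x. (+) x ` W) ` U,
       mult = undefined, one = undefined,
       zero = W,
       add = (\<lambda>X Y. {x + y | x y. x \<in> X \<and> y \<in> Y}),
       smult = (\<lambda>c X. {scale c x + w | x w. x \<in> X \<and> w \<in> W}) \<rparr>"

definition ker_pow :: "('v::zero \<Rightarrow> 'v) \<Rightarrow> nat \<Rightarrow> 'v set" where
  "ker_pow u k = {x. (u ^^ k) x = 0}"

definition t_radical :: "('v::ab_group_add \<Rightarrow> 'v) \<Rightarrow> nat \<Rightarrow> 'v set" where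
  "t_radical u k = {x + y | x y. x \<in> ker_pow u (k - 1) \<and> y \<in> ker_pow u k \<inter> range u}"

text \<open>
  The form \<open>(b, u)\<^sub>t\<^sub>,\<^sub>k\<close>, meant for \<open>k \<ge> 1\<close> and \<open>u\<close> selfadjoint or skew-selfadjoint. For such \<open>u\<close>,
  \<open>b x (u\<^sup>k\<^sup>-\<^sup>1 y)\<close> depends only on the cosets \<open>X\<close> of \<open>x\<close> and \<open>Y\<close> of \<open>y\<close>, so the image below is a singleton.
\<close>

definition t_form ::
  "('f \<Rightarrow> 'v::ab_group_add \<Rightarrow> 'v) \<Rightarrow> ('v \<Rightarrow> 'v \<Rightarrow> 'f) \<Rightarrow> ('v \<Rightarrow> 'v) \<Rightarrow> nat
     \<Rightarrow> ('f, 'v set) form_space" where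
  "t_form scale b u k = with_form (quotient_module scale (ker_pow u k) (t_radical u k))
     (\<lambda>X Y. the_elem ((\<lambda>(x, y). b x ((u ^^ (k - 1)) y)) ` (X \<times> Y)))"

end

theory Submission
  imports Defs
begin

text \<open>
  With \<open>v = a1 - a2\<close>, condition (i) asks for an operator \<open>v\<close>, (skew-)selfadjoint like \<open>u\<close>, such that \<open>u v = - v u\<close>
  and \<open>v\<^sup>2 = - u\<^sup>2\<close>. The space is an orthogonal sum of \<open>u\<close>-strings and of pairs of dual isotropic \<open>u\<close>-strings. On
  strings of even length and on pairs of dual strings such a \<open>v\<close> always exists, and it also exists on
  the sum of a string of length \<open>2k + 3\<close> and one of length \<open>2k + 1\<close> whose middle vectors have opposite norms.
  The middle vectors of the strings of length \<open>> 2k + 1\<close> span a space isometric to the orthogonal sum of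
  the forms \<open>\<eta>\<^sup>i (b, u)\<^sub>t\<^sub>,\<^sub>2\<^sub>i\<^sub>+\<^sub>1\<close> with \<open>i > k\<close>. Under (ii), a downward induction on \<open>k\<close> matches an anisotropic part of it
  with strings of length \<open>2k + 1\<close>. Conversely, the range of \<open>u\<^sup>k a1\<close> is totally isotropic for \<open>b\<close>, and it
  contains the graph of an isometric embedding of this anisotropic part into \<open>- \<eta>\<^sup>k (b, u)\<^sub>t\<^sub>,\<^sub>2\<^sub>k\<^sub>+\<^sub>1\<close>.
\<close>

section \<open>Witt decompositions\<close>

text \<open>With \<open>a1 = (u + v) / 2\<close> and \<open>a2 = (u - v) / 2\<close>, the sum and
  the difference of the equations \<open>a1\<^sup>2 = 0\<close> and \<open>a2\<^sup>2 = 0\<close>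
  are the two equations for \<open>v\<close>. The matching only ever joins neighbouring odd lengths:
  at each stage the anisotropic part of all middle vectors found so far is carried by strings of the
  shortest length reached, and (ii) provides partners one step below. The forms in (ii) live on
  cosets and on families of cosets, and a nonisotropic part is only given up to isometry. All of
  them are therefore modelled inside the given space: a quotient by generators of strings, an
  orthogonal sum by middle vectors. A Witt cancellation theorem is avoided by an asymmetry: from
  (ii) to (i) one chosen Witt decomposition is enough, while from (i) to (ii) an arbitrary
  nonisotropic part is pulled back to a pair of subspaces \<open>M\<close>, \<open>N\<close>, and
  the embedding is built for every such pair.\<close>

locale symmetric_bilinear_space = finite_dimensional_vector_space +
  fixes b :: "'b \<Rightarrow> 'b \<Rightarrow> 'a"
  assumes bilinear: "bilinear_form scale b" and symmetric: "symmetric_form b"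
    and two_neq_0: "(2::'a) \<noteq> 0"
begin

sublocale self: finite_dimensional_vector_space_pair_1 scale Basis scale ..

abbreviation endomorphism :: "('b \<Rightarrow> 'b) \<Rightarrow> bool" where
  "endomorphism \<equiv> Vector_Spaces.linear scale scale"

lemma endomorphismI:
  assumes "\<And>x y. f (x + y) = f x + f y" "\<And>c x. f (c *s x) = c *s f x"
  shows "endomorphism f"
  using assms unfolding Vector_Spaces.linear_iff by (simp add: vector_space_axioms)

lemma endomorphismD:
  assumes "endomorphism f"
  shows "f (x + y) = f x + f y" "f (c *s x) = c *s f x" "f 0 = 0"
proof -
  show "f (x + y) = f x + f y" "f (c *s x) = c *s f x" for x y c
    using assms unfolding Vector_Spaces.linear_iff by auto
  from this(2)[of 0 0] show "f 0 = 0" by simp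
qed

lemma b_commute: "b x y = b y x"
  using symmetric by (simp add: symmetric_form_def)

lemma linear_b_right: "Vector_Spaces.linear scale (*) (b x)"
  using bilinear by (simp add: bilinear_form_def)

lemma b_add_right: "b x (y + z) = b x y + b x z"
  and b_scale_right: "b x (c *s y) = c * b x y"
  using linear_b_right[of x] unfolding Vector_Spaces.linear_iff by blast+

lemma b_add_left: "b (x + y) z = b x z + b y z"
  and b_scale_left: "b (c *s x) y = c * b x y"
  by (metis b_commute b_add_right, metis b_commute b_scale_right)

lemma b_zero_right [simp]: "b x 0 = 0"
  using b_scale_right[of x 0 0] by simp

lemma b_zero_left [simp]: "b 0 x = 0"
  using b_zero_right b_commute by metis

lemma b_minus_right: "b x (- y) = - b x y"
  using b_scale_right[of x "-1" y] by simp

lemma b_minus_left: "b (- x) y = - b x y"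
  using b_minus_right b_commute by metis

lemma b_diff_right: "b x (y - z) = b x y - b x z"
  using b_add_right[of x y "- z"] by (simp add: b_minus_right)

lemma b_diff_left: "b (x - y) z = b x z - b y z"
  using b_diff_right b_commute by metis

lemma b_sum_right: "b x (\<Sum>i\<in>I. f i) = (\<Sum>i\<in>I. b x (f i))"
  by (induction I rule: infinite_finite_induct) (auto simp: b_add_right)

lemma b_sum_left: "b (\<Sum>i\<in>I. f i) x = (\<Sum>i\<in>I. b (f i) x)"
  by (simp add: b_commute[of _ x] b_sum_right)

lemmas b_simps = b_add_left b_add_right b_scale_left b_scale_right b_minus_left b_minus_right
  b_diff_left b_diff_right

definition perp :: "'b set \<Rightarrow> 'b set" where
  "perp X = {y. \<forall>x\<in>X. b x y = 0}"

lemma subspace_perp: "subspace (perp X)"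
  by (auto simp: subspace_def perp_def b_simps)

lemma perp_span: "perp (span X) = perp X"
proof -
  have "b x y = 0" if "y \<in> perp X" "x \<in> span X" for x y
  proof -
    have "X \<subseteq> perp {y}" using that by (auto simp: perp_def b_commute)
    then have "x \<in> perp {y}" using span_minimal[OF _ subspace_perp] that by blast
    then show ?thesis by (simp add: perp_def b_commute)
  qed
  then show ?thesis using span_superset[of X] by (force simp: perp_def)
qed

text \<open>Stated for an arbitrary bilinear \<open>D\<close>, because it also serves for the
  pairings \<open>b x (u\<^sup>j y)\<close> and for defects such as
  \<open>b (v x) y - \<eta> * b x (v y)\<close>, whose vanishing expresses adjointness or
  isometry.\<close>

lemma span_bilinear_eq_0:
  fixes D :: "'b \<Rightarrow> 'b \<Rightarrow> 'a"
  assumes "\<And>x y y'. D x (y + y') = D x y + D x y'" "\<And>c x y. D x (c *s y) = c * D x y"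
    and "\<And>x x' y. D (x + x') y = D x y + D x' y" "\<And>c x y. D (c *s x) y = c * D x y"
    and "x \<in> span X" "y \<in> span Y" "\<And>x y. x \<in> X \<Longrightarrow> y \<in> Y \<Longrightarrow> D x y = 0"
  shows "D x y = 0"
proof -
  have s: "subspace {y. D x y = 0}" "subspace {x. D x y = 0}" for x y
    using assms(2)[of x 0 0] assms(4)[of 0 0 y] by (simp_all add: subspace_def assms(1-4))
  have "span Y \<subseteq> {y. D x y = 0}" if "x \<in> X" for x
    using assms(7) that by (intro span_minimal s) auto
  then have "span X \<subseteq> {x. D x y = 0}" using assms(6) by (intro span_minimal s) auto
  then show ?thesis using assms(5) by blast
qed

lemma span_perp_eq_0:
  assumes "x \<in> span X" "y \<in> span Y" "\<And>x y. x \<in> X \<Longrightarrow> y \<in> Y \<Longrightarrow> b x y = 0"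
  shows "b x y = 0"
  by (rule span_bilinear_eq_0[OF _ _ _ _ assms]) (simp_all add: b_simps)

definition hyperbolic_pairs :: "('b \<times> 'b) set \<Rightarrow> bool" where
  "hyperbolic_pairs H \<longleftrightarrow> finite H \<and> (\<forall>p\<in>H. \<forall>q\<in>H. b (fst p) (fst q) = 0 \<and>
     b (snd p) (snd q) = 0 \<and> b (fst p) (snd q) = (if p = q then 1 else 0))"

definition pair_vectors :: "('b \<times> 'b) set \<Rightarrow> 'b set" where
  "pair_vectors H = fst ` H \<union> snd ` H"

definition orthogonal_set :: "'b set \<Rightarrow> bool" where
  "orthogonal_set A \<longleftrightarrow> finite A \<and> 0 \<notin> A \<and> (\<forall>x\<in>A. \<forall>y\<in>A. x \<noteq> y \<longrightarrow> b x y = 0)"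

definition anisotropic :: "'b set \<Rightarrow> bool" where
  "anisotropic X \<longleftrightarrow> (\<forall>x\<in>X. b x x = 0 \<longrightarrow> x = 0)"

definition nondegenerate_on :: "'b set \<Rightarrow> bool" where
  "nondegenerate_on X \<longleftrightarrow> (\<forall>x\<in>X. (\<forall>y\<in>X. b x y = 0) \<longrightarrow> x = 0)"

definition witt_decomposition :: "'b set \<Rightarrow> ('b \<times> 'b) set \<Rightarrow> 'b set \<Rightarrow> bool" where
  "witt_decomposition W H A \<longleftrightarrow> hyperbolic_pairs H \<and> orthogonal_set A \<and> anisotropic (span A) \<and>
     (\<forall>x\<in>pair_vectors H. \<forall>a\<in>A. b x a = 0) \<and> span (pair_vectors H \<union> A) = W"

text \<open>The last condition says that the orthogonal of \<open>M\<close> in \<open>W\<close> is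
  \<open>M + N\<close>, so that this orthogonal modulo \<open>M\<close> is a copy of
  \<open>N\<close>. Compared with a Witt decomposition, only one half of each hyperbolic plane is
  kept.\<close>

definition metabolic_decomposition :: "'b set \<Rightarrow> 'b set \<Rightarrow> 'b set \<Rightarrow> bool" where
  "metabolic_decomposition W M N \<longleftrightarrow> subspace M \<and> M \<subseteq> W \<and> (\<forall>x\<in>M. \<forall>y\<in>M. b x y = 0) \<and>
     subspace N \<and> N \<subseteq> W \<and> (\<forall>x\<in>M. \<forall>y\<in>N. b x y = 0) \<and> anisotropic N \<and>
     (\<forall>w\<in>W. (\<forall>m\<in>M. b m w = 0) \<longrightarrow> (\<exists>m\<in>M. \<exists>n\<in>N. w = m + n))"

lemma hyperbolic_pairs_Un:
  assumes "hyperbolic_pairs H" "hyperbolic_pairs G"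
    and "\<And>x y. x \<in> pair_vectors H \<Longrightarrow> y \<in> pair_vectors G \<Longrightarrow> b x y = 0"
  shows "hyperbolic_pairs (H \<union> G)"
proof -
  have *: "b (fst p) (fst q) = 0 \<and> b (snd p) (snd q) = 0 \<and> b (fst p) (snd q) = 0 \<and> b (snd p) (fst q) = 0"
    if "p \<in> H" "q \<in> G" for p q
    using that assms(3) by (auto simp: pair_vectors_def)
  have ne: "p \<noteq> q" if "p \<in> H" "q \<in> G" for p q
    using *[OF that] that assms(1) by (auto simp: hyperbolic_pairs_def)
  have **: "b (fst q) (fst p) = 0 \<and> b (snd q) (snd p) = 0 \<and> b (fst q) (snd p) = 0" if "p \<in> H" "q \<in> G" for p q
    using *[OF that] b_commute by metis
  show ?thesis
    using assms(1,2) * ** ne ne[symmetric] by (simp add: hyperbolic_pairs_def ball_Un)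
qed

lemma pair_vectors_Un: "pair_vectors (H \<union> G) = pair_vectors H \<union> pair_vectors G"
  by (auto simp: pair_vectors_def)

text \<open>Every \<open>z\<close> in \<open>P\<close> differs from a vector of
  \<open>P \<inter> perp F\<close> by an element of \<open>span F\<close>. A vector of
  \<open>P \<inter> perp F\<close> that is orthogonal to this space is therefore orthogonal to all
  of \<open>P\<close>.\<close>

lemma nondegenerate_on_complement:
  assumes "nondegenerate_on P" and proj: "\<And>z. z \<in> P \<Longrightarrow> \<exists>p\<in>span F. z - p \<in> P \<inter> perp F"
  shows "nondegenerate_on (P \<inter> perp F)"
  unfolding nondegenerate_on_def
proof (intro ballI impI)
  fix x assume x: "x \<in> P \<inter> perp F" "\<forall>y\<in>P \<inter> perp F. b x y = 0"
  have "b x z = 0" if z: "z \<in> P" for z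
  proof -
    obtain p where p: "p \<in> span F" "z - p \<in> P \<inter> perp F" using proj[OF z] by blast
    then have "b p x = 0" using x(1) perp_span[of F] by (auto simp: perp_def)
    moreover have "b x (z - p) = 0" using p x(2) by blast
    ultimately show ?thesis using b_commute[of x p] by (simp add: b_diff_right)
  qed
  then show "x = 0" using x(1) assms(1) by (auto simp: nondegenerate_on_def)
qed

lemma orthogonal_complement:
  assumes "subspace P" "nondegenerate_on P" "orthogonal_set F" "F \<subseteq> P"
    and nz: "\<And>x. x \<in> F \<Longrightarrow> b x x \<noteq> 0"
  shows "nondegenerate_on (P \<inter> perp F)" "P \<subseteq> span (F \<union> (P \<inter> perp F))"
proof -
  have fin: "finite F" using assms(3) by (simp add: orthogonal_set_def)
  \<comment> \<open>Orthogonal projection onto \<open>span F\<close>; the division uses that no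
    vector of \<open>F\<close> is isotropic.\<close>
  define p where "p z = (\<Sum>x\<in>F. (b z x / b x x) *s x)" for z
  have pF: "p z \<in> span F" for z unfolding p_def by (intro span_sum span_scale span_base)
  have "span F \<subseteq> P" using assms(1,4) span_minimal by blast
  then have pP: "p z \<in> P" for z using pF by blast
  have q: "z - p z \<in> P \<inter> perp F" if "z \<in> P" for z
  proof -
    have "b y (p z) = b y z" if y: "y \<in> F" for y
    proof -
      have "b y (p z) = (\<Sum>x\<in>F. (b z x / b x x) * b y x)" by (simp add: p_def b_sum_right b_scale_right)
      also have "\<dots> = (\<Sum>x\<in>F. if x = y then b z y else 0)"
        using assms(3) y nz[OF y] by (intro sum.cong) (auto simp: orthogonal_set_def)
      also have "\<dots> = b y z" using y fin b_commute[of z y] by simp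
      finally show ?thesis .
    qed
    then show ?thesis using that pP assms(1) by (auto simp: perp_def b_diff_right intro: subspace_diff)
  qed
  show "nondegenerate_on (P \<inter> perp F)"
    using assms(2) by (rule nondegenerate_on_complement) (use pF q in blast)
  show "P \<subseteq> span (F \<union> (P \<inter> perp F))"
  proof
    fix z assume "z \<in> P"
    have "p z \<in> span (F \<union> (P \<inter> perp F))" using pF span_mono[of F "F \<union> (P \<inter> perp F)"] by blast
    moreover have "z - p z \<in> span (F \<union> (P \<inter> perp F))" using q[OF \<open>z \<in> P\<close>] by (intro span_base) auto
    ultimately have "p z + (z - p z) \<in> span (F \<union> (P \<inter> perp F))" by (rule span_add)
    then show "z \<in> span (F \<union> (P \<inter> perp F))" by simp
  qed
qed

text \<open>A nonzero vector of an anisotropic space has nonzero norm, so its line splits off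
  orthogonally and the dimension drops.\<close>

lemma anisotropic_orthogonal_basis:
  assumes "subspace U" "anisotropic U"
  shows "\<exists>A. orthogonal_set A \<and> span A = U"
  using assms
proof (induction "dim U" arbitrary: U rule: less_induct)
  case less
  show ?case
  proof (cases "U = {0}")
    case True
    then show ?thesis by (intro exI[of _ "{}"]) (auto simp: orthogonal_set_def)
  next
    case False
    then obtain x where x: "x \<in> U" "x \<noteq> 0" using less.prems subspace_0 by auto
    then have nx: "b x x \<noteq> 0" using less.prems by (auto simp: anisotropic_def)
    define U' where "U' = U \<inter> perp {x}"
    have s: "subspace U'" unfolding U'_def by (intro subspace_inter less.prems subspace_perp)
    have "x \<notin> U'" using nx by (auto simp: U'_def perp_def)
    then have "U' \<subset> U" using x by (auto simp: U'_def)
    then have "dim U' < dim U"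
      using dim_psubset[of U' U] s less.prems by (simp add: span_eq_iff[THEN iffD2])
    then obtain A where A: "orthogonal_set A" "span A = U'"
      using less.hyps[of U'] s less.prems by (auto simp: anisotropic_def U'_def)
    have 1: "orthogonal_set (insert x A)"
      using A span_superset[of A] x(2) by (auto simp: orthogonal_set_def U'_def perp_def b_commute)
    have "U \<subseteq> span ({x} \<union> U')"
      unfolding U'_def using less.prems x nx
      by (intro orthogonal_complement) (auto simp: nondegenerate_on_def anisotropic_def orthogonal_set_def)
    also have "\<dots> \<subseteq> span (insert x A)"
      using A(2) span_mono[of A "insert x A"] by (intro span_minimal) (auto intro: span_base)
    finally have "U \<subseteq> span (insert x A)" .
    moreover have "span (insert x A) \<subseteq> U"
      using A span_superset[of A] x(1) by (intro span_minimal less.prems) (auto simp: U'_def)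
    ultimately show ?thesis using 1 by auto
  qed
qed

lemma witt_decomposition_exists:
  assumes "subspace U" "nondegenerate_on U"
  shows "\<exists>H A. witt_decomposition U H A"
  using assms
proof (induction "dim U" arbitrary: U rule: less_induct)
  case less
  show ?case
  proof (cases "anisotropic U")
    case True
    then obtain A where A: "orthogonal_set A" "span A = U"
      using anisotropic_orthogonal_basis less.prems by blast
    then have "witt_decomposition U {} A"
      using True by (auto simp: witt_decomposition_def hyperbolic_pairs_def pair_vectors_def)
    then show ?thesis by blast
  next
    case False
    then obtain x where x: "x \<in> U" "x \<noteq> 0" "b x x = 0" by (auto simp: anisotropic_def)
    then obtain y0 where y0: "y0 \<in> U" "b x y0 \<noteq> 0"
      using less.prems by (auto simp: nondegenerate_on_def)
    \<comment> \<open>Completes the isotropic \<open>x\<close> to a hyperbolic pair: scaling gives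
      \<open>b x y1 = 1\<close>, and subtracting half the norm of \<open>y1\<close> times
      \<open>x\<close> makes \<open>y\<close> isotropic without changing this pairing. Halving needs
      characteristic other than 2.\<close>
    define y1 where "y1 = (1 / b x y0) *s y0"
    define y where "y = y1 - (b y1 y1 / 2) *s x"
    have y1: "y1 \<in> U" "b x y1 = 1"
      using y0 less.prems by (auto simp: y1_def b_simps intro: subspace_scale)
    have yU: "y \<in> U" using y1 x less.prems by (auto simp: y_def intro: subspace_diff subspace_scale)
    have xy: "b x y = 1" by (simp add: y_def b_simps y1 x)
    have yy: "b y y = 0"
      using two_neq_0 by (simp add: y_def b_simps y1 x b_commute[of y1 x] field_simps)
    define U' where "U' = U \<inter> perp {x, y}"
    have s: "subspace U'" unfolding U'_def by (intro subspace_inter less.prems subspace_perp)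
    have "x \<notin> U'" using xy by (auto simp: U'_def perp_def b_commute[of y x])
    then have "U' \<subset> U" using x by (auto simp: U'_def)
    then have d: "dim U' < dim U"
      using dim_psubset[of U' U] s less.prems by (simp add: span_eq_iff[THEN iffD2])
    have proj: "z - b z y *s x - b z x *s y \<in> U'" if "z \<in> U" for z
      using that x yU less.prems xy yy
      by (auto simp: U'_def perp_def b_simps b_commute[of _ z] b_commute[of y x]
          intro!: subspace_diff subspace_scale)
    have "nondegenerate_on U'"
      unfolding U'_def using less.prems(2)
    proof (rule nondegenerate_on_complement)
      fix z assume "z \<in> U"
      then show "\<exists>p\<in>span {x, y}. z - p \<in> U \<inter> perp {x, y}"
        using proj[of z]
        by (intro bexI[of _ "b z y *s x + b z x *s y"] span_add span_scale span_base)
          (simp_all add: U'_def diff_diff_add)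
    qed
    then obtain H A where HA: "witt_decomposition U' H A" using less.hyps[OF d s] by blast
    then have sub: "pair_vectors H \<union> A \<subseteq> U'"
      using span_superset[of "pair_vectors H \<union> A"] by (auto simp: witt_decomposition_def)
    have 1: "hyperbolic_pairs {(x, y)}" using x xy yy by (auto simp: hyperbolic_pairs_def)
    have "hyperbolic_pairs ({(x, y)} \<union> H)"
      using HA sub 1
      by (intro hyperbolic_pairs_Un) (auto simp: witt_decomposition_def pair_vectors_def U'_def perp_def)
    moreover have "\<forall>z\<in>pair_vectors ({(x, y)} \<union> H). \<forall>a\<in>A. b z a = 0"
      using HA sub by (auto simp: witt_decomposition_def pair_vectors_def U'_def perp_def)
    moreover have "span (pair_vectors ({(x, y)} \<union> H) \<union> A) = U"
    proof
      show "span (pair_vectors ({(x, y)} \<union> H) \<union> A) \<subseteq> U"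
        using sub x yU by (intro span_minimal less.prems) (auto simp: pair_vectors_def U'_def)
      show "U \<subseteq> span (pair_vectors ({(x, y)} \<union> H) \<union> A)"
      proof
        fix z assume "z \<in> U"
        then have "z - b z y *s x - b z x *s y \<in> span (pair_vectors H \<union> A)"
          using proj HA by (auto simp: witt_decomposition_def)
        then have 1: "z - b z y *s x - b z x *s y \<in> span (pair_vectors ({(x, y)} \<union> H) \<union> A)"
          using span_mono[of "pair_vectors H \<union> A" "pair_vectors ({(x, y)} \<union> H) \<union> A"]
          by (auto simp: pair_vectors_def)
        have 2: "b z y *s x + b z x *s y \<in> span (pair_vectors ({(x, y)} \<union> H) \<union> A)"
          by (intro span_add span_scale span_base) (auto simp: pair_vectors_def)
        show "z \<in> span (pair_vectors ({(x, y)} \<union> H) \<union> A)"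
          using span_add[OF 1 2] by simp
      qed
    qed
    ultimately have "witt_decomposition U ({(x, y)} \<union> H) A"
      using HA by (auto simp: witt_decomposition_def)
    then show ?thesis by blast
  qed
qed

lemma witt_decompositionD:
  assumes "witt_decomposition W H A"
  shows "hyperbolic_pairs H" "orthogonal_set A" "anisotropic (span A)" "span (pair_vectors H \<union> A) = W"
    "finite H" "p \<in> H \<Longrightarrow> q \<in> H \<Longrightarrow> b (fst p) (snd q) = (if p = q then 1 else 0)"
    "p \<in> H \<Longrightarrow> q \<in> H \<Longrightarrow> b (fst p) (fst q) = 0" "p \<in> H \<Longrightarrow> q \<in> H \<Longrightarrow> b (snd p) (snd q) = 0"
    "finite A" "x \<in> A \<Longrightarrow> y \<in> A \<Longrightarrow> x \<noteq> y \<Longrightarrow> b x y = 0" "x \<in> A \<Longrightarrow> b x x \<noteq> 0"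
    "z \<in> pair_vectors H \<Longrightarrow> a \<in> span A \<Longrightarrow> b z a = 0" "z \<in> pair_vectors H \<Longrightarrow> a \<in> span A \<Longrightarrow> b a z = 0"
    "pair_vectors H \<subseteq> W" "A \<subseteq> W" "span A \<subseteq> W"
proof -
  note W = assms[unfolded witt_decomposition_def]
  show "hyperbolic_pairs H" "orthogonal_set A" "anisotropic (span A)" "span (pair_vectors H \<union> A) = W"
    using W by blast+
  then show "finite H" "p \<in> H \<Longrightarrow> q \<in> H \<Longrightarrow> b (fst p) (snd q) = (if p = q then 1 else 0)"
    "p \<in> H \<Longrightarrow> q \<in> H \<Longrightarrow> b (fst p) (fst q) = 0" "p \<in> H \<Longrightarrow> q \<in> H \<Longrightarrow> b (snd p) (snd q) = 0"
    "finite A" "x \<in> A \<Longrightarrow> y \<in> A \<Longrightarrow> x \<noteq> y \<Longrightarrow> b x y = 0"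
    unfolding hyperbolic_pairs_def orthogonal_set_def by blast+
  show "x \<in> A \<Longrightarrow> b x x \<noteq> 0"
    using W span_base[of x A] unfolding anisotropic_def orthogonal_set_def by metis
  show za: "b z a = 0" if "z \<in> pair_vectors H" "a \<in> span A" for z a
    by (rule span_perp_eq_0[of z "{z}" a A]) (use that W in \<open>auto intro: span_base\<close>)
  then show "z \<in> pair_vectors H \<Longrightarrow> a \<in> span A \<Longrightarrow> b a z = 0" by (simp add: b_commute[of a])
  show "pair_vectors H \<subseteq> W" "A \<subseteq> W" "span A \<subseteq> W"
    using W span_superset[of "pair_vectors H \<union> A"] span_mono[of A "pair_vectors H \<union> A"] by auto
qed

lemma dim_insert_le: "dim (insert x X) \<le> Suc (dim X)"
  by (simp add: dim_insert)

text \<open>Removing a pair \<open>(h, h')\<close> costs at most one dimension. The space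
  \<open>L \<inter> perp {h}\<close> is projected along \<open>h\<close> into the span of the other
  pairs and \<open>A\<close>. If \<open>h\<close> is in \<open>L\<close>, then \<open>L\<close>
  already lies in \<open>perp {h}\<close> and only the line of \<open>h\<close> is killed; otherwise
  the projection is injective and the loss is the passage to \<open>perp {h}\<close>.\<close>

lemma totally_isotropic_dim_le:
  assumes "witt_decomposition W H A" "subspace L" "L \<subseteq> W" "\<And>x y. x \<in> L \<Longrightarrow> y \<in> L \<Longrightarrow> b x y = 0"
  shows "dim L \<le> card H"
proof -
  show ?thesis using witt_decompositionD(5)[OF assms(1)] assms
  proof (induction H arbitrary: W L rule: finite_induct)
    case empty
    then have "L \<subseteq> {0}" by (auto simp: witt_decomposition_def pair_vectors_def anisotropic_def)
    then have "dim L \<le> dim {0}" by (intro dim_subset)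
    then show ?case by simp
  next
    case (insert p H)
    obtain h h' where p: "p = (h, h')" by (cases p)
    have H: "hyperbolic_pairs (insert p H)" using insert.prems by (auto simp: witt_decomposition_def)
    have hh: "b h h = 0" "b h' h' = 0" "b h h' = 1" "b h' h = 1"
      using H p b_commute[of h' h] by (auto simp: hyperbolic_pairs_def)
    have ort: "b h x = 0 \<and> b h' x = 0" if "x \<in> pair_vectors H \<union> A" for x
      using that H p insert.hyps(2) insert.prems(1) b_commute
      unfolding hyperbolic_pairs_def witt_decomposition_def pair_vectors_def
      by auto
    then have ort': "b h x = 0 \<and> b h' x = 0" if "x \<in> span (pair_vectors H \<union> A)" for x
      using that span_perp_eq_0[of h "{h}" x "pair_vectors H \<union> A"]
        span_perp_eq_0[of h' "{h'}" x "pair_vectors H \<union> A"] span_base by blast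
    define W1 where "W1 = span (pair_vectors H \<union> A)"
    have W1: "witt_decomposition W1 H A"
      using insert.prems(1) unfolding W1_def witt_decomposition_def hyperbolic_pairs_def pair_vectors_def
      by auto
    define L1 where "L1 = L \<inter> perp {h}"
    define f where "f = (\<lambda>w. w - b w h' *s h)"
    have lin: "endomorphism f"
      by (rule endomorphismI) (simp_all add: f_def b_simps scale_left_distrib scale_right_diff_distrib)
    have fW1: "f w \<in> W1" if w: "w \<in> L1" for w
    proof -
      have "w \<in> span (insert h (insert h' (pair_vectors H \<union> A)))"
        using w insert.prems by (auto simp: L1_def witt_decomposition_def pair_vectors_def p Un_commute insert_commute)
      then obtain c d where cd: "w - c *s h - d *s h' \<in> W1"
        by (auto simp: span_insert W1_def diff_diff_add add.commute)
      \<comment> \<open>Since \<open>w\<close> is orthogonal to \<open>h\<close>, it has no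
        component along \<open>h'\<close>; its component along \<open>h\<close> is what
        \<open>f\<close> removes.\<close>
      have "b h (w - c *s h - d *s h') = 0" "b h' (w - c *s h - d *s h') = 0"
        using ort' cd by (auto simp: W1_def)
      then have "d = 0" "c = b w h'"
        using w hh by (auto simp: L1_def perp_def b_simps b_commute[of w])
      then show ?thesis using cd by (simp add: f_def)
    qed
    have sL1: "subspace L1" unfolding L1_def by (intro subspace_inter insert.prems subspace_perp)
    have iso: "b (f x) (f y) = 0" if "x \<in> L1" "y \<in> L1" for x y
    proof -
      have "b x y = 0" "b h x = 0" "b h y = 0" "b x h = 0"
        using that insert.prems(4)[of x y] b_commute[of x h] by (auto simp: L1_def perp_def)
      then show ?thesis using hh by (simp add: f_def b_simps)
    qed
    have le: "dim (f ` L1) \<le> card H"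
      using fW1 iso
      by (intro insert.IH[OF W1 self.linear_subspace_image[OF lin sL1]]) auto
    have "dim L \<le> Suc (dim (f ` L1))"
    proof (cases "h \<in> L")
      case True
      then have "L = L1" using insert.prems(4) by (auto simp: L1_def perp_def)
      then have "L \<subseteq> span (insert h (f ` L1))"
        by (auto simp: span_insert f_def intro!: exI[of _ "b _ h'"] span_base)
      then have "dim L \<le> dim (insert h (f ` L1))" by (rule dim_mono)
      then show ?thesis using dim_insert_le order_trans by blast
    next
      case False
      have "inj_on f L1"
      proof (rule inj_onI)
        fix x y assume xy: "x \<in> L1" "y \<in> L1" "f x = f y"
        define c where "c = b x h' - b y h'"
        have "x - y = c *s h" using xy(3) by (simp add: f_def c_def algebra_simps)
        moreover have "x - y \<in> L" using xy insert.prems by (auto simp: L1_def intro: subspace_diff)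
        ultimately have "c = 0"
          using False subspace_scale[OF insert.prems(2), of "c *s h" "1/c"] by (auto split: if_splits)
        then show "x = y" using \<open>x - y = c *s h\<close> by simp
      qed
      then have "dim (f ` L1) = dim L1"
        using lin sL1 by (intro self.dim_image_eq) (simp_all add: span_eq_iff[THEN iffD2])
      moreover have "dim L \<le> Suc (dim L1)"
      proof (cases "L = L1")
        case False
        then obtain z where z: "z \<in> L" "b h z \<noteq> 0" by (auto simp: L1_def perp_def)
        have "x \<in> span (insert z L1)" if "x \<in> L" for x
        proof -
          have "x - (b h x / b h z) *s z \<in> L1"
            using that z insert.prems by (auto simp: L1_def perp_def b_simps intro!: subspace_diff subspace_scale)
          then show ?thesis by (auto simp: span_insert intro: span_base)
        qed
        then have "dim L \<le> dim (insert z L1)" by (intro dim_mono) auto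
        then show ?thesis using dim_insert_le order_trans by blast
      qed simp
      ultimately show ?thesis by simp
    qed
    then show ?case using le insert.hyps by simp
  qed
qed

section \<open>Form spaces as images of subspaces\<close>

text \<open>Presents a module record as the image of a genuine subspace, so that questions about
  cosets and families become questions about vectors. Injectivity is left to
  \<open>isometric_image\<close>, because quotient maps must qualify too.\<close>

definition linear_image :: "'b set \<Rightarrow> ('b \<Rightarrow> 'c) \<Rightarrow> ('a, 'c, 'd) module_scheme \<Rightarrow> bool" where
  "linear_image L \<phi> X \<longleftrightarrow> subspace L \<and> carrier X = \<phi> ` L \<and> \<zero>\<^bsub>X\<^esub> = \<phi> 0 \<and>
     (\<forall>x\<in>L. \<forall>y\<in>L. \<phi> x \<oplus>\<^bsub>X\<^esub> \<phi> y = \<phi> (x + y)) \<and> (\<forall>c. \<forall>x\<in>L. c \<odot>\<^bsub>X\<^esub> \<phi> x = \<phi> (c *s x))"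

definition isometric_image :: "'b set \<Rightarrow> ('b \<Rightarrow> 'c) \<Rightarrow> ('a, 'c) form_space \<Rightarrow> bool" where
  "isometric_image L \<phi> X \<longleftrightarrow> linear_image L \<phi> X \<and> inj_on \<phi> L \<and>
     (\<forall>x\<in>L. \<forall>y\<in>L. form X (\<phi> x) (\<phi> y) = b x y)"

lemma linear_imageD:
  assumes "linear_image L \<phi> X"
  shows "subspace L" "carrier X = \<phi> ` L" "\<zero>\<^bsub>X\<^esub> = \<phi> 0"
    "x \<in> L \<Longrightarrow> y \<in> L \<Longrightarrow> \<phi> x \<oplus>\<^bsub>X\<^esub> \<phi> y = \<phi> (x + y)" "x \<in> L \<Longrightarrow> c \<odot>\<^bsub>X\<^esub> \<phi> x = \<phi> (c *s x)"
  using assms unfolding linear_image_def by blast+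

lemma isometric_imageD:
  assumes "isometric_image L \<phi> X"
  shows "linear_image L \<phi> X" "inj_on \<phi> L" "x \<in> L \<Longrightarrow> y \<in> L \<Longrightarrow> form X (\<phi> x) (\<phi> y) = b x y"
  using assms unfolding isometric_image_def by blast+

lemma linear_image_vectorspace:
  assumes "linear_image L \<phi> X"
  shows "vectorspace class_ring X"
proof -
  note X = linear_imageD[OF assms]
  note L = subspace_0[OF X(1)] subspace_add[OF X(1)] subspace_scale[OF X(1)] subspace_neg[OF X(1)]
  have "module class_ring X"
  proof (rule module_criteria, goal_cases)
    case 1
    show ?case by (rule class_cring.is_cring)
  next
    case 4
    have "\<exists>y\<in>L. \<phi> x \<oplus>\<^bsub>X\<^esub> \<phi> y = \<zero>\<^bsub>X\<^esub>" if "x \<in> L" for x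
      using X(3) X(4)[OF that L(4)[OF that]] L(4)[OF that] by (intro bexI[of _ "- x"]) simp_all
    then show ?case unfolding X(2) by blast
  qed (use L in \<open>auto simp: X add_ac scale_left_distrib scale_right_distrib\<close>)
  moreover have "field (class_ring :: 'a ring)" by (rule class_field.field_axioms)
  ultimately show ?thesis by (rule vectorspace.intro)
qed

lemma linear_image_subspace:
  assumes "linear_image W \<phi> X" "subspace L" "L \<subseteq> W"
  shows "VectorSpace.subspace class_ring (\<phi> ` L) X" "linear_image L \<phi> (X\<lparr>carrier := \<phi> ` L\<rparr>)"
proof -
  note X = linear_imageD[OF assms(1)]
  have v: "vectorspace class_ring X" by (rule linear_image_vectorspace[OF assms(1)])
  have 4: "\<phi> x \<oplus>\<^bsub>X\<^esub> \<phi> y = \<phi> (x + y)" "c \<odot>\<^bsub>X\<^esub> \<phi> x = \<phi> (c *s x)" if "x \<in> L" "y \<in> L" for x y c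
    using X(4,5) that assms(3) by blast+
  have "submodule class_ring (\<phi> ` L) X"
  proof (rule submodule.intro)
    show "module class_ring X" using v by (simp add: vectorspace_def)
    show "\<phi> ` L \<subseteq> carrier X" using X(2) assms(3) by blast
    show "\<zero>\<^bsub>X\<^esub> \<in> \<phi> ` L" using X(3) subspace_0[OF assms(2)] by blast
  qed (use subspace_add[OF assms(2)] subspace_scale[OF assms(2)] in \<open>auto simp: 4\<close>)
  then show "VectorSpace.subspace class_ring (\<phi> ` L) X" using v by (rule VectorSpace.subspace.intro[rotated])
  show "linear_image L \<phi> (X\<lparr>carrier := \<phi> ` L\<rparr>)"
    unfolding linear_image_def using assms(2) X(3) 4 by simp
qed

lemma linear_image_vimage_subspace:
  assumes "linear_image W \<phi> X" "submodule class_ring L X"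
  shows "subspace {x \<in> W. \<phi> x \<in> L}"
  unfolding subspace_def
proof (intro conjI ballI allI)
  note X = linear_imageD[OF assms(1)]
  show "0 \<in> {x \<in> W. \<phi> x \<in> L}"
    using submodule.zero_closed[OF assms(2)] X(3) subspace_0[OF X(1)] by simp
  fix x c assume x: "x \<in> {x \<in> W. \<phi> x \<in> L}"
  then show "c *s x \<in> {x \<in> W. \<phi> x \<in> L}"
    using submodule.smult_closed[OF assms(2), of c "\<phi> x"] X(5)[of x c] subspace_scale[OF X(1)] by simp
  fix y assume "y \<in> {x \<in> W. \<phi> x \<in> L}"
  with x show "x + y \<in> {x \<in> W. \<phi> x \<in> L}"
    using submodule.m_closed[OF assms(2), of "\<phi> x" "\<phi> y"] X(4)[of x y] subspace_add[OF X(1)] by simp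
qed

lemma linear_image_span:
  assumes "linear_image L \<phi> X" "A \<subseteq> L"
  shows "LinearCombinations.module.span class_ring X (\<phi> ` A) = \<phi> ` span A"
proof -
  note X = linear_imageD[OF assms(1)]
  interpret X: vectorspace class_ring X by (rule linear_image_vectorspace[OF assms(1)])
  have sub: "span A \<subseteq> L" using assms(2) X(1) by (rule span_minimal)
  have AX: "\<phi> ` A \<subseteq> carrier X" using assms(2) X(2) by blast
  have sm: "submodule class_ring (X.span (\<phi> ` A)) X" by (rule X.span_is_submodule[OF AX])
  have "X.span (\<phi> ` A) \<subseteq> \<phi> ` span A"
    using linear_image_subspace(1)[OF assms(1) subspace_span sub] span_superset[of A]
    by (intro X.span_is_subset) (auto simp: VectorSpace.subspace_def)
  moreover have "span A \<subseteq> {x \<in> L. \<phi> x \<in> X.span (\<phi> ` A)}"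
  proof (rule span_minimal)
    show "A \<subseteq> {x \<in> L. \<phi> x \<in> X.span (\<phi> ` A)}" using assms(2) X.in_own_span[OF AX] by blast
    show "subspace {x \<in> L. \<phi> x \<in> X.span (\<phi> ` A)}" by (rule linear_image_vimage_subspace[OF assms(1) sm])
  qed
  ultimately show ?thesis by blast
qed

text \<open>\<open>vectorspace.dim\<close> is the least size of a finite generating set: a basis of
  \<open>L\<close> attains the value, and a generating set of \<open>X\<close> pulls back along the
  injective \<open>\<phi>\<close> to one of \<open>L\<close>.\<close>

lemma linear_image_dim:
  assumes "linear_image L \<phi> X" "inj_on \<phi> L"
  shows "vectorspace.dim class_ring X = dim L"
proof -
  note X = linear_imageD[OF assms(1)]
  interpret X: vectorspace class_ring X by (rule linear_image_vectorspace[OF assms(1)])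
  show ?thesis
    unfolding X.dim_def
  proof (rule Least_equality)
    obtain B where B: "B \<subseteq> L" "independent B" "L \<subseteq> span B" "card B = dim L"
      using basis_exists[of L] by blast
    have "span B = L" using B X(1) by (metis span_minimal subset_antisym)
    then have "X.gen_set (\<phi> ` B)" using linear_image_span[OF assms(1) B(1)] X(2) by simp
    moreover have "finite (\<phi> ` B)" using finiteI_independent[OF B(2)] by simp
    moreover have "card (\<phi> ` B) = dim L" using B(1,4) assms(2) card_image inj_on_subset by metis
    moreover have "\<phi> ` B \<subseteq> carrier X" using B(1) X(2) by blast
    ultimately show "\<exists>A. finite A \<and> card A = dim L \<and> A \<subseteq> carrier X \<and> X.gen_set A" by blast
  next
    fix n assume "\<exists>A. finite A \<and> card A = n \<and> A \<subseteq> carrier X \<and> X.gen_set A"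
    then obtain A where A: "finite A" "card A = n" "A \<subseteq> \<phi> ` L" "X.span A = carrier X" using X(2) by blast
    then obtain A0 where A0: "A0 \<subseteq> L" "A = \<phi> ` A0" by (meson subset_image_iff)
    have inj: "inj_on \<phi> A0" using assms(2) A0(1) inj_on_subset by blast
    have sub: "span A0 \<subseteq> L" using A0(1) X(1) by (rule span_minimal)
    have "\<phi> ` span A0 = \<phi> ` L" using linear_image_span[OF assms(1) A0(1)] A(4) A0(2) X(2) by simp
    then have "span A0 = L" using inj_on_image_eq_iff[OF assms(2) sub subset_refl] by blast
    then have "dim L \<le> card A0" using finite_imageD[of \<phi> A0] A(1) A0(2) inj by (intro dim_le_card) auto
    also have "card A0 = n" using A(2) A0(2) inj card_image by metis
    finally show "dim L \<le> n" .
  qed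
qed

lemma isometric_if_isometric_images:
  assumes "isometric_image L \<phi> X" "isometric_image L \<psi> Y"
  shows "isometric X Y"
proof -
  note X = isometric_imageD[OF assms(1)] and Y = isometric_imageD[OF assms(2)]
  note X' = linear_imageD[OF X(1)] and Y' = linear_imageD[OF Y(1)]
  define h where "h = (\<lambda>z. \<psi> (inv_into L \<phi> z))"
  have h: "h (\<phi> x) = \<psi> x" if "x \<in> L" for x using X(2) that by (simp add: h_def)
  have "h \<in> LinearCombinations.module_hom class_ring X Y"
    unfolding LinearCombinations.module_hom_def
    using subspace_add[OF X'(1)] subspace_scale[OF X'(1)]
    by (auto simp: X'(2,4,5) Y'(2,4,5) h)
  moreover have "bij_betw h (carrier X) (carrier Y)"
  proof -
    have "inj_on h (\<phi> ` L)" using Y(2) h by (auto simp: inj_on_def)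
    moreover have "h ` \<phi> ` L = \<psi> ` L" using h by (auto simp: image_image)
    ultimately show ?thesis by (simp add: X'(2) Y'(2) bij_betw_def)
  qed
  moreover have "form Y (h x) (h y) = form X x y" if "x \<in> carrier X" "y \<in> carrier X" for x y
    using that X(3) Y(3) h unfolding X'(2) by auto
  ultimately show ?thesis unfolding isometric_def by blast
qed

lemma isometric_image_symmetric_form_space:
  assumes "isometric_image L \<phi> X"
  shows "symmetric_form_space X"
proof -
  note X = isometric_imageD(1,3)[OF assms]
  note X' = linear_imageD[OF X(1)]
  show ?thesis
    unfolding symmetric_form_space_def X'(2)
    using linear_image_vectorspace[OF X(1)] subspace_add[OF X'(1)] subspace_scale[OF X'(1)] X(2) b_commute
    by (auto simp: X'(4,5) b_add_left b_scale_left b_add_right b_scale_right)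
qed

lemma isometric_image_subform:
  assumes "isometric_image W \<phi> X" "subspace L" "L \<subseteq> W"
  shows "isometric_image L \<phi> (subform X (\<phi> ` L))"
  using assms linear_image_subspace(2)[of W \<phi> X L]
  unfolding isometric_image_def subform_def by (auto intro: inj_on_subset)

lemma hyperbolic_pairs_independent:
  assumes "hyperbolic_pairs H"
  shows "independent (fst ` H)" "card (fst ` H) = card H"
proof -
  have H: "finite H" "\<And>p q. p \<in> H \<Longrightarrow> q \<in> H \<Longrightarrow> b (fst p) (snd q) = (if p = q then 1 else 0)"
    using assms by (auto simp: hyperbolic_pairs_def)
  have inj: "inj_on fst H"
    using H(2) by (auto simp: inj_on_def) (metis fst_conv snd_conv zero_neq_one)+
  then show "card (fst ` H) = card H" by (rule card_image)
  show "independent (fst ` H)"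
  proof (rule independent_if_scalars_zero)
    show "finite (fst ` H)" using H(1) by simp
    fix f x assume 0: "(\<Sum>x\<in>fst ` H. f x *s x) = 0" and "x \<in> fst ` H"
    then obtain q where q: "q \<in> H" "x = fst q" by blast
    have "0 = b (\<Sum>x\<in>fst ` H. f x *s x) (snd q)" using 0 by simp
    also have "\<dots> = (\<Sum>p\<in>H. f (fst p) * b (fst p) (snd q))"
      by (simp add: sum.reindex[OF inj] b_sum_left b_scale_left)
    also have "\<dots> = (\<Sum>p\<in>H. if p = q then f x else 0)"
      using q H(2) by (intro sum.cong) auto
    also have "\<dots> = f x" using q H(1) by simp
    finally show "f x = 0" by simp
  qed
qed

text \<open>The preimage of a totally isotropic subspace of \<open>X\<close> obeys the bound
  \<open>card H\<close>, and the first vectors of the pairs in \<open>H\<close> span one that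
  attains it. The bound also makes the set under \<open>Max\<close> finite.\<close>

lemma witt_index_eq:
  assumes X: "isometric_image W \<phi> X" and HA: "witt_decomposition W H A"
  shows "witt_index X = card H"
proof -
  note X' = isometric_imageD[OF X]
  note Xd = linear_imageD[OF X'(1)]
  have dim_sub: "vectorspace.dim class_ring (subform X (\<phi> ` L)) = dim L" if "subspace L" "L \<subseteq> W" for L
    using linear_image_dim[OF linear_image_subspace(2)[OF X'(1) that]] X'(2) that(2) inj_on_subset
    unfolding subform_def by blast
  let ?D = "{vectorspace.dim class_ring (subform X L) | L.
     VectorSpace.subspace class_ring L X \<and> totally_isotropic X L}"
  have le: "n \<le> card H" if n: "n \<in> ?D" for n
  proof -
    obtain L where L: "VectorSpace.subspace class_ring L X" "totally_isotropic X L"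
      "n = vectorspace.dim class_ring (subform X L)" using n by blast
    have sm: "submodule class_ring L X" using L(1) by (simp add: VectorSpace.subspace_def)
    define L0 where "L0 = {x \<in> W. \<phi> x \<in> L}"
    have "subspace L0" unfolding L0_def by (rule linear_image_vimage_subspace[OF X'(1) sm])
    moreover have "L0 \<subseteq> W" by (auto simp: L0_def)
    moreover have "\<phi> ` L0 = L" using submodule.subset[OF sm] Xd(2) by (auto simp: L0_def)
    moreover have "b x y = 0" if "x \<in> L0" "y \<in> L0" for x y
      using that L(2) X'(3)[of x y] by (auto simp: L0_def totally_isotropic_def)
    ultimately show ?thesis using totally_isotropic_dim_le[OF HA] dim_sub L(3) by metis
  qed
  note H = witt_decompositionD(1)[OF HA]
  let ?L = "span (fst ` H)"
  have "?L \<subseteq> W"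
    using witt_decompositionD(14)[OF HA] Xd(1) by (intro span_minimal) (auto simp: pair_vectors_def)
  moreover have "b x y = 0" if "x \<in> ?L" "y \<in> ?L" for x y
    using that by (rule span_perp_eq_0) (use H in \<open>auto simp: hyperbolic_pairs_def\<close>)
  then have "totally_isotropic X (\<phi> ` ?L)"
    using X'(3) \<open>?L \<subseteq> W\<close> by (auto simp: totally_isotropic_def subset_iff)
  moreover have "dim ?L = card H"
    using hyperbolic_pairs_independent[OF H] by (simp add: dim_eq_card_independent)
  ultimately have "card H \<in> ?D"
    using dim_sub[of ?L] linear_image_subspace(1)[OF X'(1), of ?L]
    by (intro CollectI exI[of _ "\<phi> ` ?L"]) auto
  then show ?thesis
    unfolding witt_index_def using le finite_subset[of ?D "{..card H}"] by (intro Max_eqI) auto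
qed

text \<open>Both sides are linear in \<open>w\<close>, so it is enough to compare them on
  \<open>pair_vectors H \<union> A\<close>, where the dual pairings leave a single term.\<close>

lemma witt_expansion:
  assumes HA: "witt_decomposition W H A" and w: "w \<in> W"
  shows "w = (\<Sum>p\<in>H. b w (snd p) *s fst p) + (\<Sum>p\<in>H. b w (fst p) *s snd p) + (\<Sum>a\<in>A. (b w a / b a a) *s a)"
proof -
  let ?E = "\<lambda>w. (\<Sum>p\<in>H. b w (snd p) *s fst p) + (\<Sum>p\<in>H. b w (fst p) *s snd p) + (\<Sum>a\<in>A. (b w a / b a a) *s a)"
  note D = witt_decompositionD[OF HA]
  have D': "b (snd p) (fst q) = (if p = q then 1 else 0)" if "p \<in> H" "q \<in> H" for p q
    using D(6)[OF that(2,1)] b_commute[of "snd p" "fst q"] by auto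
  have o: "b (fst p) a = 0" "b (snd p) a = 0" "b a (fst p) = 0" "b a (snd p) = 0" if "p \<in> H" "a \<in> A" for p a
    using D(12,13)[of _ a] span_base[OF that(2)] that(1) by (auto simp: pair_vectors_def)
  have "?E (x + y) = ?E x + ?E y" for x y
    by (simp add: b_add_left scale_left_distrib sum.distrib add_divide_distrib ac_simps)
  moreover have "?E (c *s x) = c *s ?E x" for c x
    by (simp add: b_scale_left scale_right_distrib scale_sum_right)
  ultimately have "subspace {w. w = ?E w}"
    unfolding subspace_def by (simp del: scale_eq_0_iff)
  moreover have "pair_vectors H \<union> A \<subseteq> {w. w = ?E w}"
  proof -
    have "fst q = ?E (fst q)" if q: "q \<in> H" for q
    proof -
      have "(\<Sum>p\<in>H. b (fst q) (snd p) *s fst p) = (\<Sum>p\<in>H. if p = q then fst q else 0)"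
        using q D(6) by (intro sum.cong) auto
      then show ?thesis using q D(5,7) o by simp
    qed
    moreover have "snd q = ?E (snd q)" if q: "q \<in> H" for q
    proof -
      have "(\<Sum>p\<in>H. b (snd q) (fst p) *s snd p) = (\<Sum>p\<in>H. if p = q then snd q else 0)"
        using q D' by (intro sum.cong) auto
      then show ?thesis using q D(5,8) o by simp
    qed
    moreover have "a = ?E a" if a: "a \<in> A" for a
    proof -
      have "(\<Sum>x\<in>A. (b a x / b x x) *s x) = (\<Sum>x\<in>A. if x = a then a else 0)"
        using a D(10,11) by (intro sum.cong) auto
      then show ?thesis using a D(9) o by simp
    qed
    ultimately show ?thesis by (auto simp: pair_vectors_def)
  qed
  ultimately have "span (pair_vectors H \<union> A) \<subseteq> {w. w = ?E w}" by (rule span_minimal[rotated])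
  then show ?thesis using D(4) w by blast
qed

lemma hyperbolic_orth_sum_simps:
  "carrier (orth_sum (hyperbolic_space m) N) = (carrier_vec m \<times> carrier_vec m) \<times> carrier N"
  "\<zero>\<^bsub>orth_sum (hyperbolic_space m) N\<^esub> = ((0\<^sub>v m, 0\<^sub>v m), \<zero>\<^bsub>N\<^esub>)"
  "((x, y), n) \<oplus>\<^bsub>orth_sum (hyperbolic_space m) N\<^esub> ((x', y'), n') = ((x + x', y + y'), n \<oplus>\<^bsub>N\<^esub> n')"
  "c \<odot>\<^bsub>orth_sum (hyperbolic_space m) N\<^esub> ((x, y), n) = ((c \<cdot>\<^sub>v x, c \<cdot>\<^sub>v y), c \<odot>\<^bsub>N\<^esub> n)"
  "form (orth_sum (hyperbolic_space m) N) ((x, y), n) ((x', y'), n') = x \<bullet> y' + y \<bullet> x' + form N n n'"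
  by (simp_all add: orth_sum_def hyperbolic_space_def with_form_def direct_sum_def module_vec_def
      module.defs form_space.defs)

text \<open>Supplies a concrete instance for the quantifier in \<open>witt_simplifies\<close>: the
  coordinates along \<open>H\<close> give the hyperbolic summand, the orthogonal projection to
  \<open>span A\<close> gives the nonisotropic one.\<close>

lemma nonisotropic_part_subform:
  assumes X: "isometric_image W \<phi> X" and HA: "witt_decomposition W H A"
  shows "nonisotropic_part (subform X (\<phi> ` span A)) X"
proof -
  note X' = isometric_imageD[OF X]
  note Xd = linear_imageD[OF X'(1)]
  note D = witt_decompositionD[OF HA]
  note sub = D(16,14,15) and H = D(5-8) and A = D(9,10) and nz = D(11) and o = D(12,13)
  let ?N = "subform X (\<phi> ` span A)"
  have N: "isometric_image (span A) \<phi> ?N" by (rule isometric_image_subform[OF X subspace_span sub(1)])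
  note Nd = linear_imageD[OF isometric_imageD(1)[OF N]]
  have "nonisotropic ?N"
    unfolding nonisotropic_def
  proof (intro ballI impI)
    fix x assume x: "x \<in> carrier ?N" "form ?N x x = 0"
    then obtain a where a: "a \<in> span A" "x = \<phi> a" using Nd(2) by blast
    then have "b a a = 0" using x(2) N by (auto simp: isometric_image_def)
    then show "x = \<zero>\<^bsub>?N\<^esub>" using D(3) a Nd(3) by (auto simp: anisotropic_def)
  qed
  moreover have "isometric X (orth_sum (hyperbolic_space (witt_index X)) ?N)"
  proof -
    let ?m = "card H"
    obtain e where e: "bij_betw e {..<?m} H"
      using ex_bij_betw_nat_finite[OF H(1)] by (auto simp: atLeast0LessThan)
    then have eH: "e i \<in> H" if "i < ?m" for i using that bij_betwE by fastforce
    define pr where "pr w = (\<Sum>a\<in>A. (b w a / b a a) *s a)" for w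
    \<comment> \<open>The coordinate along \<open>fst (e i)\<close> is the pairing with its dual
      partner \<open>snd (e i)\<close>; the roles are exchanged in \<open>p2\<close>.\<close>
    define p1 where "p1 w = vec ?m (\<lambda>i. b w (snd (e i)))" for w
    define p2 where "p2 w = vec ?m (\<lambda>i. b w (fst (e i)))" for w
    have pr_in: "pr w \<in> span A" for w unfolding pr_def by (intro span_sum span_scale span_base)
    have pr_lin: "pr (x + y) = pr x + pr y" "pr (c *s x) = c *s pr x" for x y c
      by (simp_all add: pr_def b_add_left b_scale_left add_divide_distrib scale_left_distrib sum.distrib scale_sum_right)
    have expand: "w = (\<Sum>p\<in>H. b w (snd p) *s fst p) + (\<Sum>p\<in>H. b w (fst p) *s snd p) + pr w" if "w \<in> W" for w
      using witt_expansion[OF HA that] by (simp add: pr_def)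
    have prA: "pr a = a" if "a \<in> span A" for a
    proof -
      have "a \<in> W" using that sub by blast
      moreover have "b a (fst p) = 0" "b a (snd p) = 0" if "p \<in> H" for p
        using o(2)[OF _ \<open>a \<in> span A\<close>] that by (auto simp: pair_vectors_def)
      ultimately show ?thesis using expand[of a] by simp
    qed
    define \<Psi> where "\<Psi> w = ((p1 w, p2 w), \<phi> (pr w))" for w
    have form: "p1 x \<bullet> p2 y + p2 x \<bullet> p1 y + b (pr x) (pr y) = b x y" if x: "x \<in> W" and y: "y \<in> W" for x y
    proof -
      have s: "p1 x \<bullet> p2 y = (\<Sum>p\<in>H. b x (snd p) * b y (fst p))" for x y
        unfolding scalar_prod_def p1_def p2_def
        using sum.reindex_bij_betw[OF e, of "\<lambda>p. b x (snd p) * b y (fst p)"]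
        by (simp add: atLeast0LessThan)
      have s': "p2 x \<bullet> p1 y = (\<Sum>p\<in>H. b y (snd p) * b x (fst p))"
        using s[of y x] comm_scalar_prod[of "p2 x" ?m "p1 y"] by (simp add: p1_def p2_def)
      have "b x (pr y) = b (pr x) (pr y)"
      proof -
        have "b (fst p) (pr y) = 0" "b (snd p) (pr y) = 0" if "p \<in> H" for p
          using o(1)[OF _ pr_in[of y]] that by (auto simp: pair_vectors_def)
        then have "b ((\<Sum>p\<in>H. b x (snd p) *s fst p) + (\<Sum>p\<in>H. b x (fst p) *s snd p) + pr x) (pr y) = b (pr x) (pr y)"
          by (simp add: b_add_left b_sum_left b_scale_left)
        then show ?thesis using expand[OF x] by simp
      qed
      moreover have "b x y = b x ((\<Sum>p\<in>H. b y (snd p) *s fst p) + (\<Sum>p\<in>H. b y (fst p) *s snd p) + pr y)"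
        using expand[OF y] by simp
      ultimately show ?thesis
        by (simp add: s s' b_add_right b_sum_right b_scale_right mult.commute)
    qed
    have inj: "x = y" if "x \<in> W" "y \<in> W" "\<Psi> x = \<Psi> y" for x y
    proof -
      have "\<phi> (pr x) = \<phi> (pr y)" "p1 x = p1 y" "p2 x = p2 y" using that by (auto simp: \<Psi>_def)
      then have "pr x = pr y" using X'(2) pr_in sub(1) unfolding inj_on_def by blast
      moreover have "b x (snd p) = b y (snd p)" "b x (fst p) = b y (fst p)" if "p \<in> H" for p
      proof -
        obtain i where i: "i < ?m" "p = e i" using e \<open>p \<in> H\<close> by (auto simp: bij_betw_def)
        show "b x (snd p) = b y (snd p)" "b x (fst p) = b y (fst p)"
          using arg_cong[OF \<open>p1 x = p1 y\<close>, of "\<lambda>v. v $ i"] arg_cong[OF \<open>p2 x = p2 y\<close>, of "\<lambda>v. v $ i"] i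
          by (simp_all add: p1_def p2_def)
      qed
      ultimately show ?thesis using expand[OF that(1)] expand[OF that(2)] by simp
    qed
    have surj: "((x, y), n) \<in> \<Psi> ` W"
      if x: "x \<in> carrier_vec ?m" and y: "y \<in> carrier_vec ?m" and n: "n \<in> \<phi> ` span A" for x y n
    proof -
      obtain a where a: "a \<in> span A" "n = \<phi> a" using n by blast
      define w where "w = (\<Sum>i<?m. x $ i *s fst (e i)) + (\<Sum>i<?m. y $ i *s snd (e i)) + a"
      have pv: "fst (e i) \<in> pair_vectors H" "snd (e i) \<in> pair_vectors H" if "i < ?m" for i
        using eH[OF that] by (auto simp: pair_vectors_def)
      have wW: "w \<in> W"
        unfolding w_def using pv sub a(1)
        by (intro subspace_add[OF Xd(1)] subspace_sum[OF Xd(1)] subspace_scale[OF Xd(1)]) auto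
      have eq: "e i = e j \<longleftrightarrow> i = j" if "i < ?m" "j < ?m" for i j
        using e that unfolding bij_betw_def inj_on_def by auto
      have delta: "(\<Sum>i<?m. z i * (if i = j then 1 else 0)) = z j" if "j < ?m" for j and z :: "nat \<Rightarrow> 'a"
        using that by (simp add: if_distrib cong: if_cong)
      have "b w (snd (e j)) = x $ j" if j: "j < ?m" for j
      proof -
        have "b w (snd (e j)) = (\<Sum>i<?m. x $ i * (if i = j then 1 else 0))"
          using j eH H eq o(2)[OF pv(2)[OF j] a(1)]
          by (simp add: w_def b_add_left b_sum_left b_scale_left)
        then show ?thesis using delta[OF j] by simp
      qed
      moreover have "b w (fst (e j)) = y $ j" if j: "j < ?m" for j
      proof -
        have "b (snd (e i)) (fst (e j)) = (if i = j then 1 else 0)" if "i < ?m" for i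
          using H(2)[OF eH[OF j] eH[OF that]] eq[OF that j] b_commute[of "snd (e i)"] by auto
        then have "b w (fst (e j)) = (\<Sum>i<?m. y $ i * (if i = j then 1 else 0))"
          using j eH H o(2)[OF pv(1)[OF j] a(1)]
          by (simp add: w_def b_add_left b_sum_left b_scale_left)
        then show ?thesis using delta[OF j] by simp
      qed
      ultimately have "p1 w = x" "p2 w = y" using x y by (auto simp: p1_def p2_def)
      moreover have "pr w = a"
      proof -
        have "b w a' = b a a'" if "a' \<in> A" for a'
          using o(1)[OF pv(1) span_base[OF that]] o(1)[OF pv(2) span_base[OF that]]
          by (simp add: w_def b_add_left b_sum_left b_scale_left)
        then have "pr w = pr a" by (simp add: pr_def)
        then show ?thesis using prA[OF a(1)] by simp
      qed
      ultimately show ?thesis using wW a(2) by (auto simp: \<Psi>_def)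
    qed
    have "isometric_image W \<Psi> (orth_sum (hyperbolic_space ?m) ?N)"
      unfolding isometric_image_def linear_image_def
    proof (intro conjI ballI allI)
      show "subspace W" by (rule Xd(1))
      show "carrier (orth_sum (hyperbolic_space ?m) ?N) = \<Psi> ` W"
        unfolding hyperbolic_orth_sum_simps Nd(2)
        using surj pr_in by (auto simp: \<Psi>_def p1_def p2_def)
      show "\<zero>\<^bsub>orth_sum (hyperbolic_space ?m) ?N\<^esub> = \<Psi> 0"
        unfolding hyperbolic_orth_sum_simps Nd(3) by (auto simp: \<Psi>_def p1_def p2_def pr_def)
      show "inj_on \<Psi> W" using inj by (auto simp: inj_on_def)
    next
      fix x y assume xy: "x \<in> W" "y \<in> W"
      show "\<Psi> x \<oplus>\<^bsub>orth_sum (hyperbolic_space ?m) ?N\<^esub> \<Psi> y = \<Psi> (x + y)"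
        unfolding \<Psi>_def hyperbolic_orth_sum_simps Nd(4)[OF pr_in pr_in]
        by (auto simp: p1_def p2_def pr_lin b_add_left)
      show "form (orth_sum (hyperbolic_space ?m) ?N) (\<Psi> x) (\<Psi> y) = b x y"
        unfolding \<Psi>_def hyperbolic_orth_sum_simps
        using form[OF xy] N pr_in by (simp add: isometric_image_def)
    next
      fix c x assume x: "x \<in> W"
      show "c \<odot>\<^bsub>orth_sum (hyperbolic_space ?m) ?N\<^esub> \<Psi> x = \<Psi> (c *s x)"
        unfolding \<Psi>_def hyperbolic_orth_sum_simps Nd(5)[OF pr_in]
        by (auto simp: p1_def p2_def pr_lin b_scale_left)
    qed
    then show ?thesis unfolding witt_index_eq[OF X HA] by (rule isometric_if_isometric_images[OF X])
  qed
  ultimately show ?thesis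
    unfolding nonisotropic_part_def using isometric_image_symmetric_form_space[OF N] by blast
qed

end

section \<open>Arithmetic of cosets of a subspace\<close>

context vector_space
begin

lemma mem_coset_iff: "z \<in> (+) x ` R \<longleftrightarrow> z - x \<in> R" for z :: 'b
  by (auto intro: image_eqI[of _ _ "z - x"])

lemma coset_eq_iff:
  assumes "subspace R"
  shows "(+) x ` R = (+) y ` R \<longleftrightarrow> x - y \<in> R"
proof
  assume "(+) x ` R = (+) y ` R"
  then have "x \<in> (+) y ` R" using mem_coset_iff[of x x] subspace_0[OF assms] by auto
  then show "x - y \<in> R" by (simp add: mem_coset_iff)
next
  assume d: "x - y \<in> R"
  have "z - x \<in> R \<longleftrightarrow> z - y \<in> R" for z
    using subspace_add[OF assms _ d, of "z - x"] subspace_diff[OF assms _ d, of "z - y"] by auto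
  then show "(+) x ` R = (+) y ` R" by (simp add: set_eq_iff mem_coset_iff)
qed

lemma coset_add:
  assumes "subspace R"
  shows "{a + c | a c. a \<in> (+) x ` R \<and> c \<in> (+) y ` R} = (+) (x + y) ` R"
proof (intro equalityI subsetI)
  fix z assume "z \<in> {a + c | a c. a \<in> (+) x ` R \<and> c \<in> (+) y ` R}"
  then obtain a c where "z = a + c" "a - x \<in> R" "c - y \<in> R" by (auto simp: mem_coset_iff)
  then show "z \<in> (+) (x + y) ` R"
    using subspace_add[OF assms, of "a - x" "c - y"] unfolding mem_coset_iff by (simp add: algebra_simps)
next
  fix z assume "z \<in> (+) (x + y) ` R"
  then have "z = x + (z - x)" "x \<in> (+) x ` R" "z - x \<in> (+) y ` R"
    using subspace_0[OF assms] by (auto simp: mem_coset_iff diff_diff_add)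
  then show "z \<in> {a + c | a c. a \<in> (+) x ` R \<and> c \<in> (+) y ` R}" by blast
qed

lemma coset_scale:
  assumes "subspace R"
  shows "{scale c a + w | a w. a \<in> (+) x ` R \<and> w \<in> R} = (+) (scale c x) ` R"
proof (intro equalityI subsetI)
  fix z assume "z \<in> {scale c a + w | a w. a \<in> (+) x ` R \<and> w \<in> R}"
  then obtain a w where "z = scale c a + w" "a - x \<in> R" "w \<in> R" by (auto simp: mem_coset_iff)
  then show "z \<in> (+) (scale c x) ` R"
    using subspace_add[OF assms subspace_scale[OF assms, of "a - x" c], of w]
    unfolding mem_coset_iff by (simp add: algebra_simps)
next
  fix z assume "z \<in> (+) (scale c x) ` R"
  then have "z = scale c x + (z - scale c x)" "x \<in> (+) x ` R" "z - scale c x \<in> R"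
    using subspace_0[OF assms] by (auto simp: mem_coset_iff)
  then show "z \<in> {scale c a + w | a w. a \<in> (+) x ` R \<and> w \<in> R}" by blast
qed

end

section \<open>Duality for a non-degenerate form\<close>

locale nondegenerate_bilinear_space = symmetric_bilinear_space +
  assumes nondegenerate: "nondegenerate_form b"
begin

lemma eq_0_if_b_eq_0: "(\<And>y. b x y = 0) \<Longrightarrow> x = 0"
  using nondegenerate by (simp add: nondegenerate_form_def)

text \<open>\<open>T z\<close> encodes the values of \<open>b z\<close> on the basis. It is
  injective by nondegeneracy, hence surjective in finite dimension, so some \<open>z\<close> takes
  the prescribed values of \<open>f\<close>.\<close>

lemma riesz:
  assumes "Vector_Spaces.linear scale (*) f"
  shows "\<exists>z. \<forall>y. b z y = f y"
proof -
  interpret to_field: vector_space_pair scale "(*) :: 'a \<Rightarrow> 'a \<Rightarrow> 'a"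
    by unfold_locales (simp_all add: algebra_simps)
  define T where "T z = (\<Sum>e\<in>Basis. b z e *s e)" for z
  have lin: "endomorphism T"
    by (rule endomorphismI) (simp_all add: T_def b_simps scale_left_distrib sum.distrib scale_sum_right)
  have coeff: "c e = 0" if "(\<Sum>e\<in>Basis. c e *s e) = 0" "e \<in> Basis" for c e
    using independentD[OF independent_Basis finite_Basis subset_refl] that by blast
  have eq: "f y = g y" if "Vector_Spaces.linear scale (*) f" "Vector_Spaces.linear scale (*) g"
      "\<And>e. e \<in> Basis \<Longrightarrow> f e = g e" for f g :: "'b \<Rightarrow> 'a" and y
    using to_field.linear_eq_on[OF that(1,2) _ that(3)] span_Basis by blast
  have "inj T"
  proof (rule injI)
    fix x y assume "T x = T y"
    then have "(\<Sum>e\<in>Basis. b (x - y) e *s e) = 0"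
      by (simp add: T_def b_simps scale_left_diff_distrib sum_subtractf)
    then have "b (x - y) e = 0" if "e \<in> Basis" for e using coeff that by blast
    then have "b x z = b y z" for z
      using eq[OF linear_b_right[of x] linear_b_right[of y]] by (simp add: b_diff_left)
    then show "x = y" using eq_0_if_b_eq_0[of "x - y"] by (simp add: b_simps)
  qed
  then have "surj T" using linear_inj_imp_surj[OF lin] by blast
  then obtain z where "T z = (\<Sum>e\<in>Basis. f e *s e)" by (metis surjD)
  then have "(\<Sum>e\<in>Basis. (b z e - f e) *s e) = 0"
    by (simp add: T_def scale_left_diff_distrib sum_subtractf)
  then have "b z e = f e" if "e \<in> Basis" for e using coeff[of "\<lambda>e. b z e - f e"] that by simp
  then show ?thesis using eq[OF linear_b_right assms] by blast
qed

text \<open>A vector outside \<open>X\<close> is detected by a linear form that vanishes on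
  \<open>X\<close>, and the vector representing this form lies in \<open>perp X\<close>.\<close>

lemma perp_perp:
  assumes "subspace X"
  shows "perp (perp X) = X"
proof
  interpret to_field: vector_space_pair scale "(*) :: 'a \<Rightarrow> 'a \<Rightarrow> 'a"
    by unfold_locales (simp_all add: algebra_simps)
  show "X \<subseteq> perp (perp X)" by (auto simp: perp_def b_commute)
  show "perp (perp X) \<subseteq> X"
  proof (rule ccontr)
    assume "\<not> ?thesis"
    then obtain y where y: "y \<in> perp (perp X)" "y \<notin> X" by blast
    obtain B where B: "B \<subseteq> X" "independent B" "X \<subseteq> span B"
      using maximal_independent_subset by blast
    then have sB: "span B = X" using assms span_minimal by blast
    then have "independent (insert y B)" using y B independent_insertI by blast
    then obtain g where g: "Vector_Spaces.linear scale (*) g"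
      "\<forall>x\<in>insert y B. g x = (if x = y then 1 else 0)"
      using to_field.linear_independent_extend[of _ "\<lambda>x. if x = y then 1 else 0"] by blast
    then obtain z where z: "\<And>x. b z x = g x" using riesz by metis
    have "z \<in> perp B" using g(2) y(2) B(1) by (auto simp: perp_def b_commute[of _ z] z)
    then have "z \<in> perp X" using sB perp_span by blast
    then have "b z y = 0" using y(1) by (auto simp: perp_def)
    then show False using g(2) z by simp
  qed
qed

lemma eq_UNIV_if_perp_eq_0:
  assumes "subspace X" "perp X \<subseteq> {0}"
  shows "X = UNIV"
proof -
  have "perp (perp X) = UNIV" using assms(2) by (auto simp: perp_def)
  then show ?thesis using perp_perp[OF assms(1)] by simp
qed

end

section \<open>Strings of a nilpotent endomorphism\<close>

text \<open>The sign \<open>\<eta>\<close> treats the selfadjoint and the skew-selfadjoint case at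
  once.\<close>

locale nilpotent_adjoint_space = nondegenerate_bilinear_space +
  fixes u :: "'b \<Rightarrow> 'b" and \<eta> :: 'a
  assumes linear_u: "endomorphism u"
    and adjoint: "b (u x) y = \<eta> * b x (u y)"
    and eta_square: "\<eta> * \<eta> = 1"
    and nilpotent: "\<exists>n. u ^^ n = (\<lambda>_. 0)"
begin

lemma u_add: "u (x + y) = u x + u y" and u_scale: "u (c *s x) = c *s u x"
  using endomorphismD[OF linear_u] by blast+

lemma upow_add: "(u ^^ j) (x + y) = (u ^^ j) x + (u ^^ j) y"
  by (induction j) (simp_all add: u_add)

lemma upow_scale: "(u ^^ j) (c *s x) = c *s (u ^^ j) x"
  by (induction j) (simp_all add: u_scale)

lemma linear_upow: "endomorphism (u ^^ j)"
  by (rule endomorphismI) (rule upow_add upow_scale)+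

lemma upow_zero [simp]: "(u ^^ j) 0 = 0"
  using upow_scale[of j 0 0] by simp

lemma u_zero [simp]: "u 0 = 0"
  by (rule endomorphismD[OF linear_u])

lemma upow_minus: "(u ^^ j) (- x) = - (u ^^ j) x"
  using upow_scale[of j "-1" x] by simp

lemma upow_diff: "(u ^^ j) (x - y) = (u ^^ j) x - (u ^^ j) y"
  using upow_add[of j x "- y"] by (simp add: upow_minus)

lemma upow_upow: "(u ^^ i) ((u ^^ j) x) = (u ^^ (i + j)) x"
  by (simp add: funpow_add)

lemma upow_zero_mono: "(u ^^ i) x = 0 \<Longrightarrow> i \<le> j \<Longrightarrow> (u ^^ j) x = 0"
  by (metis upow_upow upow_zero le_add_diff_inverse2)

lemma upow_u: "(u ^^ i) (u x) = u ((u ^^ i) x)"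
  by (simp add: funpow_swap1[of u])

lemma eta_power_square [simp]: "\<eta> ^ i * \<eta> ^ i = 1" "\<eta> ^ i * (\<eta> ^ i * c) = c"
proof -
  show "\<eta> ^ i * \<eta> ^ i = 1" by (metis eta_square power_mult_distrib power_one)
  then show "\<eta> ^ i * (\<eta> ^ i * c) = c" by (metis mult.assoc mult.left_neutral)
qed

lemma eta_power_neq_0 [simp]: "\<eta> ^ i \<noteq> 0"
  using eta_power_square(1)[of i] by (metis mult_zero_left zero_neq_one)

lemma eta_neq_0 [simp]: "\<eta> \<noteq> 0"
  using eta_square by auto

lemma b_upow_left: "b ((u ^^ i) x) y = \<eta> ^ i * b x ((u ^^ i) y)"
proof (induction i arbitrary: y)
  case (Suc i)
  have "b ((u ^^ Suc i) x) y = \<eta> * b ((u ^^ i) x) (u y)" by (simp add: adjoint)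
  also have "\<dots> = \<eta> ^ Suc i * b x ((u ^^ Suc i) y)"
    by (simp only: Suc upow_u power_Suc mult.assoc funpow.simps o_apply)
  finally show ?case .
qed simp

lemma b_upow: "b ((u ^^ i) x) ((u ^^ j) y) = \<eta> ^ i * b x ((u ^^ (i + j)) y)"
  by (simp add: b_upow_left upow_upow)

text \<open>The form \<open>b x (u\<^sup>j y)\<close> is thus symmetric if
  \<open>\<eta> ^ j = 1\<close> and skew-symmetric if \<open>\<eta> ^ j = - 1\<close>.\<close>

lemma b_upow_swap: "b x ((u ^^ j) y) = \<eta> ^ j * b y ((u ^^ j) x)"
  using b_upow_left[of j y x] by (simp add: b_commute)

text \<open>The submodule generated by \<open>X\<close> when the polynomials in \<open>u\<close> act
  on the space.\<close>

definition u_span :: "'b set \<Rightarrow> 'b set" where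
  "u_span X = span {(u ^^ j) x | x j. x \<in> X}"

lemma subspace_u_span [simp]: "subspace (u_span X)"
  by (simp add: u_span_def)

lemma u_span_base: "x \<in> X \<Longrightarrow> (u ^^ j) x \<in> u_span X"
  unfolding u_span_def by (rule span_base) blast

lemma subset_u_span: "X \<subseteq> u_span X"
  using u_span_base[of _ X 0] by auto

lemma u_span_minimal:
  "(\<And>x j. x \<in> X \<Longrightarrow> (u ^^ j) x \<in> Y) \<Longrightarrow> subspace Y \<Longrightarrow> u_span X \<subseteq> Y"
  unfolding u_span_def by (rule span_minimal) auto

lemma subspace_vimage_u: "subspace Y \<Longrightarrow> subspace {x. (u ^^ j) x \<in> Y}"
  by (auto simp: subspace_def upow_add upow_scale)

lemma u_span_stable: "x \<in> u_span X \<Longrightarrow> (u ^^ j) x \<in> u_span X"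
  using u_span_minimal[of X "{x. (u ^^ j) x \<in> u_span X}"] subspace_vimage_u[of "u_span X" j]
  by (auto simp: upow_upow u_span_base)

lemma u_span_mono: "X \<subseteq> u_span Y \<Longrightarrow> u_span X \<subseteq> u_span Y"
  using u_span_stable by (intro u_span_minimal) auto

text \<open>Powers of \<open>u\<close> can be moved across \<open>b\<close>, so powers on one side
  already test the orthogonality of the two \<open>u\<close>-stable spans.\<close>

definition u_orthogonal :: "'b set \<Rightarrow> 'b set \<Rightarrow> bool" where
  "u_orthogonal X Y \<longleftrightarrow> (\<forall>x\<in>X. \<forall>y\<in>Y. \<forall>j. b x ((u ^^ j) y) = 0)"

lemma u_orthogonal_commute: "u_orthogonal X Y \<longleftrightarrow> u_orthogonal Y X"
  unfolding u_orthogonal_def by (metis b_upow_swap mult_zero_right)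

lemma u_orthogonal_Un: "u_orthogonal (X \<union> X') Y \<longleftrightarrow> u_orthogonal X Y \<and> u_orthogonal X' Y"
  unfolding u_orthogonal_def by blast

lemma u_orthogonal_u_span:
  assumes "u_orthogonal X Y" "x \<in> u_span X" "y \<in> u_span Y"
  shows "b x y = 0"
  using assms(2,3) unfolding u_span_def
  by (rule span_perp_eq_0) (use assms(1) in \<open>auto simp: u_orthogonal_def b_upow\<close>)

lemma perp_u_span_stable: "z \<in> perp (u_span X) \<Longrightarrow> (u ^^ j) z \<in> perp (u_span X)"
proof -
  assume z: "z \<in> perp (u_span X)"
  have "b x ((u ^^ j) z) = 0" if "x \<in> u_span X" for x
    using u_span_stable[OF that, of j] z b_upow_left[of j x z] by (auto simp: perp_def)
  then show ?thesis by (simp add: perp_def)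
qed

lemma perp_u_spanI: "(\<And>x j. x \<in> X \<Longrightarrow> b ((u ^^ j) x) z = 0) \<Longrightarrow> z \<in> perp (u_span X)"
  unfolding u_span_def perp_span by (auto simp: perp_def)

text \<open>\<open>t x\<close> is the last exponent of the string \<open>x, u x, u (u x), \<dots>\<close>, so this string has length \<open>t x + 1\<close>
  and a middle vector iff \<open>t x\<close> is even.\<close>

definition string_system :: "'b set \<Rightarrow> ('b \<Rightarrow> nat) \<Rightarrow> ('b \<Rightarrow> 'b) \<Rightarrow> bool" where
  "string_system S t star \<longleftrightarrow> finite S \<and> (\<forall>x\<in>S. star x \<in> S \<and> (u ^^ Suc (t x)) x = 0 \<and>
     (\<forall>y\<in>S. \<forall>j. b x ((u ^^ j) y) \<noteq> 0 \<longleftrightarrow> y = star x \<and> j = t x))"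

context
  fixes S t star
  assumes S: "string_system S t star"
begin

lemma string_finite: "finite S"
  and string_star: "x \<in> S \<Longrightarrow> star x \<in> S"
  and string_top: "x \<in> S \<Longrightarrow> (u ^^ Suc (t x)) x = 0"
  and string_pairing: "x \<in> S \<Longrightarrow> y \<in> S \<Longrightarrow> b x ((u ^^ j) y) \<noteq> 0 \<longleftrightarrow> y = star x \<and> j = t x"
  using S unfolding string_system_def by blast+

text \<open>By the swap rule the nonzero pairing of \<open>x\<close> with its dual string can be
  read from the side of \<open>star x\<close>, and the uniqueness in \<open>string_pairing\<close>
  then identifies partner and exponent.\<close>

lemma string_star_star: "x \<in> S \<Longrightarrow> star (star x) = x"
  and string_t_star: "x \<in> S \<Longrightarrow> t (star x) = t x"
proof -
  assume x: "x \<in> S"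
  have "b (star x) ((u ^^ t x) x) \<noteq> 0"
    using string_pairing[OF x string_star[OF x], of "t x"] b_upow_swap by (metis mult_zero_right)
  then show "star (star x) = x" "t (star x) = t x"
    using string_pairing[OF string_star[OF x] x] by metis+
qed

lemma string_pairing':
  assumes "x \<in> S" "y \<in> S"
  shows "b ((u ^^ i) x) ((u ^^ j) y) \<noteq> 0 \<longleftrightarrow> y = star x \<and> i + j = t x"
  using string_pairing[OF assms] by (simp add: b_upow)

text \<open>For \<open>j \<le> t x\<close>, the only string vector pairing nontrivially with
  \<open>(u ^^ (t x - j)) (star x)\<close> is \<open>(u ^^ j) x\<close>, so the quotient is the
  coordinate along \<open>(u ^^ j) x\<close>.\<close>

definition string_coeff :: "'b \<Rightarrow> nat \<Rightarrow> 'b \<Rightarrow> 'a" where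
  "string_coeff x j z =
     b z ((u ^^ (t x - j)) (star x)) / b ((u ^^ j) x) ((u ^^ (t x - j)) (star x))"

lemma string_denominator:
  "x \<in> S \<Longrightarrow> j \<le> t x \<Longrightarrow> b ((u ^^ j) x) ((u ^^ (t x - j)) (star x)) \<noteq> 0"
  using string_pairing'[OF _ string_star] by simp

lemma string_coeff_basis:
  assumes "x \<in> S" "y \<in> S" "j \<le> t x"
  shows "string_coeff x j ((u ^^ i) y) = (if y = x \<and> i = j then 1 else 0)"
proof -
  have "b ((u ^^ i) y) ((u ^^ (t x - j)) (star x)) \<noteq> 0 \<longleftrightarrow> y = x \<and> i = j"
    using string_pairing'[OF assms(2) string_star[OF assms(1)], of i "t x - j"] assms
      string_star_star by (metis add.commute add_diff_cancel_left' le_add_diff_inverse2 add_right_cancel)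
  then show ?thesis using string_denominator[OF assms(1,3)] by (auto simp: string_coeff_def)
qed

lemma string_coeff_linear:
  "string_coeff x j (z + z') = string_coeff x j z + string_coeff x j z'"
  "string_coeff x j (c *s z) = c * string_coeff x j z"
  "string_coeff x j (\<Sum>i\<in>I. f i) = (\<Sum>i\<in>I. string_coeff x j (f i))"
  by (simp_all add: string_coeff_def b_simps add_divide_distrib b_sum_left sum_divide_distrib)

lemma string_coeff_perp:
  "x \<in> S \<Longrightarrow> z \<in> perp (u_span S) \<Longrightarrow> string_coeff x j z = 0"
  using u_span_base[OF string_star, of x "t x - j"] by (auto simp: string_coeff_def perp_def b_commute)

definition string_proj :: "'b \<Rightarrow> 'b" where
  "string_proj z = (\<Sum>x\<in>S. \<Sum>j\<le>t x. string_coeff x j z *s (u ^^ j) x)"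

lemma string_sum_delta:
  assumes "x \<in> S" "j \<le> t x"
  shows "(\<Sum>y\<in>S. \<Sum>i\<le>t y. f y i * (if y = x \<and> i = j then 1 else 0)) = (f x j :: 'a)"
proof -
  have "(\<Sum>i\<le>t y. f y i * (if y = x \<and> i = j then 1 else 0)) = (if y = x then f x j else 0)" for y
    using assms by (cases "y = x") (simp_all add: if_distrib cong: if_cong)
  then show ?thesis using assms string_finite by simp
qed

lemma string_coeff_proj:
  assumes "x \<in> S" "j \<le> t x"
  shows "string_coeff x j (string_proj z) = string_coeff x j z"
  unfolding string_proj_def string_coeff_linear
  using string_sum_delta[OF assms, of "\<lambda>y i. string_coeff y i z"] assms string_coeff_basis
  by simp

lemma string_proj_in: "string_proj z \<in> u_span S"
  unfolding string_proj_def by (intro subspace_sum subspace_scale u_span_base) auto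

lemma string_proj_perp: "z - string_proj z \<in> perp (u_span S)"
proof (rule perp_u_spanI)
  fix y m assume y: "y \<in> S"
  show "b ((u ^^ m) y) (z - string_proj z) = 0"
  proof (cases "m \<le> t y")
    case True
    \<comment> \<open>The vector \<open>(u ^^ m) y\<close> is the dual vector that reads the
      coordinate of \<open>star y\<close> at exponent \<open>t y - m\<close>.\<close>
    let ?x = "star y" and ?j = "t y - m"
    have x: "?x \<in> S" "?j \<le> t ?x" "star ?x = y" "t ?x - ?j = m"
      using y True by (auto simp: string_star string_t_star string_star_star)
    have "string_coeff ?x ?j (z - string_proj z) = 0"
      using string_coeff_proj[OF x(1,2), of z] string_coeff_linear(1)[of ?x ?j "z - string_proj z" "string_proj z"]
      by simp
    then show ?thesis
      using string_denominator[OF x(1,2)] x by (simp add: string_coeff_def b_commute)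
  next
    case False
    then show ?thesis using upow_zero_mono[OF string_top[OF y], of m] by simp
  qed
qed

lemma string_decomposition: "\<exists>p\<in>u_span S. \<exists>q\<in>perp (u_span S). z = p + q"
  using string_proj_in string_proj_perp by (metis add.commute diff_add_cancel)

lemma string_proj_full: "u_span S = UNIV \<Longrightarrow> string_proj z = z"
proof -
  assume "u_span S = UNIV"
  then have "b (z - string_proj z) y = 0" for y
    using string_proj_perp[of z] by (auto simp: perp_def b_commute)
  then show ?thesis using eq_0_if_b_eq_0[of "z - string_proj z"] by simp
qed

text \<open>Bounds the number of strings by the dimension, so that a system of maximal cardinality
  exists.\<close>

lemma string_independent: "independent S"
proof (rule independent_if_scalars_zero[OF string_finite])
  fix f x assume *: "(\<Sum>y\<in>S. f y *s y) = 0" "x \<in> S"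
  have "string_coeff x 0 (\<Sum>y\<in>S. f y *s y) = (\<Sum>y\<in>S. f y * (if y = x then 1 else 0))"
    unfolding string_coeff_linear
    using string_coeff_basis[OF *(2), of _ 0 0] by (intro sum.cong) auto
  also have "\<dots> = f x" using *(2) string_finite by (simp add: if_distrib cong: if_cong)
  finally show "f x = 0" using * string_coeff_linear(2)[of x 0 0 0] by simp
qed

lemma string_nondegenerate_perp: "nondegenerate_on (perp (u_span S))"
proof -
  have "nondegenerate_on UNIV" using eq_0_if_b_eq_0 by (simp add: nondegenerate_on_def)
  then have "nondegenerate_on (UNIV \<inter> perp (u_span S))"
    using string_proj_in string_proj_perp by (intro nondegenerate_on_complement) (auto intro: span_base)
  then show ?thesis by simp
qed

end

section \<open>Operators \<open>v\<close> with \<open>u v = - v u\<close> and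
  \<open>v\<^sup>2 = - u\<^sup>2\<close>\<close>

text \<open>Such a \<open>v\<close> is the difference \<open>a1 - a2\<close> in a decomposition \<open>u = a1 + a2\<close> on \<open>u_span X\<close>.\<close>

definition splits :: "('b \<Rightarrow> 'b) \<Rightarrow> 'b set \<Rightarrow> bool" where
  "splits v X \<longleftrightarrow> endomorphism v \<and> (\<forall>x y. b (v x) y = \<eta> * b x (v y)) \<and>
     (\<forall>x. u (v x) = - v (u x)) \<and> range v \<subseteq> u_span X \<and> (\<forall>z\<in>u_span X. v (v z) = - u (u z))"

definition splitting :: "'b set \<Rightarrow> bool" where
  "splitting X \<longleftrightarrow> (\<exists>v. splits v X)"

lemma splitsD:
  assumes "splits v X"
  shows "endomorphism v" "b (v x) y = \<eta> * b x (v y)" "u (v x) = - v (u x)"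
    "v x \<in> u_span X" "z \<in> u_span X \<Longrightarrow> v (v z) = - u (u z)" "v (x + y) = v x + v y" "v (c *s x) = c *s v x"
  using assms unfolding splits_def Vector_Spaces.linear_iff by auto

text \<open>As \<open>range v\<close> lies in \<open>u_span X\<close> and \<open>v\<close> is its
  own adjoint up to sign, \<open>v\<close> vanishes on everything orthogonal to
  \<open>u_span X\<close>. Splittings of orthogonal pieces therefore add without cross
  terms.\<close>

lemma splitting_Un:
  assumes "splitting X" "splitting Y" "u_orthogonal X Y"
  shows "splitting (X \<union> Y)"
proof -
  obtain v w where "splits v X" "splits w Y"
    using assms unfolding splitting_def by blast
  note v = splitsD[OF this(1)] and w = splitsD[OF this(2)]
  have v0: "v z = 0" if "z \<in> u_span Y" for z
  proof (rule eq_0_if_b_eq_0)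
    fix y show "b (v z) y = 0"
      using u_orthogonal_u_span[OF assms(3), of "v y" z] v(2)[of z y] v(4) that b_commute[of z] by auto
  qed
  have w0: "w z = 0" if "z \<in> u_span X" for z
  proof (rule eq_0_if_b_eq_0)
    fix y show "b (w z) y = 0"
      using u_orthogonal_u_span[OF assms(3), of z "w y"] w(2)[of z y] w(4) that by auto
  qed
  have sub: "u_span X \<subseteq> u_span (X \<union> Y)" "u_span Y \<subseteq> u_span (X \<union> Y)"
    using subset_u_span[of "X \<union> Y"] by (intro u_span_mono; blast)+
  define f where "f = (\<lambda>x. v x + w x)"
  have "endomorphism f"
    by (rule endomorphismI) (simp_all add: f_def v w scale_right_distrib)
  moreover have "b (f x) y = \<eta> * b x (f y)" for x y
    by (simp add: f_def b_simps v w distrib_left)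
  moreover have "u (f x) = - f (u x)" for x
    by (simp add: f_def u_add v w)
  moreover have "range f \<subseteq> u_span (X \<union> Y)"
    using v(4) w(4) sub by (auto simp: f_def intro!: subspace_add[OF subspace_u_span] intro: subsetD)
  moreover have "f (f z) = - u (u z)" if z: "z \<in> u_span (X \<union> Y)" for z
  proof -
    have "u_span (X \<union> Y) \<subseteq> {x + y | x y. x \<in> u_span X \<and> y \<in> u_span Y}"
      using u_span_base[of _ X] u_span_base[of _ Y] subspace_0[OF subspace_u_span]
      by (intro u_span_minimal subspace_sums subspace_u_span)
        (auto, (metis add.right_neutral add.left_neutral)+)
    then obtain x y where xy: "x \<in> u_span X" "y \<in> u_span Y" "z = x + y" using z by blast
    have "v x \<in> u_span X" "w y \<in> u_span Y" using v(4) w(4) by auto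
    then show ?thesis using xy v0 w0 by (simp add: f_def v(5,6) w(5,6) u_add)
  qed
  ultimately show ?thesis unfolding splitting_def splits_def by blast
qed

lemma splitting_zero:
  assumes "\<And>x. x \<in> X \<Longrightarrow> u x = 0"
  shows "splitting X"
proof -
  have "u_span X \<subseteq> {x. (u ^^ 1) x \<in> {0}}"
    using assms subspace_vimage_u[of "{0}" 1]
    by (intro u_span_minimal) (auto simp: upow_u[symmetric] subspace_def)
  then have "u (u z) = 0" if "z \<in> u_span X" for z
    using that u_scale[of 0 0] by auto
  moreover have "u 0 = 0" using u_scale[of 0 0] by simp
  ultimately show ?thesis
    unfolding splitting_def splits_def
    by (intro exI[of _ "\<lambda>_. 0"]) (auto intro!: endomorphismI subspace_0)
qed

lemma splitting_UN:
  assumes "finite I" "\<And>i. i \<in> I \<Longrightarrow> splitting (X i)"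
    and "\<And>i j. i \<in> I \<Longrightarrow> j \<in> I \<Longrightarrow> i \<noteq> j \<Longrightarrow> u_orthogonal (X i) (X j)"
  shows "splitting (\<Union>i\<in>I. X i)"
  using assms
proof (induction I)
  case empty
  show ?case by (rule splitting_zero) simp
next
  case (insert i I)
  have "u_orthogonal (X i) (\<Union>j\<in>I. X j)"
    using insert.prems(2)[of i] insert.hyps(2) unfolding u_orthogonal_def by (metis UN_E insertCI)
  then show ?case
    using insert by (auto intro!: splitting_Un)
qed

text \<open>The witness satisfies \<open>v (u\<^sup>j x) = (-1)\<^sup>j u\<^sup>j (w x)\<close> for \<open>x \<in> T\<close> and vanishes on the orthogonal of the strings.\<close>

lemma splitting_string_system:
  assumes T: "string_system T t star"
    and top: "\<And>x. x \<in> T \<Longrightarrow> (u ^^ Suc (t x)) (w x) = 0"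
    and adj: "\<And>x y m. x \<in> T \<Longrightarrow> y \<in> T \<Longrightarrow> b (w x) ((u ^^ m) y) = \<eta> * (- 1) ^ m * b x ((u ^^ m) (w y))"
    and square: "\<And>x. x \<in> T \<Longrightarrow> \<exists>c r x'. x' \<in> T \<and> w x = c *s (u ^^ r) x' \<and>
      (c * (- 1) ^ r) *s (u ^^ r) (w x') = - u (u x)"
  shows "splitting T"
proof -
  \<comment> \<open>The values \<open>w x\<close> at the generators determine \<open>v\<close> on
    the strings; the factor \<open>(- 1) ^ j\<close> is forced by
    \<open>u v = - v u\<close>.\<close>
  define v where "v z = (\<Sum>x\<in>T. \<Sum>j\<le>t x. (string_coeff t star x j z * (- 1) ^ j) *s (u ^^ j) (w x))" for z
  note coeff = string_coeff_linear[OF T]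
  have add: "v (x + y) = v x + v y" for x y
    by (simp add: v_def coeff distrib_right scale_left_distrib sum.distrib)
  have scale: "v (c *s x) = c *s v x" for c x
    by (simp only: v_def coeff(2) scale_sum_right scale_scale mult.assoc)
  have lin: "endomorphism v" by (rule endomorphismI[OF add scale])
  have v_base: "v ((u ^^ i) y) = (- 1) ^ i *s (u ^^ i) (w y)" if y: "y \<in> T" for y i
  proof (cases "i \<le> t y")
    case True
    have "(\<Sum>j\<le>t x. (string_coeff t star x j ((u ^^ i) y) * (- 1) ^ j) *s (u ^^ j) (w x)) =
      (if x = y then (- 1) ^ i *s (u ^^ i) (w y) else 0)" if "x \<in> T" for x
    proof -
      have "(\<Sum>j\<le>t x. (string_coeff t star x j ((u ^^ i) y) * (- 1) ^ j) *s (u ^^ j) (w x)) =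
        (\<Sum>j\<le>t x. if j = i then (if y = x then (- 1) ^ i *s (u ^^ i) (w x) else 0) else 0)"
        using string_coeff_basis[OF T that y] by (intro sum.cong) auto
      then show ?thesis using True by auto
    qed
    then have "v ((u ^^ i) y) = (\<Sum>x\<in>T. if x = y then (- 1) ^ i *s (u ^^ i) (w y) else 0)"
      unfolding v_def by (rule sum.cong[OF refl])
    then show ?thesis using y string_finite[OF T] by simp
  next
    case False
    then have "(u ^^ i) y = 0" "(u ^^ i) (w y) = 0"
      using upow_zero_mono[OF string_top[OF T y], of i] upow_zero_mono[OF top[OF y], of i] by auto
    then show ?thesis using scale[of 0 0] by simp
  qed
  have v_perp: "v z = 0" if "z \<in> perp (u_span T)" for z
    using string_coeff_perp[OF T _ that] by (simp add: v_def)
  have w_in: "w x \<in> u_span T" if "x \<in> T" for x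
    using square[OF that] by (auto intro!: subspace_scale u_span_base)
  have range: "v z \<in> u_span T" for z
    unfolding v_def by (intro subspace_sum subspace_scale u_span_stable w_in) auto
  \<comment> \<open>String vectors together with the orthogonal of the strings generate the space,
    so adjointness and anticommutation need only be checked on them.\<close>
  let ?G = "{(u ^^ j) x | x j. x \<in> T} \<union> perp (u_span T)"
  have UNIV: "z \<in> span ?G" for z
  proof -
    obtain p q where "p \<in> u_span T" "q \<in> perp (u_span T)" "z = p + q"
      using string_decomposition[OF T] by blast
    then show ?thesis unfolding u_span_def
      by (auto intro!: span_add intro: span_base span_mono[THEN subsetD, rotated])
  qed
  have adj_base: "b (v x) y = \<eta> * b x (v y)" if "x \<in> ?G" "y \<in> ?G" for x y
  proof -
    have perp: "b x' y' = 0" "b y' x' = 0" if "x' \<in> u_span T" "y' \<in> perp (u_span T)" for x' y'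
      using that b_commute by (auto simp: perp_def)
    consider x' i y' j where "x' \<in> T" "y' \<in> T" "x = (u ^^ i) x'" "y = (u ^^ j) y'"
      | "x \<in> perp (u_span T)" | "y \<in> perp (u_span T)" using \<open>x \<in> ?G\<close> \<open>y \<in> ?G\<close> by blast
    then show ?thesis
    proof cases
      case 1
      let ?B = "b x' ((u ^^ (i + j)) (w y'))"
      have "b (v x) y = (- 1) ^ i * (\<eta> ^ i * (\<eta> * (- 1) ^ (i + j) * ?B))"
        by (simp only: 1 v_base b_scale_left b_upow adj)
      also have "\<dots> = ((- 1) ^ i * (- 1) ^ i) * (\<eta> * ((- 1) ^ j * (\<eta> ^ i * ?B)))"
        by (simp only: power_add ac_simps)
      also have "(- 1) ^ i * (- 1) ^ i = (1::'a)" by (simp flip: power_mult_distrib)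
      also have "1 * (\<eta> * ((- 1) ^ j * (\<eta> ^ i * ?B))) = \<eta> * b x (v y)"
        by (simp only: 1 v_base b_scale_right b_upow mult_1_left)
      finally show ?thesis .
    qed (simp_all add: v_perp perp range)
  qed
  have "b (v x) y - \<eta> * b x (v y) = 0" for x y
    by (rule span_bilinear_eq_0[OF _ _ _ _ UNIV UNIV])
      (simp_all add: adj_base b_add_left b_add_right b_scale_left b_scale_right add scale algebra_simps)
  then have "b (v x) y = \<eta> * b x (v y)" for x y by simp
  moreover have "u (v x) = - v (u x)" for x
  proof -
    have "subspace {x. u (v x) = - v (u x)}"
      using scale[of 0 0] u_scale[of 0 0] by (simp add: subspace_def add scale u_add u_scale)
    moreover have "?G \<subseteq> {x. u (v x) = - v (u x)}"
    proof -
      have "u (v ((u ^^ j) y)) = - v (u ((u ^^ j) y))" if "y \<in> T" for y j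
        using v_base[OF that, of j] v_base[OF that, of "Suc j"] by (simp add: u_scale)
      moreover have "u (v z) = - v (u z)" if "z \<in> perp (u_span T)" for z
        using v_perp[OF that] v_perp[OF perp_u_span_stable[OF that, of 1]] u_scale[of 0 0] by simp
      ultimately show ?thesis by blast
    qed
    ultimately show ?thesis using span_minimal[of ?G] UNIV[of x] by blast
  qed
  moreover have "v (v z) = - u (u z)" if "z \<in> u_span T" for z
  proof -
    have "u_span T \<subseteq> {z. v (v z) = - u (u z)}"
    proof (rule u_span_minimal)
      show "subspace {z. v (v z) = - u (u z)}"
        using scale[of 0 0] u_scale[of 0 0] by (simp add: subspace_def add scale u_add u_scale)
    next
      fix y i assume y: "y \<in> T"
      obtain c r x' where x': "x' \<in> T" "w y = c *s (u ^^ r) x'"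
        "(c * (- 1) ^ r) *s (u ^^ r) (w x') = - u (u y)" using square[OF y] by blast
      \<comment> \<open>Passing \<open>v\<close> through \<open>u\<^sup>i\<close> twice cancels the
        sign \<open>(- 1) ^ i\<close>; what remains is the sign \<open>(- 1) ^ r\<close> built into
        the assumption \<open>square\<close>.\<close>
      have "v (v ((u ^^ i) y)) = ((- 1) ^ i * c) *s v ((u ^^ (i + r)) x')"
        by (simp add: v_base[OF y] scale x'(2) upow_scale upow_upow)
      also have "\<dots> = ((- 1) ^ i * c * (- 1) ^ (i + r)) *s (u ^^ (i + r)) (w x')"
        by (simp add: v_base[OF x'(1)])
      also have "(- 1) ^ i * c * (- 1) ^ (i + r) = c * (- 1) ^ r"
      proof -
        have "(- 1) ^ i * c * (- 1) ^ (i + r) = c * (- 1) ^ r * ((- 1) ^ i * (- 1) ^ i)"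
          by (simp only: power_add ac_simps)
        also have "(- 1) ^ i * (- 1) ^ i = (1::'a)" by (simp flip: power_mult_distrib)
        finally show ?thesis by simp
      qed
      also have "(c * (- 1) ^ r) *s (u ^^ (i + r)) (w x') = (u ^^ i) ((c * (- 1) ^ r) *s (u ^^ r) (w x'))"
        by (simp only: upow_scale upow_upow)
      also have "\<dots> = - u (u ((u ^^ i) y))"
        unfolding x'(3) by (simp add: upow_minus upow_u)
      finally show "(u ^^ i) y \<in> {z. v (v z) = - u (u z)}" by simp
    qed
    then show ?thesis using that by blast
  qed
  ultimately show ?thesis
    unfolding splitting_def splits_def using lin range by (intro exI[of _ v]) auto
qed

definition square_zero_sum :: bool where
  "square_zero_sum \<longleftrightarrow> (\<exists>a1 a2. endomorphism a1 \<and> endomorphism a2 \<and>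
     (\<forall>x y. b (a1 x) y = \<eta> * b x (a1 y)) \<and> (\<forall>x y. b (a2 x) y = \<eta> * b x (a2 y)) \<and>
     a1 \<circ> a1 = (\<lambda>_. 0) \<and> a2 \<circ> a2 = (\<lambda>_. 0) \<and> u = (\<lambda>x. a1 x + a2 x))"

lemma square_zero_sum_if_splitting:
  assumes "splitting X" "u_span X = UNIV"
  shows square_zero_sum
proof -
  obtain v where "splits v X"
    using assms unfolding splitting_def by blast
  note v = splitsD[OF this]
  have vv: "v (v z) = - u (u z)" for z using v(5) assms(2) by simp
  note add = v(6,7)
  have neg: "v (- x) = - v x" for x using add(2)[of "-1" x] by simp
  have diff: "v (x - y) = v x - v y" "u (x - y) = u x - u y" for x y
    using add(1)[of x "- y"] upow_diff[of 1] by (simp_all add: neg)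
  define h where "h = (1 / 2 :: 'a)"
  have h: "h *s x + h *s x = x" for x
    using two_neq_0 by (simp add: h_def flip: scale_left_distrib)
  define a1 a2 where "a1 x = h *s (u x + v x)" and "a2 x = h *s (u x - v x)" for x
  have "endomorphism a1"
    by (rule endomorphismI) (simp_all add: a1_def add u_add u_scale scale_right_distrib mult.commute)
  moreover have "endomorphism a2"
    by (rule endomorphismI)
      (simp_all add: a2_def add u_add u_scale scale_right_distrib scale_right_diff_distrib mult.commute)
  moreover have "b (a1 x) y = \<eta> * b x (a1 y)" "b (a2 x) y = \<eta> * b x (a2 y)" for x y
    by (simp_all add: a1_def a2_def b_simps adjoint v(2) distrib_left right_diff_distrib mult.left_commute)
  moreover have "a1 (a1 x) = 0" "a2 (a2 x) = 0" for x
    by (simp_all add: a1_def a2_def add diff u_add u_scale v(3) vv scale_right_distrib scale_right_diff_distrib)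
  moreover have "a1 x + a2 x = u x" for x
    using h[of "u x"] by (simp add: a1_def a2_def scale_right_distrib scale_right_diff_distrib)
  ultimately show ?thesis unfolding square_zero_sum_def by (intro exI[of _ a1] exI[of _ a2]) auto
qed

section \<open>Existence of a decomposition into strings\<close>

text \<open>For a vector \<open>x\<close> with \<open>b x (u\<^sup>m x) \<noteq> 0\<close>, adding a multiple of \<open>u\<^sup>m\<^sup>-\<^sup>j x\<close> to \<open>x\<close> makes \<open>b x (u\<^sup>j x)\<close> vanish
  without affecting \<open>b x (u\<^sup>i x)\<close> for \<open>i > j\<close>; this is done successively for \<open>j = m - 1, \<dots>, 0\<close>.\<close>

lemma string_extension_self:
  assumes Q: "\<And>x j. x \<in> Q \<Longrightarrow> (u ^^ j) x \<in> Q" "subspace Q"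
    and m: "\<And>x. x \<in> Q \<Longrightarrow> (u ^^ Suc m) x = 0"
    and x0: "x0 \<in> Q" "b x0 ((u ^^ m) x0) \<noteq> 0"
  shows "\<exists>T t star. string_system T t star \<and> (\<forall>x\<in>T. even (t x) \<longrightarrow> star x = x) \<and> T \<noteq> {} \<and> T \<subseteq> Q"
proof -
  have top: "b x ((u ^^ i) y) = 0" if "y \<in> Q" "i > m" for x y i
    using upow_zero_mono[OF m[OF that(1)], of i] that by simp
  have "\<exists>x\<in>Q. b x ((u ^^ m) x) \<noteq> 0 \<and> (\<forall>j. n \<le> j \<and> j < m \<longrightarrow> b x ((u ^^ j) x) = 0)"
    if "n \<le> m" for n
    using that
  proof (induction rule: inc_induct)
    case base
    then show ?case using x0 by auto
  next
    case (step n)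
    obtain x where x: "x \<in> Q" "b x ((u ^^ m) x) \<noteq> 0"
      "\<And>j. Suc n \<le> j \<Longrightarrow> j < m \<Longrightarrow> b x ((u ^^ j) x) = 0"
      using step by (auto simp: Suc_le_eq)
    show ?case
    proof (cases "b x ((u ^^ n) x) = 0")
      case True
      then have "b x ((u ^^ j) x) = 0" if "n \<le> j" "j < m" for j
        using x(3)[of j] that by (cases "j = n") auto
      then show ?thesis using x by auto
    next
      case False
      define r' where "r' = m - n"
      \<comment> \<open>A nonzero self-pairing at exponent \<open>j\<close> forces
        \<open>\<eta> ^ j = 1\<close>. Hence \<open>\<eta> ^ r' = 1\<close>, and the two cross terms
        in \<open>b y (u\<^sup>j y)\<close> agree.\<close>
      have "\<eta> ^ n = 1" "\<eta> ^ m = 1"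
        using b_upow_swap[of x n x] b_upow_swap[of x m x] False x(2) by auto
      then have eta: "\<eta> ^ r' = 1" using step.hyps power_add[of \<eta> n r'] by (simp add: r'_def)
      \<comment> \<open>Solves \<open>b x (u\<^sup>n x) + 2 c b x (u\<^sup>m x) = 0\<close>; the
        quadratic term has exponent \<open>n + 2 r' > m\<close> and vanishes.\<close>
      define c where "c = - b x ((u ^^ n) x) / (2 * b x ((u ^^ m) x))"
      define y where "y = x + c *s (u ^^ r') x"
      have y: "b y ((u ^^ j) y) = b x ((u ^^ j) x) + 2 * c * b x ((u ^^ (j + r')) x) +
        c * c * b x ((u ^^ (j + 2 * r')) x)" for j
      proof -
        have 1: "(u ^^ j) y = (u ^^ j) x + c *s (u ^^ (j + r')) x"
          by (simp add: y_def upow_add upow_scale upow_upow)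
        have 2: "b ((u ^^ r') x) ((u ^^ i) x) = b x ((u ^^ (i + r')) x)" for i
          by (simp add: b_upow eta add.commute)
        have 3: "j + 2 * r' = j + r' + r'" by simp
        show ?thesis
          unfolding 1 3 by (simp add: y_def b_add_left b_add_right b_scale_left b_scale_right 2 distrib_left)
      qed
      have "r' > 0" "n + r' = m" "n + 2 * r' > m" using step.hyps by (auto simp: r'_def)
      then have "b y ((u ^^ m) y) = b x ((u ^^ m) x)"
        using top[OF x(1), of "m + r'" x] top[OF x(1), of "m + 2 * r'" x] by (simp add: y)
      moreover have "b y ((u ^^ j) y) = 0" if "n \<le> j" "j < m" for j
      proof (cases "j = n")
        case True
        then show ?thesis
          using y[of n] \<open>n + r' = m\<close> top[OF x(1) \<open>n + 2 * r' > m\<close>] x(2) two_neq_0 by (simp add: c_def)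
      next
        case False
        then have "j + r' > m" "j + 2 * r' > m" "Suc n \<le> j" using that \<open>n + r' = m\<close> by auto
        then show ?thesis using y[of j] top[OF x(1)] x(3) that by simp
      qed
      moreover have "y \<in> Q" using x(1) Q by (auto simp: y_def intro!: subspace_add subspace_scale)
      ultimately show ?thesis using x(2) by (intro bexI[of _ y]) auto
    qed
  qed
  from this[of 0] obtain x where x: "x \<in> Q" "b x ((u ^^ m) x) \<noteq> 0" "\<And>j. j < m \<Longrightarrow> b x ((u ^^ j) x) = 0"
    by auto
  then have "string_system {x} (\<lambda>_. m) id"
    using m[OF x(1)] top[OF x(1), of _ x] unfolding string_system_def
    by (auto simp del: funpow.simps) (metis nat_neq_iff)
  then show ?thesis using x(1) by (intro exI[of _ "{x}"] exI[of _ "\<lambda>_. m"] exI[of _ id]) auto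
qed

text \<open>The remaining case: \<open>b x (u\<^sup>m y)\<close> is alternating, so strings come in pairs, corrected in the same way.\<close>

lemma string_extension_pair:
  assumes Q: "\<And>x j. x \<in> Q \<Longrightarrow> (u ^^ j) x \<in> Q" "subspace Q"
    and m: "\<And>x. x \<in> Q \<Longrightarrow> (u ^^ Suc m) x = 0"
    and xy0: "x0 \<in> Q" "y0 \<in> Q" "b x0 ((u ^^ m) y0) \<noteq> 0"
    and alternating: "\<And>x. x \<in> Q \<Longrightarrow> b x ((u ^^ m) x) = 0"
  shows "\<exists>T t star. string_system T t star \<and> (\<forall>x\<in>T. even (t x) \<longrightarrow> star x = x) \<and> T \<noteq> {} \<and> T \<subseteq> Q"
proof -
  have top: "b x ((u ^^ i) y) = 0" if "y \<in> Q" "i > m" for x y i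
    using upow_zero_mono[OF m[OF that(1)], of i] that by simp
  \<comment> \<open>For even \<open>m\<close> the pairing at exponent \<open>m\<close> would be
    symmetric as well as alternating, hence zero in characteristic other than 2.\<close>
  have eta_m: "odd m"
  proof
    assume "even m"
    then have "\<eta> ^ m = 1" using eta_square by (auto elim!: evenE simp: power_mult power2_eq_square)
    then have "2 * b x0 ((u ^^ m) y0) = b (x0 + y0) ((u ^^ m) (x0 + y0))"
      using alternating[OF xy0(1)] alternating[OF xy0(2)] b_upow_swap[of y0 m x0]
      by (simp add: upow_add b_simps)
    also have "\<dots> = 0" using alternating subspace_add[OF Q(2)] xy0 by blast
    finally show False using xy0 two_neq_0 by simp
  qed
  have "\<exists>x\<in>Q. \<exists>y\<in>Q. b x ((u ^^ m) y) \<noteq> 0 \<and> (\<forall>j. n \<le> j \<and> j < m \<longrightarrow>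
      b x ((u ^^ j) x) = 0 \<and> b y ((u ^^ j) y) = 0 \<and> b x ((u ^^ j) y) = 0)"
    if "n \<le> m" for n
    using that
  proof (induction rule: inc_induct)
    case base
    then show ?case using xy0 by (intro bexI[of _ x0] bexI[of _ y0]) auto
  next
    case (step n)
    obtain x y where xy: "x \<in> Q" "y \<in> Q" "b x ((u ^^ m) y) \<noteq> 0"
      "\<And>j. Suc n \<le> j \<Longrightarrow> j < m \<Longrightarrow> b x ((u ^^ j) x) = 0 \<and> b y ((u ^^ j) y) = 0 \<and> b x ((u ^^ j) y) = 0"
      using step by (auto simp: Suc_le_eq)
    define r' where "r' = m - n"
    define P where "P = b x ((u ^^ m) y)"
    \<comment> \<open>The three scalars cancel, at exponent \<open>n\<close>, the pairings of
      \<open>x\<close> with \<open>x\<close>, of \<open>y\<close> with \<open>y\<close> and of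
      \<open>x\<close> with \<open>y\<close>. Only first-order terms count, since two shifts by
      \<open>r'\<close> lead beyond exponent \<open>m\<close>.\<close>
    define \<alpha> where "\<alpha> = - b x ((u ^^ n) x) / (2 * P)"
    define \<beta> where "\<beta> = - (\<eta> ^ r' * b y ((u ^^ n) y)) / (2 * P)"
    define \<gamma> where "\<gamma> = - b x ((u ^^ n) y) / P"
    define x' where "x' = x + \<alpha> *s (u ^^ r') y"
    define y' where "y' = y + \<beta> *s (u ^^ r') x + \<gamma> *s (u ^^ r') y"
    have r': "n + r' = m" "r' > 0" using step.hyps by (auto simp: r'_def)
    have vanish: "b z ((u ^^ (j + (r' + r'))) w) = 0" if "w \<in> Q" "n \<le> j" for z w j
      using that r' by (intro top) auto
    have xx: "b x' ((u ^^ j) x') = b x ((u ^^ j) x) + \<alpha> * (1 + \<eta> ^ j) * b x ((u ^^ (j + r')) y)"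
      if "n \<le> j" for j
      using vanish[OF xy(2) that, of y] b_upow_swap[of y "j + r'" x] eta_power_square(2)[of r']
      by (simp add: x'_def b_simps upow_add upow_scale b_upow upow_upow power_add ring_distribs ac_simps)
    have yy: "b y' ((u ^^ j) y') = b y ((u ^^ j) y) + \<beta> * \<eta> ^ r' * (1 + \<eta> ^ j) * b x ((u ^^ (j + r')) y)
      + \<gamma> * (1 + \<eta> ^ r') * b y ((u ^^ (j + r')) y)" if "n \<le> j" for j
      using vanish[OF xy(2) that] vanish[OF xy(1) that] b_upow_swap[of y "j + r'" x]
      by (simp add: y'_def b_simps upow_add upow_scale b_upow upow_upow power_add ring_distribs ac_simps)
    have xy': "b x' ((u ^^ j) y') = b x ((u ^^ j) y) + \<beta> * b x ((u ^^ (j + r')) x)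
      + \<gamma> * b x ((u ^^ (j + r')) y) + \<alpha> * \<eta> ^ r' * b y ((u ^^ (j + r')) y)" if "n \<le> j" for j
      using vanish[OF xy(2) that] vanish[OF xy(1) that]
      by (simp add: x'_def y'_def b_simps upow_add upow_scale b_upow upow_upow ring_distribs ac_simps)
    have Pm: "b x' ((u ^^ m) y') \<noteq> 0"
      using xy'[of m] r' xy(3) top[OF xy(1), of "m + r'"] top[OF xy(2), of "m + r'"] by simp
    \<comment> \<open>If \<open>\<eta> ^ j = - 1\<close>, the self-pairing at exponent
      \<open>j\<close> is already zero. So \<open>1 + \<eta> ^ n\<close> acts on it as the factor 2
      in the denominators of \<open>\<alpha>\<close> and \<open>\<beta>\<close>.\<close>
    have sym: "\<eta> ^ j * b z ((u ^^ j) z) = b z ((u ^^ j) z)" for j z using b_upow_swap[of z j z] by simp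
    have "b x' ((u ^^ j) x') = 0 \<and> b y' ((u ^^ j) y') = 0 \<and> b x' ((u ^^ j) y') = 0"
      if j: "n \<le> j" "j < m" for j
    proof (cases "j = n")
      case True
      have P: "P \<noteq> 0" "b x ((u ^^ (n + r')) y) = P" using xy(3) r' by (auto simp: P_def)
      have "\<alpha> * (1 + \<eta> ^ n) * P = - (b x ((u ^^ n) x) + \<eta> ^ n * b x ((u ^^ n) x)) / 2"
        using P two_neq_0 by (simp add: \<alpha>_def field_simps)
      also have "\<dots> = - b x ((u ^^ n) x)" unfolding sym using two_neq_0 by (simp add: field_simps)
      finally have 1: "b x' ((u ^^ n) x') = 0" using xx[of n] P by simp
      have "\<beta> * \<eta> ^ r' * (1 + \<eta> ^ n) * P = - (\<eta> ^ r' * \<eta> ^ r') * (b y ((u ^^ n) y) + \<eta> ^ n * b y ((u ^^ n) y)) / 2"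
        using P two_neq_0 by (simp add: \<beta>_def field_simps del: eta_power_square)
      also have "\<dots> = - b y ((u ^^ n) y)" unfolding sym using two_neq_0 by (simp add: field_simps)
      finally have 2: "b y' ((u ^^ n) y') = 0" using yy[of n] P r' alternating[OF xy(2)] by simp
      have 3: "b x' ((u ^^ n) y') = 0"
        using xy'[of n] P r' alternating[OF xy(2)] alternating[OF xy(1)] by (simp add: \<gamma>_def)
      show ?thesis using 1 2 3 True by simp
    next
      case False
      then have "j + r' > m" "Suc n \<le> j" using that r' by auto
      then show ?thesis using xx[OF j(1)] yy[OF j(1)] xy'[OF j(1)] top[OF xy(1)] top[OF xy(2)] xy(4) j by simp
    qed
    moreover have "x' \<in> Q" "y' \<in> Q"
      using xy Q by (auto simp: x'_def y'_def intro!: subspace_add subspace_scale)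
    ultimately show ?case using Pm by auto
  qed
  from this[of 0] obtain x y where xy: "x \<in> Q" "y \<in> Q" "b x ((u ^^ m) y) \<noteq> 0"
    "\<And>j. j < m \<Longrightarrow> b x ((u ^^ j) x) = 0 \<and> b y ((u ^^ j) y) = 0 \<and> b x ((u ^^ j) y) = 0"
    by auto
  have zero: "b x ((u ^^ j) x) = 0" "b y ((u ^^ j) y) = 0" for j
    using xy(4)[of j] alternating[OF xy(1)] alternating[OF xy(2)] top[OF xy(1), of j] top[OF xy(2), of j]
    by (metis nat_neq_iff)+
  have one: "b x ((u ^^ j) y) \<noteq> 0 \<longleftrightarrow> j = m" for j
    using xy(4)[of j] xy(3) top[OF xy(2), of j] by (metis nat_neq_iff)
  have one': "b y ((u ^^ j) x) \<noteq> 0 \<longleftrightarrow> j = m" for j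
    using one[of j] b_upow_swap[of y j x] by simp
  have "x \<noteq> y" using zero one by metis
  define star where "star z = (if z = x then y else x)" for z
  have "string_system {x, y} (\<lambda>_. m) star"
    using m[OF xy(1)] m[OF xy(2)] zero one one' \<open>x \<noteq> y\<close> unfolding string_system_def
    by (auto simp del: funpow.simps simp: star_def)
  then show ?thesis
    using xy eta_m by (intro exI[of _ "{x, y}"] exI[of _ "\<lambda>_. m"] exI[of _ star]) auto
qed

text \<open>Let \<open>u\<^sup>m\<close> be the last power that is nonzero on \<open>Q\<close>. By
  nondegeneracy the pairing \<open>b x (u\<^sup>m y)\<close> is nonzero on \<open>Q\<close>; either
  some vector has nonzero self-pairing or the pairing is alternating.\<close>

lemma string_extension:
  assumes Q: "\<And>x j. x \<in> Q \<Longrightarrow> (u ^^ j) x \<in> Q" "subspace Q" "nondegenerate_on Q" "Q \<noteq> {0}"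
  shows "\<exists>T t star. string_system T t star \<and> (\<forall>x\<in>T. even (t x) \<longrightarrow> star x = x) \<and> T \<noteq> {} \<and> T \<subseteq> Q"
proof -
  define P where "P n \<longleftrightarrow> (\<forall>x\<in>Q. (u ^^ n) x = 0)" for n
  have "\<exists>n. P n" using nilpotent unfolding P_def by metis
  moreover have "\<not> P 0" using Q(4) subspace_0[OF Q(2)] by (auto simp: P_def)
  ultimately obtain m where m: "\<not> P m" "P (Suc m)"
    using ex_least_nat_less[of P] by blast
  then obtain y where y: "y \<in> Q" "(u ^^ m) y \<noteq> 0" by (auto simp: P_def)
  then obtain x where x: "x \<in> Q" "b x ((u ^^ m) y) \<noteq> 0"
    using Q(3) Q(1)[OF y(1), of m] unfolding nondegenerate_on_def by (metis b_commute)
  show ?thesis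
  proof (cases "\<exists>x0\<in>Q. b x0 ((u ^^ m) x0) \<noteq> 0")
    case True
    then show ?thesis using string_extension_self[OF Q(1,2)] m(2) unfolding P_def by blast
  next
    case False
    then show ?thesis using string_extension_pair[OF Q(1,2) _ x(1) y(1) x(2)] m(2) unfolding P_def by blast
  qed
qed

lemma string_system_Un:
  assumes S: "string_system S t star" and T: "string_system T t' star'" and o: "u_orthogonal S T"
  shows "string_system (S \<union> T) (\<lambda>x. if x \<in> S then t x else t' x) (\<lambda>x. if x \<in> S then star x else star' x)"
    and "S \<inter> T = {}"
proof -
  show disj: "S \<inter> T = {}"
  proof (rule ccontr)
    assume "S \<inter> T \<noteq> {}"
    then obtain x where x: "x \<in> S" "x \<in> T" by blast
    then have "b (star x) ((u ^^ t (star x)) x) \<noteq> 0" "star x \<in> S"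
      using string_pairing[OF S string_star[OF S x(1)] x(1)] string_star_star[OF S x(1)]
        string_star[OF S x(1)] by simp_all
    then show False using o x(2) by (simp add: u_orthogonal_def)
  qed
  have o': "u_orthogonal T S" using o u_orthogonal_commute by blast
  show "string_system (S \<union> T) (\<lambda>x. if x \<in> S then t x else t' x) (\<lambda>x. if x \<in> S then star x else star' x)"
    unfolding string_system_def
  proof (intro conjI ballI allI)
    show "finite (S \<union> T)" using string_finite[OF S] string_finite[OF T] by simp
    fix x assume "x \<in> S \<union> T"
    then show "(if x \<in> S then star x else star' x) \<in> S \<union> T" "(u ^^ Suc (if x \<in> S then t x else t' x)) x = 0"
      using string_star[OF S] string_star[OF T] string_top[OF S] string_top[OF T] by auto
  next
    fix x y j assume xy: "x \<in> S \<union> T" "y \<in> S \<union> T"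
    consider "x \<in> S" "y \<in> S" | "x \<in> S" "y \<in> T" | "x \<in> T" "y \<in> S" | "x \<in> T" "y \<in> T"
      using xy by blast
    then show "(b x ((u ^^ j) y) \<noteq> 0) = (y = (if x \<in> S then star x else star' x) \<and> j = (if x \<in> S then t x else t' x))"
    proof cases
      case 1
      then show ?thesis using string_pairing[OF S] by simp
    next
      case 2
      then show ?thesis using o string_star[OF S 2(1)] disj by (auto simp: u_orthogonal_def)
    next
      case 3
      then show ?thesis using o' string_star[OF T 3(1)] disj by (auto simp: u_orthogonal_def)
    next
      case 4
      then show ?thesis using string_pairing[OF T 4] disj by auto
    qed
  qed
qed

text \<open>A system of maximal cardinality generates everything: the orthogonal of its strings is
  \<open>u\<close>-stable and nondegenerate, so if nonzero it would contain a further
  system.\<close>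

lemma string_system_exists:
  "\<exists>S t star. string_system S t star \<and> (\<forall>x\<in>S. even (t x) \<longrightarrow> star x = x) \<and> u_span S = UNIV"
proof -
  define P where "P S \<longleftrightarrow> (\<exists>t star. string_system S t star \<and> (\<forall>x\<in>S. even (t x) \<longrightarrow> star x = x))" for S
  have "P {}" by (auto simp: P_def string_system_def)
  moreover have "\<forall>S. P S \<longrightarrow> card S \<le> dim UNIV"
    unfolding P_def using string_independent independent_card_le_dim by blast
  ultimately obtain S where S: "P S" "\<And>T. P T \<Longrightarrow> card T \<le> card S"
    using ex_has_greatest_nat[of P "{}" card "Suc (dim UNIV)"] by (auto simp: less_Suc_eq_le)
  then obtain t star where st: "string_system S t star" "\<And>x. x \<in> S \<Longrightarrow> even (t x) \<Longrightarrow> star x = x"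
    by (auto simp: P_def)
  have "u_span S = UNIV"
  proof (rule ccontr)
    assume "u_span S \<noteq> UNIV"
    then have "perp (u_span S) \<noteq> {0}" using eq_UNIV_if_perp_eq_0[of "u_span S"] by auto
    then obtain T t' star' where T: "string_system T t' star'" "\<And>x. x \<in> T \<Longrightarrow> even (t' x) \<Longrightarrow> star' x = x"
      "T \<noteq> {}" "T \<subseteq> perp (u_span S)"
      using string_extension[OF perp_u_span_stable subspace_perp string_nondegenerate_perp[OF st(1)]] by blast
    have o: "u_orthogonal S T"
      using T(4) perp_u_span_stable[of _ S] subset_u_span[of S]
      unfolding u_orthogonal_def perp_def by blast
    note U = string_system_Un[OF st(1) T(1) o]
    have "P (S \<union> T)"
      unfolding P_def by (rule exI, rule exI, rule conjI, rule U(1)) (use st(2) T(2) in auto)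
    then have "card (S \<union> T) \<le> card S" by (rule S(2))
    then show False
      using U(2) T(3) string_finite[OF st(1)] string_finite[OF T(1)] by (simp add: card_Un_disjoint)
  qed
  then show ?thesis using st by blast
qed

end

section \<open>Embeddings from sums of square-zero operators\<close>

text \<open>By \<open>star_even\<close> each string of odd length is dual to itself, so its middle
  vector has nonzero norm.\<close>

locale string_space = nilpotent_adjoint_space +
  fixes S :: "'b set" and t :: "'b \<Rightarrow> nat" and star :: "'b \<Rightarrow> 'b"
  assumes system: "string_system S t star"
    and star_even: "x \<in> S \<Longrightarrow> even (t x) \<Longrightarrow> star x = x"
    and full: "u_span S = UNIV"
begin

text \<open>Spanned by the generators of the strings of length \<open>2k + 1\<close>. It turns out
  to be a complement of \<open>t_radical u (2 * k + 1)\<close> in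
  \<open>ker_pow u (2 * k + 1)\<close>, hence a model of the quotient carrying the form.\<close>

definition level :: "nat \<Rightarrow> 'b set" where
  "level k = span {x \<in> S. t x = 2 * k}"

text \<open>The vectors \<open>(u ^^ i) x\<close> with \<open>t x = 2 * i\<close> are middle
  vectors, here of strings of length at least \<open>2k + 1\<close>. The abbreviation
  \<open>middle k\<close> starts one odd length later and models the orthogonal sum over
  \<open>i > k\<close>.\<close>

definition tail :: "nat \<Rightarrow> 'b set" where
  "tail k = span {(u ^^ i) x | x i. x \<in> S \<and> t x = 2 * i \<and> k \<le> i}"

abbreviation middle :: "nat \<Rightarrow> 'b set" where
  "middle k \<equiv> tail (Suc k)"

text \<open>Spanned by the string vectors beyond the middle. The exponents of two such vectors are
  too large for a nonzero pairing, so the space is totally isotropic.\<close>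

definition upper :: "'b set" where
  "upper = span {(u ^^ j) x | x j. x \<in> S \<and> t x < 2 * j}"

lemma subspaces [simp]: "subspace (level k)" "subspace (tail k)" "subspace upper"
  by (simp_all add: level_def tail_def upper_def)

text \<open>An isometry of \<open>A\<close> into the negative of \<open>\<eta> ^ k\<close> times the
  form at exponent \<open>2k + 1\<close>, given by representatives instead of cosets. The set
  \<open>A\<close> can be a basis or a whole subspace.\<close>

definition level_embedding :: "nat \<Rightarrow> 'b set \<Rightarrow> ('b \<Rightarrow> 'b) \<Rightarrow> bool" where
  "level_embedding k A f \<longleftrightarrow> (\<forall>y\<in>A. (u ^^ Suc (2 * k)) (f y) = 0) \<and>
     (\<forall>y\<in>A. \<forall>y'\<in>A. \<eta> ^ k * b (f y) ((u ^^ (2 * k)) (f y')) = - b y y')"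

lemma subset_sums:
  fixes X Y :: "'b set"
  shows "0 \<in> Y \<Longrightarrow> X \<subseteq> {x + y | x y. x \<in> X \<and> y \<in> Y}"
    "0 \<in> X \<Longrightarrow> Y \<subseteq> {x + y | x y. x \<in> X \<and> y \<in> Y}"
  by (intro subsetI CollectI, metis add.right_neutral, intro subsetI CollectI, metis add.left_neutral)

lemma pairing_span_eq_0:
  assumes "x \<in> span X" "y \<in> span Y" "\<And>x y. x \<in> X \<Longrightarrow> y \<in> Y \<Longrightarrow> b x ((u ^^ j) y) = 0"
  shows "b x ((u ^^ j) y) = 0"
  by (rule span_bilinear_eq_0[OF _ _ _ _ assms]) (simp_all add: b_simps upow_add upow_scale)

lemma level_pairing:
  assumes "x \<in> level k" "y \<in> level l" "\<not> (k = l \<and> j = 2 * k)"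
  shows "b x ((u ^^ j) y) = 0"
proof (rule pairing_span_eq_0)
  show "x \<in> span {x \<in> S. t x = 2 * k}" "y \<in> span {x \<in> S. t x = 2 * l}"
    using assms by (auto simp: level_def)
next
  fix x y assume "x \<in> {x \<in> S. t x = 2 * k}" "y \<in> {x \<in> S. t x = 2 * l}"
  then show "b x ((u ^^ j) y) = 0"
    using string_pairing[OF system, of x y j] star_even[of x] assms(3) by auto
qed

lemma level_pairing_odd:
  assumes "x \<in> level k" "y \<in> S" "odd (t y)"
  shows "b x ((u ^^ j) y) = 0"
proof (rule pairing_span_eq_0)
  show "x \<in> span {x \<in> S. t x = 2 * k}" "y \<in> span {y}"
    using assms by (auto simp: level_def span_base)
next
  fix x y' assume "x \<in> {x \<in> S. t x = 2 * k}" "y' \<in> {y}"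
  then show "b x ((u ^^ j) y') = 0"
    using string_pairing[OF system, of x y j] star_even[of x] assms by auto
qed

lemma level_top: "x \<in> level k \<Longrightarrow> (u ^^ Suc (2 * k)) x = 0"
  using span_minimal[of "{x \<in> S. t x = 2 * k}" "{x. (u ^^ Suc (2 * k)) x \<in> {0}}"]
    subspace_vimage_u[of "{0}" "Suc (2 * k)"] string_top[OF system]
  by (force simp: level_def subspace_def)

lemma level_base: "x \<in> S \<Longrightarrow> t x = 2 * k \<Longrightarrow> x \<in> level k"
  by (simp add: level_def span_base)

text \<open>The pairing rules make \<open>x\<close> orthogonal to all other strings, so together
  with the assumption it is orthogonal to the whole space.\<close>

lemma level_nondegenerate:
  assumes "x \<in> level k" "\<And>y. y \<in> level k \<Longrightarrow> b x ((u ^^ (2 * k)) y) = 0"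
  shows "x = 0"
proof (rule eq_0_if_b_eq_0)
  have "x \<in> perp (u_span S)"
  proof (rule perp_u_spanI)
    fix y j assume y: "y \<in> S"
    have "b x ((u ^^ j) y) = 0"
    proof (cases "even (t y)")
      case True
      then obtain l where l: "t y = 2 * l" by (auto elim: evenE)
      then show ?thesis
        using assms level_base[OF y l] level_pairing[OF assms(1) level_base[OF y l], of j] by blast
    qed (use level_pairing_odd[OF assms(1) y] in blast)
    then show "b ((u ^^ j) y) x = 0" by (simp add: b_commute)
  qed
  then show "b x y = 0" for y using full b_commute[of x y] by (simp add: perp_def)
qed

lemma string_vectors_orthogonal:
  assumes "x \<in> S" "y \<in> S" "t x + t y < 2 * (i + j)"
  shows "b ((u ^^ i) x) ((u ^^ j) y) = 0"
proof (rule ccontr)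
  assume "b ((u ^^ i) x) ((u ^^ j) y) \<noteq> 0"
  then have "y = star x" "i + j = t x" using string_pairing'[OF system assms(1,2)] by auto
  then show False using assms string_t_star[OF system assms(1)] by simp
qed

lemma upper_isotropic: "x \<in> upper \<Longrightarrow> y \<in> upper \<Longrightarrow> b x y = 0"
  unfolding upper_def by (erule span_perp_eq_0, assumption) (auto intro: string_vectors_orthogonal)

lemma middle_upper: "x \<in> middle k \<Longrightarrow> y \<in> upper \<Longrightarrow> b x y = 0"
  unfolding upper_def tail_def
  by (erule span_perp_eq_0, assumption) (auto intro: string_vectors_orthogonal)

lemma middle_range: "x \<in> middle k \<Longrightarrow> \<exists>y. x = (u ^^ Suc k) y"
proof -
  assume x: "x \<in> middle k"
  have "middle k \<subseteq> range (u ^^ Suc k)"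
    unfolding tail_def
  proof (rule span_minimal)
    show "subspace (range (u ^^ Suc k))"
      using self.linear_subspace_image[OF linear_upow subspace_UNIV] by blast
    show "{(u ^^ i) x |x i. x \<in> S \<and> t x = 2 * i \<and> Suc k \<le> i} \<subseteq> range (u ^^ Suc k)"
    proof clarify
      fix x i assume "Suc k \<le> i"
      then have "(u ^^ i) x = (u ^^ Suc k) ((u ^^ (i - Suc k)) x)" by (simp only: upow_upow) simp
      then show "(u ^^ i) x \<in> range (u ^^ Suc k)" by blast
    qed
  qed
  then show ?thesis using x by blast
qed

lemma middle_component:
  assumes y: "\<And>z. (u ^^ Suc k) z \<in> upper \<Longrightarrow> b ((u ^^ Suc k) y) ((u ^^ Suc k) z) = 0"
  shows "\<exists>w\<in>middle k. \<exists>e\<in>upper. (u ^^ Suc k) y = w + e"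
proof -
  let ?s = "Suc k"
  let ?p = "(u ^^ ?s) y"
  let ?D = "{w + e | w e. w \<in> middle k \<and> e \<in> upper}"
  have sD: "subspace ?D" by (intro subspace_sums) auto
  have "?p = (\<Sum>x\<in>S. \<Sum>j\<le>t x. string_coeff t star x j ?p *s (u ^^ j) x)"
    using string_proj_full[OF system full] by (simp add: string_proj_def[OF system])
  also have "\<dots> \<in> ?D"
  proof (intro subspace_sum[OF sD])
    fix x j assume x: "x \<in> S" and "j \<in> {..t x}"
    then have j: "j \<le> t x" by simp
    have sx: "star x \<in> S" "t (star x) = t x"
      using x string_star[OF system] string_t_star[OF system] by auto
    let ?i = "t x - j"
    \<comment> \<open>A coordinate is read by the dual vector at exponent \<open>t x - j\<close>. In
      the third case \<open>u\<^sup>k\<^sup>+\<^sup>1\<close> kills this dual vector; in the fourth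
      it lies in \<open>upper\<close> and in the range of \<open>u\<^sup>k\<^sup>+\<^sup>1\<close>,
      so the hypothesis applies. The first two cases are vectors of \<open>upper\<close> and of
      \<open>middle k\<close>.\<close>
    consider "t x < 2 * j" | "t x = 2 * j" "k < j" | "?i < ?s" "j < ?s" | "t x < 2 * ?i" "?s \<le> ?i"
      using j by linarith
    then show "string_coeff t star x j ?p *s (u ^^ j) x \<in> ?D"
    proof cases
      case 1
      then have "(u ^^ j) x \<in> upper" unfolding upper_def using x by (intro span_base) blast
      then have "string_coeff t star x j ?p *s (u ^^ j) x \<in> upper" by (rule subspace_scale[OF subspaces(3)])
      moreover have "0 \<in> middle k" by (rule subspace_0[OF subspaces(2)])
      ultimately show ?thesis by force
    next
      case 2
      then have "(u ^^ j) x \<in> middle k" unfolding tail_def using x by (intro span_base) (auto simp: Suc_le_eq)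
      then have "string_coeff t star x j ?p *s (u ^^ j) x \<in> middle k" by (rule subspace_scale[OF subspaces(2)])
      moreover have "0 \<in> upper" by (rule subspace_0[OF subspaces(3)])
      ultimately show ?thesis by force
    next
      case 3
      then have "(u ^^ (?s + ?i)) (star x) = 0"
        using sx j by (intro upow_zero_mono[OF string_top[OF system sx(1)]]) auto
      then have "b ?p ((u ^^ ?i) (star x)) = 0" by (simp only: b_upow) simp
      then have "string_coeff t star x j ?p = 0" by (simp add: string_coeff_def[OF system])
      then show ?thesis using subspace_0[OF sD] by simp
    next
      case 4
      have *: "(u ^^ ?i) (star x) = (u ^^ ?s) ((u ^^ (?i - ?s)) (star x))"
        using 4 by (simp only: upow_upow le_add_diff_inverse)
      have "(u ^^ ?i) (star x) \<in> upper" unfolding upper_def using sx 4 by (intro span_base) force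
      then have "b ?p ((u ^^ ?i) (star x)) = 0" using y * by metis
      then have "string_coeff t star x j ?p = 0" by (simp add: string_coeff_def[OF system])
      then show ?thesis using subspace_0[OF sD] by simp
    qed
  qed
  finally show ?thesis by blast
qed

text \<open>The preimage \<open>Z\<close> of \<open>M + upper\<close> under \<open>u\<^sup>k\<^sup>+\<^sup>1\<close> is totally isotropic for
  \<open>\<beta> x y = b (u\<^sup>k\<^sup>+\<^sup>1 x) (u\<^sup>k\<^sup>+\<^sup>1 y)\<close>, and \<open>\<beta>\<close> induces a form isometric to \<open>N\<close> on \<open>Y / Z\<close>, where \<open>Y\<close> is the
  \<open>\<beta>\<close>-orthogonal of \<open>Z\<close>. The range of \<open>u\<^sup>k \<circ> a1\<close> is totally isotropic, and its part in
  \<open>u\<^sup>k\<^sup>+\<^sup>1 Y + u\<^sup>k (Ker u\<^sup>2\<^sup>k\<^sup>+\<^sup>1)\<close> is large enough to be the graph of an embedding of \<open>N\<close> into \<open>-(b, u)\<^sub>t\<^sub>,\<^sub>2\<^sub>k\<^sub>+\<^sub>1\<close>.\<close>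

lemma embedding_if_square_zero_sum:
  assumes a1: "endomorphism a1" "\<And>x y. b (a1 x) y = \<eta> * b x (a1 y)" "\<And>x. a1 (a1 x) = 0"
    and a2: "endomorphism a2" "\<And>x y. b (a2 x) y = \<eta> * b x (a2 y)" "\<And>x. a2 (a2 x) = 0"
    and sum: "\<And>x. u x = a1 x + a2 x"
    and MN: "metabolic_decomposition (middle k) M N"
  shows "\<exists>f. endomorphism f \<and> level_embedding k N f"
proof -
  have M: "subspace M" "M \<subseteq> middle k" "\<And>x y. x \<in> M \<Longrightarrow> y \<in> M \<Longrightarrow> b x y = 0"
    and N: "subspace N" "N \<subseteq> middle k" "\<And>x y. x \<in> M \<Longrightarrow> y \<in> N \<Longrightarrow> b x y = 0" "anisotropic N"
    and MN: "\<And>w. w \<in> middle k \<Longrightarrow> (\<And>m. m \<in> M \<Longrightarrow> b m w = 0) \<Longrightarrow> \<exists>m\<in>M. \<exists>n\<in>N. w = m + n"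
    using MN unfolding metabolic_decomposition_def by simp_all
  let ?s = "Suc k"
  note add1 = endomorphismD[OF a1(1)] and add2 = endomorphismD[OF a2(1)]
  \<comment> \<open>Here \<open>u\<^sup>2 = a1 a2 + a2 a1\<close>, which commutes with both
    operators.\<close>
  have comm: "u (u (a1 x)) = a1 (u (u x))" "u (u (a2 x)) = a2 (u (u x))" for x
    by (simp_all add: sum add1 add2 a1 a2)
  have comm_pow: "(u ^^ (2 * i)) (a1 x) = a1 ((u ^^ (2 * i)) x)"
    "(u ^^ (2 * i)) (a2 x) = a2 ((u ^^ (2 * i)) x)" for i x
    by (induction i) (simp_all add: comm)
  \<comment> \<open>Moving everything to the right leaves
    \<open>a1 u\<^sup>2\<^sup>k a1 = u\<^sup>2\<^sup>k a1 a1 = 0\<close>; only even powers of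
    \<open>u\<close> occur.\<close>
  have iso: "b ((u ^^ k) (a1 x)) ((u ^^ k) (a1 y)) = 0" "b ((u ^^ k) (a2 x)) ((u ^^ k) (a2 y)) = 0" for x y
    by (simp_all add: b_upow a1(2,3) a2(2,3) comm_pow flip: mult_2)
  define Z where "Z = {z. (u ^^ ?s) z \<in> {m + e | m e. m \<in> M \<and> e \<in> upper}}"
  have sZ: "subspace Z"
    unfolding Z_def by (intro subspace_vimage_u subspace_sums M subspaces)
  have ZE: "\<exists>m\<in>M. \<exists>e\<in>upper. (u ^^ ?s) z = m + e" if "z \<in> Z" for z
    using that unfolding Z_def by blast
  have ZI: "z \<in> Z" if "(u ^^ ?s) z = m + e" "m \<in> M" "e \<in> upper" for z m e
    using that unfolding Z_def by blast
  define Y where "Y = {y. \<forall>z\<in>Z. b ((u ^^ ?s) y) ((u ^^ ?s) z) = 0}"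
  define X0 where "X0 = (u ^^ (?s + ?s)) ` Z"
  have sX0: "subspace X0" unfolding X0_def using self.linear_subspace_image[OF linear_upow sZ] .
  \<comment> \<open>Turns the \<open>\<beta>\<close>-orthogonal of \<open>Z\<close> into an ordinary
    orthogonal, to which double orthogonality applies.\<close>
  have Y_perp: "Y = perp X0"
    unfolding Y_def X0_def perp_def by (simp only: b_upow) (auto simp: b_commute)
  have perp_Y: "perp Y = X0" using perp_perp[OF sX0] Y_perp by simp
  have sY: "subspace Y" unfolding Y_perp by (rule subspace_perp)
  have ZY: "Z \<subseteq> Y"
  proof
    fix z assume "z \<in> Z"
    have "b ((u ^^ ?s) z) ((u ^^ ?s) z') = 0" if z': "z' \<in> Z" for z'
    proof -
      obtain m e m' e' where "m \<in> M" "e \<in> upper" "(u ^^ ?s) z = m + e"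
        "m' \<in> M" "e' \<in> upper" "(u ^^ ?s) z' = m' + e'"
        using ZE[OF \<open>z \<in> Z\<close>] ZE[OF z'] by blast
      moreover from this have "m \<in> middle k" "m' \<in> middle k" using M(2) by auto
      ultimately show ?thesis
        using M(3) middle_upper[of m k e'] middle_upper[of m' k e] upper_isotropic b_commute[of e m']
        by (simp add: b_add_left b_add_right del: funpow.simps)
    qed
    then show "z \<in> Y" by (simp add: Y_def)
  qed
  have Y_split: "\<exists>m\<in>M. \<exists>n\<in>N. \<exists>e\<in>upper. (u ^^ ?s) y = m + n + e" if y: "y \<in> Y" for y
  proof -
    have "b ((u ^^ ?s) y) ((u ^^ ?s) z) = 0" if "(u ^^ ?s) z \<in> upper" for z
      using y ZI[of z 0] subspace_0[OF M(1)] that unfolding Y_def by fastforce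
    then obtain w e where we: "w \<in> middle k" "e \<in> upper" "(u ^^ ?s) y = w + e"
      using middle_component by blast
    have "b m w = 0" if m: "m \<in> M" for m
    proof -
      obtain z where z: "m = (u ^^ ?s) z" using middle_range M(2) m by blast
      then have "z \<in> Z" using ZI[of z m 0] m subspace_0[OF subspaces(3)] by simp
      then have "b (w + e) m = 0" using y z we(3) unfolding Y_def by auto
      moreover have "b e m = 0" using middle_upper[of m k e] M(2) m we(2) b_commute by auto
      ultimately show ?thesis by (simp add: b_simps b_commute)
    qed
    then obtain m n where "m \<in> M" "n \<in> N" "w = m + n" using MN we(1) by blast
    then show ?thesis using we by blast
  qed
  have Y_aniso: "y \<in> Z" if y: "y \<in> Y" "b ((u ^^ ?s) y) ((u ^^ ?s) y) = 0" for y
  proof -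
    obtain m n e where mne: "m \<in> M" "n \<in> N" "e \<in> upper" "(u ^^ ?s) y = m + n + e" using Y_split[OF y(1)] by blast
    have "b m m = 0" "b m n = 0" "b n m = 0" "b m e = 0" "b e m = 0" "b n e = 0" "b e n = 0" "b e e = 0"
      using mne M N middle_upper upper_isotropic b_commute by (metis subsetD)+
    then have "b n n = 0" using y(2) unfolding mne(4) by (simp only: b_simps) simp
    then have "n = 0" using N(4) mne(2) by (auto simp: anisotropic_def)
    then show ?thesis using ZI[of y m e] mne by simp
  qed
  define G where "G x = (u ^^ (?s + k)) (a1 x + a1 x)" for x
  have linG: "endomorphism G"
    by (rule endomorphismI) (simp_all add: G_def add1 upow_add upow_scale u_add u_scale scale_right_distrib)
  have solve: "\<exists>x\<in>Y. \<exists>z\<in>Z. (u ^^ (?s + ?s)) y = G x + (u ^^ (?s + ?s)) z" if y: "y \<in> Y" for y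
  proof -
    define D where "D = {g + x | g x. g \<in> G ` Y \<and> x \<in> X0}"
    have sD: "subspace D"
      unfolding D_def using self.linear_subspace_image[OF linG sY] sX0 by (rule subspace_sums)
    have sub: "G ` Y \<subseteq> D" "X0 \<subseteq> D"
      using subspace_0[OF sX0] subspace_0[OF self.linear_subspace_image[OF linG sY]]
      unfolding D_def by (simp_all only: subset_sums)
    have "(u ^^ (?s + ?s)) y \<in> perp (perp D)"
      unfolding perp_def[of "perp D"]
    proof (intro CollectI ballI)
      fix r assume r: "r \<in> perp D"
      then have rY: "r \<in> Y" using sub(2) unfolding Y_perp by (auto simp: perp_def)
      then have "b (G r) r = 0" using r sub(1) by (auto simp: perp_def)
      then have "b r ((u ^^ (?s + k)) (a1 r + a1 r)) = 0" by (simp add: G_def b_commute)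
      then have "b ((u ^^ ?s) r) ((u ^^ k) (a1 r + a1 r)) = 0" by (simp only: b_upow) simp
      moreover have "(u ^^ ?s) r = (u ^^ k) (a1 r) + (u ^^ k) (a2 r)"
        using upow_u[of k r] by (simp add: sum[of r] upow_add)
      \<comment> \<open>As the ranges of \<open>u\<^sup>k a1\<close> and \<open>u\<^sup>k a2\<close>
        are isotropic, the norm of \<open>u\<^sup>k\<^sup>+\<^sup>1 r\<close> is this same double
        mixed term.\<close>
      ultimately have "b ((u ^^ k) (a2 r)) ((u ^^ k) (a1 r)) + b ((u ^^ k) (a2 r)) ((u ^^ k) (a1 r)) = 0"
        by (simp add: upow_add b_simps iso)
      then have "b ((u ^^ ?s) r) ((u ^^ ?s) r) = 0"
        using \<open>(u ^^ ?s) r = _\<close> b_commute[of "(u ^^ k) (a1 r)" "(u ^^ k) (a2 r)"] by (simp only: b_simps iso) simp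
      then have "r \<in> Z" using Y_aniso rY by blast
      then have "b ((u ^^ ?s) y) ((u ^^ ?s) r) = 0" using y unfolding Y_def by blast
      then have "b ((u ^^ ?s) r) ((u ^^ ?s) y) = 0" by (simp only: b_commute)
      then show "b r ((u ^^ (?s + ?s)) y) = 0" by (simp only: b_upow) simp
    qed
    then have "(u ^^ (?s + ?s)) y \<in> D" using perp_perp[OF sD] by simp
    then show ?thesis unfolding D_def X0_def by blast
  qed
  have "\<exists>\<kappa> x y z. (u ^^ Suc (2 * k)) \<kappa> = 0 \<and> (u ^^ ?s) y = c \<and> y \<in> Y \<and> z \<in> Z \<and>
      a1 x + a1 x = u (y + z) + \<kappa>" if c: "c \<in> N" for c
  proof -
    obtain y where y: "c = (u ^^ ?s) y" using middle_range N(2) c by blast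
    have yY: "y \<in> Y"
      unfolding Y_def
    proof (intro CollectI ballI)
      fix z assume "z \<in> Z"
      then obtain m e where "m \<in> M" "e \<in> upper" "(u ^^ ?s) z = m + e" using ZE by blast
      then show "b ((u ^^ ?s) y) ((u ^^ ?s) z) = 0"
        using N(2,3) c middle_upper[of c k e] b_commute[of c m] unfolding y by (simp only: b_simps) auto
    qed
    obtain x z where xz: "x \<in> Y" "z \<in> Z" "(u ^^ (?s + ?s)) y = G x + (u ^^ (?s + ?s)) z" using solve[OF yY] by blast
    \<comment> \<open>The equation from \<open>solve\<close> says exactly that
      \<open>u\<^sup>2\<^sup>k\<^sup>+\<^sup>1\<close> kills this difference.\<close>
    define \<kappa> where "\<kappa> = a1 x + a1 x - u (y + - z)"
    have "(u ^^ (?s + k)) \<kappa> = G x - (u ^^ (?s + ?s)) y + (u ^^ (?s + ?s)) z"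
      using upow_diff[of 1] by (simp add: \<kappa>_def G_def upow_diff upow_add upow_u u_add)
    then have "(u ^^ Suc (2 * k)) \<kappa> = 0" using xz(3) by (simp add: mult_2)
    moreover have "- z \<in> Z" using xz(2) sZ by (rule subspace_neg[rotated])
    moreover have "a1 x + a1 x = u (y + - z) + \<kappa>" by (simp add: \<kappa>_def)
    ultimately show ?thesis using y yY by blast
  qed
  then have "\<forall>c\<in>N. \<exists>\<kappa>. \<exists>x y z. (u ^^ Suc (2 * k)) \<kappa> = 0 \<and> (u ^^ ?s) y = c \<and> y \<in> Y \<and> z \<in> Z \<and>
      a1 x + a1 x = u (y + z) + \<kappa>" by blast
  from bchoice[OF this] obtain K where K: "\<And>c. c \<in> N \<Longrightarrow> \<exists>x y z. (u ^^ Suc (2 * k)) (K c) = 0 \<and>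
    (u ^^ ?s) y = c \<and> y \<in> Y \<and> z \<in> Z \<and> a1 x + a1 x = u (y + z) + K c" by blast
  have K_top: "(u ^^ Suc (2 * k)) (K c) = 0" if "c \<in> N" for c using K[OF that] by blast
  have K_form: "\<eta> ^ k * b (K c) ((u ^^ (2 * k)) (K c')) = - b c c'" if "c \<in> N" "c' \<in> N" for c c'
  proof -
    obtain x y z where 1: "(u ^^ ?s) y = c" "y \<in> Y" "z \<in> Z" "a1 x + a1 x = u (y + z) + K c"
      using K[OF \<open>c \<in> N\<close>] by blast
    obtain x' y' z' where 2: "(u ^^ ?s) y' = c'" "y' \<in> Y" "z' \<in> Z" "a1 x' + a1 x' = u (y' + z') + K c'"
      using K[OF \<open>c' \<in> N\<close>] by blast
    \<comment> \<open>Isotropy of the range of \<open>u\<^sup>k a1\<close> forces the form of the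
      \<open>K\<close> parts to be the negative of \<open>b c c'\<close>: cross terms vanish because
      \<open>u\<^sup>2\<^sup>k\<^sup>+\<^sup>1\<close> kills \<open>K c\<close>, and
      \<open>Z\<close> does not contribute to \<open>\<beta>\<close> on \<open>Y\<close>.\<close>
    have "b ((u ^^ k) (u (y + z) + K c)) ((u ^^ k) (u (y' + z') + K c')) = 0"
      unfolding 1(4)[symmetric] 2(4)[symmetric] by (simp add: upow_add b_simps iso)
    then have *: "b ((u ^^ ?s) (y + z)) ((u ^^ ?s) (y' + z')) + b ((u ^^ ?s) (y + z)) ((u ^^ k) (K c'))
        + b ((u ^^ k) (K c)) ((u ^^ ?s) (y' + z')) + b ((u ^^ k) (K c)) ((u ^^ k) (K c')) = 0"
      by (simp only: upow_add[of k] upow_u b_simps) (simp add: add_ac upow_add[of k])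
    have "b ((u ^^ ?s) x) ((u ^^ k) (K c)) = 0" if "c \<in> N" for x c
      using K_top[OF that] by (simp only: b_upow) (simp add: mult_2)
    then have K0: "b ((u ^^ ?s) x) ((u ^^ k) (K c)) = 0" "b ((u ^^ k) (K c)) ((u ^^ ?s) x) = 0"
      if "c \<in> N" for x c
      using that b_commute by metis+
    have "b ((u ^^ ?s) (y + z)) ((u ^^ ?s) (y' + z')) = b c c'"
    proof -
      have "b ((u ^^ ?s) y) ((u ^^ ?s) z') = 0" "b ((u ^^ ?s) z) ((u ^^ ?s) z') = 0"
        "b ((u ^^ ?s) y') ((u ^^ ?s) z) = 0"
        using 1 2 ZY unfolding Y_def by blast+
      then show ?thesis
        unfolding upow_add[of ?s] 1(1) 2(1) using b_commute[of c' "(u ^^ ?s) z"] 1 2 by (simp only: b_simps) simp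
    qed
    then have "b ((u ^^ k) (K c)) ((u ^^ k) (K c')) = - b c c'"
      using * K0[OF \<open>c \<in> N\<close>] K0[OF \<open>c' \<in> N\<close>] by (simp add: eq_neg_iff_add_eq_0 add.commute)
    then show ?thesis by (simp only: b_upow mult_2)
  qed
  \<comment> \<open>\<open>K\<close> was chosen pointwise and need not be linear. Its values on a
    basis are extended linearly, and the identities extend with them.\<close>
  obtain C where C: "C \<subseteq> N" "independent C" "N \<subseteq> span C"
    using maximal_independent_subset by blast
  obtain f where f: "endomorphism f" "\<And>c. c \<in> C \<Longrightarrow> f c = K c"
    using self.linear_independent_extend[OF C(2), of K] by blast
  note fadd = endomorphismD[OF f(1)]
  have "subspace {y. (u ^^ Suc (2 * k)) (f y) = 0}"
    by (simp add: subspace_def fadd upow_add upow_scale u_add u_scale)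
  then have "(u ^^ Suc (2 * k)) (f y) = 0" if "y \<in> N" for y
    using span_minimal[of C "{y. (u ^^ Suc (2 * k)) (f y) = 0}"] C f(2) K_top that by (auto simp: subset_iff)
  moreover have "\<eta> ^ k * b (f y) ((u ^^ (2 * k)) (f y')) = - b y y'" if "y \<in> N" "y' \<in> N" for y y'
  proof -
    have "\<eta> ^ k * b (f y) ((u ^^ (2 * k)) (f y')) + b y y' = 0"
    proof (rule span_bilinear_eq_0[of "\<lambda>y y'. \<eta> ^ k * b (f y) ((u ^^ (2 * k)) (f y')) + b y y'" y C y' C])
      show "\<eta> ^ k * b (f c) ((u ^^ (2 * k)) (f d)) + b c d = 0" if "c \<in> C" "d \<in> C" for c d
        using K_form[of c d] f(2)[of c] f(2)[of d] C(1) that by (auto simp: eq_neg_iff_add_eq_0)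
    qed (use C(3) that in \<open>auto simp: fadd upow_add upow_scale b_add_left b_add_right
        b_scale_left b_scale_right algebra_simps\<close>)
    then show ?thesis by (simp add: eq_neg_iff_add_eq_0)
  qed
  ultimately show ?thesis using f(1) unfolding level_embedding_def by blast
qed

section \<open>Sums of square-zero operators from embeddings\<close>

lemma level_pairing_push:
  "x \<in> level k \<Longrightarrow> y \<in> level k \<Longrightarrow> b x ((u ^^ j) y) = (if j = 2 * k then \<eta> ^ k * b ((u ^^ k) x) ((u ^^ k) y) else 0)"
  using level_pairing[of x k y k j] by (simp add: b_upow mult_2)

lemma inj_on_level: "inj_on (u ^^ k) (level k)"
proof (rule inj_onI)
  fix x y assume xy: "x \<in> level k" "y \<in> level k" "(u ^^ k) x = (u ^^ k) y"
  have d: "x - y \<in> level k" using xy by (simp add: subspace_diff)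
  have "b (x - y) ((u ^^ (2 * k)) z) = 0" if "z \<in> level k" for z
    using level_pairing_push[OF d that, of "2 * k"] xy(3) by (simp add: upow_diff)
  then show "x = y" using level_nondegenerate[OF d] by simp
qed

text \<open>The operator sends \<open>x\<close> to \<open>y\<close> and \<open>y\<close> to
  \<open>- u (u x)\<close>. Adjointness compares the pairing of \<open>y\<close> at exponent
  \<open>2k\<close> with that of \<open>x\<close> at exponent \<open>2k + 2\<close> and holds
  exactly when the middle norms are opposite.\<close>

lemma splitting_matched:
  assumes x: "x \<in> level (Suc k)" and y: "y \<in> level k"
    and nz: "b ((u ^^ k) y) ((u ^^ k) y) \<noteq> 0"
    and eq: "b ((u ^^ Suc k) x) ((u ^^ Suc k) x) = - b ((u ^^ k) y) ((u ^^ k) y)"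
  shows "splitting {x, y}"
proof -
  have xy: "b x ((u ^^ j) y) = 0" "b y ((u ^^ j) x) = 0" for j
    using level_pairing[OF x y] level_pairing[OF y x] by auto
  have xx: "b x ((u ^^ j) x) = (if j = 2 * Suc k then - (\<eta> ^ Suc k * b ((u ^^ k) y) ((u ^^ k) y)) else 0)" for j
    using level_pairing_push[OF x x, of j] unfolding eq by simp
  note yy = level_pairing_push[OF y y]
  have "x \<noteq> y" using xy(1)[of "2 * k"] yy[of "2 * k"] nz by auto
  define t' where "t' z = (if z = x then 2 * Suc k else 2 * k)" for z
  define w where "w z = (if z = x then y else - u (u x))" for z
  have w: "w x = y" "w y = - u (u x)" using \<open>x \<noteq> y\<close> by (auto simp: w_def)
  have t': "t' x = 2 * Suc k" "t' y = 2 * k" using \<open>x \<noteq> y\<close> by (auto simp: t'_def)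
  have shift: "(u ^^ m) (- u (u x)) = - (u ^^ (m + 2)) x" for m
    by (simp add: upow_minus upow_u numeral_2_eq_2)
  have shift': "b (- u (u x)) z = - b x ((u ^^ 2) z)" for z
    using b_upow_left[of 2 x z] eta_square by (simp add: b_minus_left numeral_2_eq_2)
  show ?thesis
  proof (rule splitting_string_system[of "{x, y}" t' id w])
    show "string_system {x, y} t' id"
      unfolding string_system_def
      using level_top[OF x] level_top[OF y] xy xx yy nz \<open>x \<noteq> y\<close> by (auto simp: t' simp del: funpow.simps)
  next
    fix z assume "z \<in> {x, y}"
    then show "(u ^^ Suc (t' z)) (w z) = 0"
      using upow_zero_mono[OF level_top[OF y], of "Suc (2 * Suc k)"] level_top[OF x]
      by (auto simp: t' w shift simp del: funpow.simps)
  next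
    fix z z' m assume "z \<in> {x, y}" "z' \<in> {x, y}"
    then show "b (w z) ((u ^^ m) z') = \<eta> * (- 1) ^ m * b z ((u ^^ m) (w z'))"
      using eta_square xx[of "Suc (Suc m)"] xy(1)[of "Suc (Suc m)"] xy(2)[of "Suc (Suc m)"]
      by (auto simp: w xy shift shift' b_minus_right upow_upow xx yy simp flip: mult.assoc)
  next
    fix z assume "z \<in> {x, y}"
    moreover have "w x = 1 *s (u ^^ 0) y" "(1 * (- 1) ^ 0) *s (u ^^ 0) (w y) = - u (u x)"
      "w y = (- 1) *s (u ^^ 2) x" "((- 1) * (- 1) ^ 2) *s (u ^^ 2) (w x) = - u (u y)"
      by (simp_all add: w numeral_2_eq_2)
    ultimately show "\<exists>c r x'. x' \<in> {x, y} \<and> w z = c *s (u ^^ r) x' \<and> (c * (- 1) ^ r) *s (u ^^ r) (w x') = - u (u z)"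
      by blast
  qed
qed

text \<open>The operator is \<open>u\<close> on the generator \<open>x\<close> and
  \<open>- u\<close> on \<open>y\<close>. Only odd \<open>m\<close> contributes to adjointness,
  since \<open>m + 1 = 2k\<close>, and the opposite signs on the dual strings absorb
  \<open>(- 1) ^ m\<close>.\<close>

lemma splitting_hyperbolic:
  assumes x: "x \<in> level k" and y: "y \<in> level k"
    and "b ((u ^^ k) x) ((u ^^ k) x) = 0" "b ((u ^^ k) y) ((u ^^ k) y) = 0" "b ((u ^^ k) x) ((u ^^ k) y) \<noteq> 0"
  shows "splitting {x, y}"
proof -
  have zero: "b x ((u ^^ j) x) = 0" "b y ((u ^^ j) y) = 0" for j
    using level_pairing_push[OF x x] level_pairing_push[OF y y] assms by auto
  have xy: "b x ((u ^^ j) y) \<noteq> 0 \<longleftrightarrow> j = 2 * k" "b y ((u ^^ j) x) \<noteq> 0 \<longleftrightarrow> j = 2 * k" for j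
    using level_pairing_push[OF x y] level_pairing_push[OF y x] assms b_commute[of "(u ^^ k) x" "(u ^^ k) y"] by auto
  have "x \<noteq> y" using assms by auto
  define star' where "star' z = (if z = x then y else x)" for z
  define w where "w z = (if z = x then u x else - u y)" for z
  have w: "w x = u x" "w y = - u y" using \<open>x \<noteq> y\<close> by (auto simp: w_def)
  have sh: "b (u z) z' = \<eta> * b z ((u ^^ 1) z')" for z z' by (simp add: adjoint)
  show ?thesis
  proof (rule splitting_string_system[of "{x, y}" "\<lambda>_. 2 * k" star' w])
    show "string_system {x, y} (\<lambda>_. 2 * k) star'"
      unfolding string_system_def
      using level_top[OF x] level_top[OF y] zero xy \<open>x \<noteq> y\<close> by (auto simp: star'_def simp del: funpow.simps)
  next
    fix z assume "z \<in> {x, y}"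
    then show "(u ^^ Suc (2 * k)) (w z) = 0"
      using level_top[OF x] level_top[OF y] by (auto simp: w upow_minus upow_u)
  next
    fix z z' m assume "z \<in> {x, y}" "z' \<in> {x, y}"
    moreover have odd_m: "Suc m = 2 * k \<Longrightarrow> odd m" by presburger
    have "b x ((u ^^ Suc m) y) = 0 \<or> odd m" "b y ((u ^^ Suc m) x) = 0 \<or> odd m"
      using xy[of "Suc m"] odd_m by blast+
    ultimately show "b (w z) ((u ^^ m) z') = \<eta> * (- 1) ^ m * b z ((u ^^ m) (w z'))"
      using zero[of "Suc m"] \<open>x \<noteq> y\<close>
      by (auto simp: w adjoint upow_minus upow_u b_minus_left b_minus_right)
  next
    fix z assume "z \<in> {x, y}"
    moreover have "w x = 1 *s (u ^^ 1) x" "(1 * (- 1) ^ 1) *s (u ^^ 1) (w x) = - u (u x)"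
      "w y = (- 1) *s (u ^^ 1) y" "((- 1) * (- 1) ^ 1) *s (u ^^ 1) (w y) = - u (u y)"
      using upow_minus[of 1] by (simp_all add: w)
    ultimately show "\<exists>c r x'. x' \<in> {x, y} \<and> w z = c *s (u ^^ r) x' \<and> (c * (- 1) ^ r) *s (u ^^ r) (w x') = - u (u z)"
      by blast
  qed
qed

text \<open>For even length one can take \<open>w = u\<close>: a nonzero pairing needs
  \<open>m + 1 = t x\<close>, so \<open>m\<close> is even and the sign disappears.\<close>

lemma splitting_odd: "splitting {x \<in> S. odd (t x)}"
proof (rule splitting_string_system[of _ t star u])
  show "string_system {x \<in> S. odd (t x)} t star"
    using system string_t_star[OF system] unfolding string_system_def by auto
next
  fix x assume "x \<in> {x \<in> S. odd (t x)}"
  then show "(u ^^ Suc (t x)) (u x) = 0" using string_top[OF system, of x] by (simp add: upow_u)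
next
  fix x y m assume xy: "x \<in> {x \<in> S. odd (t x)}" "y \<in> {x \<in> S. odd (t x)}"
  then have "b x ((u ^^ Suc m) y) = 0 \<or> even m"
    using string_pairing[OF system, of x y "Suc m"] by (metis (no_types, lifting) even_Suc mem_Collect_eq)
  then show "b (u x) ((u ^^ m) y) = \<eta> * (- 1) ^ m * b x ((u ^^ m) (u y))"
    by (auto simp: adjoint upow_u)
next
  fix x assume "x \<in> {x \<in> S. odd (t x)}"
  moreover have "u x = 1 *s (u ^^ 1) x" "(1 * (- 1) ^ 1) *s (u ^^ 1) (u x) = - u (u x)" by simp_all
  ultimately show "\<exists>c r x'. x' \<in> {x \<in> S. odd (t x)} \<and> u x = c *s (u ^^ r) x' \<and>
      (c * (- 1) ^ r) *s (u ^^ r) (u x') = - u (u x)" by blast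
qed

section \<open>Representing the quotients by generators of strings\<close>

lemma subspace_ker_pow: "subspace (ker_pow u k)"
  by (auto simp: ker_pow_def subspace_def upow_add upow_scale)

lemma subspace_t_radical: "subspace (t_radical u k)"
  unfolding t_radical_def
  using self.linear_subspace_image[OF linear_u subspace_UNIV]
  by (intro subspace_sums subspace_inter subspace_ker_pow) auto

lemma t_radical_pairing:
  assumes "r \<in> t_radical u (Suc (2 * k))" "(u ^^ Suc (2 * k)) y = 0"
  shows "b r ((u ^^ (2 * k)) y) = 0"
proof -
  obtain p z where r: "r = p + u z" "(u ^^ (2 * k)) p = 0"
    using assms(1) by (auto simp: t_radical_def ker_pow_def)
  have "b p ((u ^^ (2 * k)) y) = 0" using b_upow_swap[of p "2 * k" y] r(2) by simp
  moreover have "b (u z) ((u ^^ (2 * k)) y) = 0" using adjoint[of z] assms(2) by simp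
  ultimately show ?thesis by (simp add: r(1) b_add_left)
qed

text \<open>In the string expansion of \<open>x\<close>, the vectors that can occur are generators
  in \<open>level k\<close>, vectors of shorter strings, killed by \<open>u\<^sup>2\<^sup>k\<close>,
  or vectors in the range of \<open>u\<close> killed by
  \<open>u\<^sup>2\<^sup>k\<^sup>+\<^sup>1\<close>. Only the first kind is outside the
  radical.\<close>

lemma ker_pow_level:
  assumes "(u ^^ Suc (2 * k)) x = 0"
  shows "\<exists>l\<in>level k. x - l \<in> t_radical u (Suc (2 * k))"
proof -
  let ?n = "Suc (2 * k)"
  let ?D = "{l + r | l r. l \<in> level k \<and> r \<in> t_radical u ?n}"
  have sD: "subspace ?D" by (intro subspace_sums subspaces subspace_t_radical)
  have D: "level k \<subseteq> ?D" "t_radical u ?n \<subseteq> ?D"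
    using subspace_0[OF subspace_t_radical] subspace_0[OF subspaces(1)] by (simp_all only: subset_sums)
  have R: "ker_pow u (2 * k) \<subseteq> t_radical u ?n" "ker_pow u ?n \<inter> range u \<subseteq> t_radical u ?n"
  proof -
    have 0: "0 \<in> ker_pow u i" "0 \<in> range u" for i
      using subspace_0[OF subspace_ker_pow] u_zero by (auto, metis rangeI)
    show "ker_pow u (2 * k) \<subseteq> t_radical u ?n" "ker_pow u ?n \<inter> range u \<subseteq> t_radical u ?n"
      using subset_sums(1)[of "ker_pow u ?n \<inter> range u" "ker_pow u (2 * k)"]
        subset_sums(2)[of "ker_pow u (2 * k)" "ker_pow u ?n \<inter> range u"] 0
      unfolding t_radical_def by auto
  qed
  have "x = (\<Sum>y\<in>S. \<Sum>j\<le>t y. string_coeff t star y j x *s (u ^^ j) y)"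
    using string_proj_full[OF system full] by (simp add: string_proj_def[OF system])
  also have "\<dots> \<in> ?D"
  proof (intro subspace_sum[OF sD])
    fix y j assume y: "y \<in> S" and "j \<in> {..t y}"
    then have j: "j \<le> t y" by simp
    let ?e = "(u ^^ j) y"
    have range: "?e \<in> range u" if "j \<noteq> 0" using that by (cases j) auto
    have top: "(u ^^ i) ?e = 0" if "i + j > t y" for i
      using upow_zero_mono[OF string_top[OF system y], of "i + j"] that by (simp add: upow_upow)
    consider "j + ?n \<le> t y" | "t y = 2 * k" "j = 0" | "t y = 2 * k" "j \<noteq> 0" | "t y < 2 * k"
      | "t y > 2 * k" "t y < j + ?n" by linarith
    then have "string_coeff t star y j x = 0 \<or> ?e \<in> ?D"
    proof cases
      case 1
      then have "(u ^^ (t y - j)) x = 0" by (intro upow_zero_mono[OF assms]) linarith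
      then have "b x ((u ^^ (t y - j)) (star y)) = 0"
        using b_upow_swap[of x "t y - j" "star y"] by simp
      then show ?thesis by (simp add: string_coeff_def[OF system])
    next
      case 2
      then show ?thesis using D(1) level_base[OF y] by auto
    next
      case 3
      then show ?thesis using D(2) R(2) range top[of ?n] by (auto simp: ker_pow_def)
    next
      case 4
      then show ?thesis using D(2) R(1) top[of "2 * k"] by (auto simp: ker_pow_def)
    next
      case 5
      then have "?e \<in> ker_pow u ?n \<inter> range u" using top[of ?n] range by (auto simp: ker_pow_def)
      then show ?thesis using D(2) R(2) by blast
    qed
    then show "string_coeff t star y j x *s ?e \<in> ?D"
    proof
      assume "string_coeff t star y j x = 0"
      then have "string_coeff t star y j x *s ?e = 0" by simp
      then show ?thesis using subspace_0[OF sD] by (simp only:)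
    qed (rule subspace_scale[OF sD])
  qed
  finally obtain l r where "x = l + r" "l \<in> level k" "r \<in> t_radical u ?n" by blast
  then show ?thesis by (intro bexI[of _ l]) simp_all
qed

lemma push_level_eq: "(u ^^ k) ` level k = span ((u ^^ k) ` {x \<in> S. t x = 2 * k})"
  unfolding level_def using self.linear_span_image[OF linear_upow] by simp

lemma subspace_push_level: "subspace ((u ^^ k) ` level k)"
  unfolding push_level_eq by simp

lemma tail_eq: "tail k = span ((u ^^ k) ` level k \<union> tail (Suc k))"
proof
  show "tail k \<subseteq> span ((u ^^ k) ` level k \<union> tail (Suc k))"
    unfolding tail_def[of k]
  proof (rule span_minimal)
    show "{(u ^^ i) x |x i. x \<in> S \<and> t x = 2 * i \<and> k \<le> i} \<subseteq> span ((u ^^ k) ` level k \<union> tail (Suc k))"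
    proof clarify
      fix x i assume x: "x \<in> S" "t x = 2 * i" "k \<le> i"
      show "(u ^^ i) x \<in> span ((u ^^ k) ` level k \<union> tail (Suc k))"
      proof (cases "i = k")
        case True
        then show ?thesis using level_base x by (intro span_base) auto
      next
        case False
        then have "(u ^^ i) x \<in> tail (Suc k)" unfolding tail_def using x by (intro span_base) force
        then show ?thesis by (intro span_base) auto
      qed
    qed
  qed simp
  show "span ((u ^^ k) ` level k \<union> tail (Suc k)) \<subseteq> tail k"
  proof (rule span_minimal)
    have "(u ^^ k) ` level k \<subseteq> tail k"
      unfolding push_level_eq tail_def by (rule span_mono) auto
    moreover have "tail (Suc k) \<subseteq> tail k" unfolding tail_def by (rule span_mono) (blast dest: Suc_leD)
    ultimately show "(u ^^ k) ` level k \<union> tail (Suc k) \<subseteq> tail k" by blast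
  qed simp
qed

lemma push_level_tail: "x \<in> (u ^^ k) ` level k \<Longrightarrow> y \<in> tail (Suc k) \<Longrightarrow> b x y = 0"
  unfolding push_level_eq tail_def
proof (erule span_perp_eq_0, assumption)
  fix x y assume "x \<in> (u ^^ k) ` {x \<in> S. t x = 2 * k}" "y \<in> {(u ^^ i) x |x i. x \<in> S \<and> t x = 2 * i \<and> Suc k \<le> i}"
  then obtain x' y' i where "x' \<in> S" "t x' = 2 * k" "x = (u ^^ k) x'" "y' \<in> S" "t y' = 2 * i" "Suc k \<le> i"
    "y = (u ^^ i) y'" by auto
  then show "b x y = 0" using string_pairing'[OF system, of x' y' k i] string_t_star[OF system, of x'] by auto
qed

lemma push_level_nondegenerate: "nondegenerate_on ((u ^^ k) ` level k)"
  unfolding nondegenerate_on_def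
proof (intro ballI impI)
  fix x assume x: "x \<in> (u ^^ k) ` level k" "\<forall>y\<in>(u ^^ k) ` level k. b x y = 0"
  then obtain z where z: "z \<in> level k" "x = (u ^^ k) z" by blast
  have "b z ((u ^^ (2 * k)) y) = 0" if "y \<in> level k" for y
    using level_pairing_push[OF z(1) that, of "2 * k"] x(2) z(2) that by simp
  then have "z = 0" using level_nondegenerate[OF z(1)] by blast
  then show "x = 0" using z by simp
qed

section \<open>The downward induction that matches strings\<close>

text \<open>\<open>X\<close> generates the strings on which a splitting is already constructed. The strings of the vectors in \<open>A\<close>
  are still unmatched; their middle vectors span an anisotropic part of \<open>tail k\<close>.\<close>

definition partial_splitting :: "nat \<Rightarrow> 'b set \<Rightarrow> ('b \<times> 'b) set \<Rightarrow> 'b set \<Rightarrow> bool" where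
  "partial_splitting k A H X \<longleftrightarrow> A \<subseteq> level k \<and> witt_decomposition (tail k) H ((u ^^ k) ` A) \<and>
     splitting X \<and> u_orthogonal X A \<and> X \<subseteq> (\<Union>i\<in>{k..}. level i) \<and> (\<forall>i\<ge>k. level i \<subseteq> u_span (X \<union> A))"

lemma partial_splitting_base:
  "\<exists>k. partial_splitting k {} {} {}"
proof -
  obtain k where k: "\<And>x. x \<in> S \<Longrightarrow> t x < k"
    using finite_nat_set_iff_bounded[of "t ` S"] string_finite[OF system] by auto
  then have *: "{x \<in> S. t x = 2 * i} = {}" if "k \<le> i" for i
    using that by fastforce
  have "level i = {0}" if "k \<le> i" for i unfolding level_def *[OF that] by simp
  moreover have e: "{(u ^^ i) x |x i. x \<in> S \<and> t x = 2 * i \<and> k \<le> i} = {}" using k by fastforce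
  have "tail k = {0}" unfolding tail_def e by simp
  moreover have "splitting {}" by (rule splitting_zero) simp
  ultimately have "partial_splitting k {} {} {}"
    by (auto simp: partial_splitting_def witt_decomposition_def hyperbolic_pairs_def pair_vectors_def
        orthogonal_set_def anisotropic_def u_orthogonal_def subspace_0)
  then show ?thesis by blast
qed

lemma u_orthogonal_levels:
  assumes "X \<subseteq> level i" "Y \<subseteq> level j" "i \<noteq> j"
  shows "u_orthogonal X Y"
  using assms level_pairing[of _ i _ j] unfolding u_orthogonal_def by blast

lemma u_orthogonal_level:
  assumes "X \<subseteq> level i" "Y \<subseteq> level i" "\<And>x y. x \<in> X \<Longrightarrow> y \<in> Y \<Longrightarrow> b ((u ^^ i) x) ((u ^^ i) y) = 0"
  shows "u_orthogonal X Y"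
  using assms level_pairing_push[of _ i] unfolding u_orthogonal_def by (simp add: subset_iff)

text \<open>Each unmatched string of length \<open>2k + 3\<close> is matched with a string of length \<open>2k + 1\<close> whose middle vector has
  the opposite norm. In \<open>tail k\<close> the two middle vectors span a hyperbolic plane, so the strings left unmatched
  are those of an anisotropic part of the orthogonal of the new partners.\<close>

lemma partial_splitting_step:
  assumes p: "partial_splitting (Suc k) A H X"
    and emb: "level_embedding k ((u ^^ Suc k) ` A) f"
  shows "\<exists>A H X. partial_splitting k A H X"
proof -
  let ?s = "Suc k"
  let ?P = "(u ^^ k) ` level k"
  let ?A = "(u ^^ ?s) ` A"
  have A: "A \<subseteq> level ?s" and wd: "witt_decomposition (tail ?s) H ?A" and X: "splitting X" "u_orthogonal X A"
    "X \<subseteq> (\<Union>i\<in>{?s..}. level i)" "\<And>i. i \<ge> ?s \<Longrightarrow> level i \<subseteq> u_span (X \<union> A)"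
    using p unfolding partial_splitting_def by blast+
  have f: "\<And>y. y \<in> ?A \<Longrightarrow> (u ^^ Suc (2 * k)) (f y) = 0"
    "\<And>y y'. y \<in> ?A \<Longrightarrow> y' \<in> ?A \<Longrightarrow> \<eta> ^ k * b (f y) ((u ^^ (2 * k)) (f y')) = - b y y'"
    using emb unfolding level_embedding_def by blast+
  have injA: "inj_on (u ^^ ?s) A" using inj_on_level A inj_on_subset by blast
  note D = witt_decompositionD[OF wd]
  have finA: "finite A" using D(9) finite_imageD[OF _ injA] by blast
  note tail_sub = D(14,15) and Aaniso = D(11)
  \<comment> \<open>The radical pairs to zero, so moving the values of \<open>f\<close> into
    \<open>level k\<close> keeps their form; this produces actual string generators as
    partners.\<close>
  have "\<forall>x\<in>A. \<exists>l. l \<in> level k \<and> f ((u ^^ ?s) x) - l \<in> t_radical u (Suc (2 * k))"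
    using ker_pow_level f(1) by blast
  from bchoice[OF this] obtain g where g: "\<And>x. x \<in> A \<Longrightarrow> g x \<in> level k"
    "\<And>x. x \<in> A \<Longrightarrow> f ((u ^^ ?s) x) - g x \<in> t_radical u (Suc (2 * k))" by blast
  have g_form: "b ((u ^^ k) (g x)) ((u ^^ k) (g y)) = - b ((u ^^ ?s) x) ((u ^^ ?s) y)"
    if x: "x \<in> A" and y: "y \<in> A" for x y
  proof -
    let ?x = "f ((u ^^ ?s) x)" and ?y = "f ((u ^^ ?s) y)"
    have "b (?x - g x) ((u ^^ (2 * k)) ?y) = 0"
      using t_radical_pairing[OF g(2)[OF x]] f(1) y by blast
    moreover have "b (g x) ((u ^^ (2 * k)) (?y - g y)) = 0"
      using b_upow_swap[of "g x" "2 * k" "?y - g y"] t_radical_pairing[OF g(2)[OF y] level_top[OF g(1)[OF x]]]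
      by simp
    ultimately have "b (g x) ((u ^^ (2 * k)) (g y)) = b ?x ((u ^^ (2 * k)) ?y)"
      by (simp add: b_simps upow_diff)
    then show ?thesis
      using f(2)[of "(u ^^ ?s) x" "(u ^^ ?s) y"] x y by (simp add: b_upow mult_2)
  qed
  define F where "F = (\<lambda>x. (u ^^ k) (g x)) ` A"
  have F_sub: "F \<subseteq> ?P" using g(1) by (auto simp: F_def)
  have Fnz: "b x x \<noteq> 0" if "x \<in> F" for x
    using that g_form Aaniso by (auto simp: F_def simp del: funpow.simps)
  have gorth: "b ((u ^^ k) (g x)) ((u ^^ k) (g y)) = 0" if "x \<in> A" "y \<in> A" "x \<noteq> y" for x y
  proof -
    have "(u ^^ ?s) x \<noteq> (u ^^ ?s) y" using injA that unfolding inj_on_def by blast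
    then have "b ((u ^^ ?s) x) ((u ^^ ?s) y) = 0" using D(10) that by blast
    then show ?thesis using g_form[OF that(1,2)] by simp
  qed
  have oF: "orthogonal_set F"
    unfolding orthogonal_set_def
  proof (intro conjI ballI impI)
    show "finite F" using finA by (simp add: F_def)
    show "0 \<notin> F" using Fnz by force
    show "b x y = 0" if "x \<in> F" "y \<in> F" "x \<noteq> y" for x y
      using that gorth by (auto simp: F_def)
  qed
  \<comment> \<open>What remains of the middle vectors of level \<open>k\<close> beside the new
    partners. Its hyperbolic pairs \<open>G\<close> give pairs of strings that split, its
    anisotropic part \<open>B\<close> the strings left unmatched.\<close>
  define P' where "P' = ?P \<inter> perp F"
  have P': "nondegenerate_on P'" "?P \<subseteq> span (F \<union> P')" "subspace P'"
    using orthogonal_complement[OF subspace_push_level push_level_nondegenerate oF F_sub Fnz]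
    by (simp_all add: P'_def subspace_inter subspace_push_level subspace_perp)
  obtain G B where GB: "witt_decomposition P' G B" using witt_decomposition_exists[OF P'(3,1)] by blast
  note G = witt_decompositionD[OF GB]
  have GB_sub: "pair_vectors G \<union> B \<subseteq> P'" using G(14,15) by blast
  \<comment> \<open>Recovers a generator in \<open>level k\<close> from its middle vector.\<close>
  define r where "r = inv_into (level k) (u ^^ k)"
  have r: "r y \<in> level k" "(u ^^ k) (r y) = y" if "y \<in> P'" for y
    using that inv_into_into[of y "u ^^ k" "level k"] f_inv_into_f[of y "u ^^ k" "level k"]
    by (auto simp: r_def P'_def)
  have r_F: "b ((u ^^ k) (g x)) ((u ^^ k) (r y)) = 0" if "x \<in> A" "y \<in> P'" for x y
    using that r(2)[OF that(2)] by (auto simp: P'_def perp_def F_def)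
  define A' where "A' = r ` B"
  have pushA': "(u ^^ k) ` A' = B"
    using r(2) GB_sub by (force simp: A'_def image_image)
  have A'_sub: "A' \<subseteq> level k" using r(1) GB_sub by (auto simp: A'_def)
  define X1 where "X1 = (\<Union>x\<in>A. {x, g x})"
  define X2 where "X2 = (\<Union>p\<in>G. {r (fst p), r (snd p)})"
  define X' where "X' = X \<union> (X1 \<union> X2)"
  have Gp: "fst p \<in> P'" "snd p \<in> P'" if "p \<in> G" for p
    using GB_sub that by (auto simp: pair_vectors_def)
  have X2_sub: "X2 \<subseteq> level k" using Gp r(1) by (auto simp: X2_def)
  have X1_sub: "X1 \<subseteq> level ?s \<union> level k" using A g(1) by (auto simp: X1_def)
  have gA_sub: "g ` A \<subseteq> level k" using g(1) by blast
  have sX1: "splitting X1"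
    unfolding X1_def
  proof (rule splitting_UN[OF finA])
    fix x assume x: "x \<in> A"
    show "splitting {x, g x}"
    proof (rule splitting_matched)
      show "x \<in> level ?s" using A x by blast
      show "g x \<in> level k" by (rule g(1)[OF x])
      show "b ((u ^^ k) (g x)) ((u ^^ k) (g x)) \<noteq> 0" using Fnz x by (auto simp: F_def)
      show "b ((u ^^ ?s) x) ((u ^^ ?s) x) = - b ((u ^^ k) (g x)) ((u ^^ k) (g x))"
        using g_form[OF x x] by simp
    qed
  next
    fix x y assume xy: "x \<in> A" "y \<in> A" "x \<noteq> y"
    have "u_orthogonal {x} {y}"
    proof (rule u_orthogonal_level[of _ ?s])
      show "{x} \<subseteq> level ?s" "{y} \<subseteq> level ?s" using A xy by auto
      show "b ((u ^^ ?s) x') ((u ^^ ?s) y') = 0" if "x' \<in> {x}" "y' \<in> {y}" for x' y'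
        using that g_form[OF xy(1,2)] gorth[OF xy] by simp
    qed
    moreover have "u_orthogonal {g x} {g y}"
      by (rule u_orthogonal_level[of _ k]) (use g(1) xy gorth in auto)
    moreover have "u_orthogonal {x} {g y}" "u_orthogonal {g x} {y}"
      using u_orthogonal_levels[of _ ?s _ k] u_orthogonal_levels[of _ k _ ?s] A g(1) xy by auto
    ultimately show "u_orthogonal {x, g x} {y, g y}"
      unfolding u_orthogonal_def by blast
  qed
  have sX2: "splitting X2"
    unfolding X2_def
  proof (rule splitting_UN)
    show "finite G" using G(1) by (simp add: hyperbolic_pairs_def)
    fix p assume p: "p \<in> G"
    show "splitting {r (fst p), r (snd p)}"
      by (rule splitting_hyperbolic[of _ k])
        (use p r[OF Gp(1)[OF p]] r[OF Gp(2)[OF p]] G(1) in \<open>auto simp: hyperbolic_pairs_def\<close>)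
  next
    fix p q assume pq: "p \<in> G" "q \<in> G" "p \<noteq> q"
    have *: "b (fst p) (fst q) = 0" "b (snd p) (snd q) = 0" "b (fst p) (snd q) = 0" "b (snd p) (fst q) = 0"
      using G(1) pq b_commute[of "snd p" "fst q"] by (auto simp: hyperbolic_pairs_def)
    show "u_orthogonal {r (fst p), r (snd p)} {r (fst q), r (snd q)}"
      by (rule u_orthogonal_level[of _ k])
        (use * r[OF Gp(1)[OF pq(1)]] r[OF Gp(2)[OF pq(1)]] r[OF Gp(1)[OF pq(2)]] r[OF Gp(2)[OF pq(2)]] in auto)
  qed
  have o12: "u_orthogonal X1 X2"
  proof -
    have "u_orthogonal A X2" using u_orthogonal_levels[OF A X2_sub] by simp
    moreover have "u_orthogonal (g ` A) X2"
      by (rule u_orthogonal_level[OF gA_sub X2_sub]) (use r_F Gp in \<open>auto simp: X2_def\<close>)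
    ultimately show ?thesis by (auto simp: u_orthogonal_def X1_def)
  qed
  have oX: "u_orthogonal X (X1 \<union> X2)" "u_orthogonal X A'"
  proof -
    have "u_orthogonal X (level k)"
      using X(3) level_pairing[of _ _ _ k] unfolding u_orthogonal_def by (fastforce simp: subset_iff)
    then show "u_orthogonal X (X1 \<union> X2)" "u_orthogonal X A'"
      using X(2) X2_sub A'_sub g(1) unfolding u_orthogonal_def X1_def by (auto simp: subset_iff)
  qed
  have sX': "splitting X'"
    unfolding X'_def by (intro splitting_Un X(1) sX1 sX2 o12 oX(1))
  have o1A: "u_orthogonal X1 A'"
  proof -
    have "u_orthogonal A A'" using u_orthogonal_levels[OF A A'_sub] by simp
    moreover have "u_orthogonal (g ` A) A'"
      by (rule u_orthogonal_level[OF gA_sub A'_sub]) (use r_F GB_sub in \<open>auto simp: A'_def\<close>)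
    ultimately show ?thesis by (auto simp: u_orthogonal_def X1_def)
  qed
  have o2A: "u_orthogonal X2 A'"
  proof (rule u_orthogonal_level[OF X2_sub A'_sub])
    fix x y assume "x \<in> X2" "y \<in> A'"
    then obtain x' y' where "x' \<in> pair_vectors G" "y' \<in> B" "x = r x'" "y = r y'"
      by (auto simp: X2_def A'_def pair_vectors_def)
    moreover from this have "x' \<in> P'" "y' \<in> P'" using GB_sub by auto
    ultimately show "b ((u ^^ k) x) ((u ^^ k) y) = 0" using G(12)[OF _ span_base] r(2) by simp
  qed
  have oX'A: "u_orthogonal X' A'"
    using oX(2) o1A o2A by (simp add: X'_def u_orthogonal_Un)
  have X'_sub: "X' \<subseteq> (\<Union>i\<in>{k..}. level i)"
    using X(3) X1_sub X2_sub unfolding X'_def by (force dest: Suc_leD)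
  have cover: "level i \<subseteq> u_span (X' \<union> A')" if i: "i \<ge> k" for i
  proof (cases "i = k")
    case True
    \<comment> \<open>Since \<open>u\<^sup>k\<close> is injective on \<open>level k\<close>, the
      inclusion can be checked on middle vectors.\<close>
    have "level k \<subseteq> span (g ` A \<union> X2 \<union> A')"
    proof
      fix z assume z: "z \<in> level k"
      let ?W = "g ` A \<union> X2 \<union> A'"
      have W: "span ?W \<subseteq> level k" using gA_sub X2_sub A'_sub by (intro span_minimal) auto
      have sW: "subspace ((u ^^ k) ` span ?W)"
        using self.linear_subspace_image[OF linear_upow subspace_span] .
      have "F \<subseteq> (u ^^ k) ` span ?W"
        by (auto simp: F_def intro!: imageI span_base)
      moreover have "pair_vectors G \<union> B \<subseteq> (u ^^ k) ` span ?W"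
      proof
        fix y assume y: "y \<in> pair_vectors G \<union> B"
        then have "r y \<in> span ?W" by (intro span_base) (auto simp: pair_vectors_def X2_def A'_def)
        then show "y \<in> (u ^^ k) ` span ?W" using r(2)[of y] y GB_sub by (metis imageI subsetD)
      qed
      then have "P' \<subseteq> (u ^^ k) ` span ?W" using span_minimal[OF _ sW] G(4) by metis
      ultimately have "?P \<subseteq> (u ^^ k) ` span ?W"
        using P'(2) span_minimal[OF _ sW, of "F \<union> P'"] by blast
      then obtain z' where z': "z' \<in> span ?W" "(u ^^ k) z = (u ^^ k) z'" using z by blast
      then have "z = z'" using inj_on_level[of k] z W unfolding inj_on_def by blast
      then show "z \<in> span ?W" using z' by simp
    qed
    also have "\<dots> \<subseteq> u_span (X' \<union> A')"
      using subset_u_span[of "X' \<union> A'"] by (intro span_minimal) (auto simp: X'_def X1_def)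
    finally show ?thesis using True by simp
  next
    case False
    have "X \<union> A \<subseteq> u_span (X' \<union> A')"
      using subset_u_span[of "X' \<union> A'"] by (auto simp: X'_def X1_def)
    then have "u_span (X \<union> A) \<subseteq> u_span (X' \<union> A')" by (rule u_span_mono)
    then show ?thesis using X(4)[of i] i False by auto
  qed
  \<comment> \<open>The sum and the difference of two orthogonal vectors with opposite norms are
    isotropic; \<open>c x\<close> normalises their pairing to 1, so that \<open>m1 x\<close> and
    \<open>m2 x\<close> form a hyperbolic pair.\<close>
  define c where "c x = 1 / (- 2 * b ((u ^^ ?s) x) ((u ^^ ?s) x))" for x
  define m1 where "m1 x = (u ^^ k) (g x) + (u ^^ ?s) x" for x
  define m2 where "m2 x = c x *s ((u ^^ k) (g x) - (u ^^ ?s) x)" for x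
  have c: "c x \<noteq> 0" "- 2 * c x * b ((u ^^ ?s) x) ((u ^^ ?s) x) = 1" if "x \<in> A" for x
    using Aaniso[of "(u ^^ ?s) x"] that two_neq_0 by (auto simp: c_def simp del: funpow.simps)
  have pt: "b ((u ^^ k) (g x)) y = 0" if "x \<in> A" "y \<in> tail ?s" for x y
    using push_level_tail[of _ k y] g(1) that by blast
  have pt': "b y ((u ^^ k) (g x)) = 0" if "x \<in> A" "y \<in> tail ?s" for x y
    using pt[OF that] by (simp add: b_commute)
  have At: "(u ^^ ?s) x \<in> tail ?s" if "x \<in> A" for x using tail_sub(2) that by blast
  have mm: "b (m1 x) (m1 y) = 0" "b (m2 x) (m2 y) = 0"
    "b (m1 x) (m2 y) = (if x = y then 1 else 0)" if "x \<in> A" "y \<in> A" for x y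
  proof -
    have 0: "b ((u ^^ k) (g x)) ((u ^^ ?s) y) = 0" "b ((u ^^ ?s) x) ((u ^^ k) (g y)) = 0"
      using pt pt' At that by blast+
    show "b (m1 x) (m1 y) = 0" "b (m2 x) (m2 y) = 0"
      by (simp_all add: m1_def m2_def b_simps 0 g_form[OF that] del: funpow.simps)
    show "b (m1 x) (m2 y) = (if x = y then 1 else 0)"
    proof (cases "x = y")
      case True
      then show ?thesis using c(2)[OF that(1)]
        by (simp add: m1_def m2_def b_simps 0[unfolded True] g_form[OF that, unfolded True] ac_simps del: funpow.simps)
    next
      case False
      then have "b ((u ^^ ?s) x) ((u ^^ ?s) y) = 0" using gorth[OF that False] g_form[OF that] by simp
      then show ?thesis using False by (simp add: m1_def m2_def b_simps 0 gorth[OF that False] del: funpow.simps)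
    qed
  qed
  define H3 where "H3 = (\<lambda>x. (m1 x, m2 x)) ` A"
  have "inj_on (\<lambda>x. (m1 x, m2 x)) A"
  proof (rule inj_onI)
    fix x y assume xy: "x \<in> A" "y \<in> A" "(m1 x, m2 x) = (m1 y, m2 y)"
    then have "b (m1 x) (m2 y) = 1" using mm(3)[of x x] by simp
    then show "x = y" using mm(3)[OF xy(1,2)] by (metis zero_neq_one)
  qed
  then have H3: "hyperbolic_pairs H3"
    using mm finA unfolding hyperbolic_pairs_def H3_def by (auto simp: inj_on_def)
  have pvH3: "pair_vectors H3 = m1 ` A \<union> m2 ` A"
    by (auto simp: pair_vectors_def H3_def image_image)
  have H3_span: "pair_vectors H3 \<subseteq> span (F \<union> ?A)"
  proof -
    have "(u ^^ k) (g x) \<in> span (F \<union> ?A)" "(u ^^ ?s) x \<in> span (F \<union> ?A)" if "x \<in> A" for x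
      using that by (auto simp: F_def intro!: span_base simp del: funpow.simps)
    then show ?thesis
      unfolding pvH3 m1_def m2_def by (auto intro!: span_add span_scale span_diff simp del: funpow.simps)
  qed
  have F_span: "F \<union> ?A \<subseteq> span (pair_vectors H3)"
  proof -
    have half: "(1 / 2) *s (a + a) = a" for a
      using two_neq_0 by (simp add: scale_right_distrib flip: scale_left_distrib)
    have "(u ^^ k) (g x) = (1 / 2) *s (m1 x + (1 / c x) *s m2 x)"
      "(u ^^ ?s) x = (1 / 2) *s (m1 x - (1 / c x) *s m2 x)" if "x \<in> A" for x
      using c(1)[OF that] half[of "(u ^^ k) (g x)"] half[of "(u ^^ ?s) x"]
      by (simp_all add: m1_def m2_def del: funpow.simps)
    then show ?thesis
      by (auto simp: F_def pvH3 simp del: funpow.simps intro!: span_scale span_add span_diff intro: span_base)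
  qed
  \<comment> \<open>Pairs from the longer strings, from \<open>P'\<close> and from the matched
    strings; this leaves \<open>B\<close> as the anisotropic part of \<open>tail k\<close>.\<close>
  define H' where "H' = (H \<union> G) \<union> H3"
  have o_P_tail: "b x y = 0" if "x \<in> P'" "y \<in> tail ?s" for x y
    using push_level_tail that by (auto simp: P'_def)
  have o_span: "b x y = 0" if "x \<in> pair_vectors H3" "\<And>z. z \<in> F \<union> ?A \<Longrightarrow> b z y = 0" for x y
  proof (rule span_perp_eq_0[of x "F \<union> ?A" y "{y}"])
    show "x \<in> span (F \<union> ?A)" using H3_span that(1) by blast
  qed (use that(2) in \<open>auto intro: span_base\<close>)
  have F_tail: "b x y = 0" if "x \<in> F" "y \<in> tail ?s" for x y
    using push_level_tail F_sub that by blast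
  have F_P': "b x y = 0" if "x \<in> F" "y \<in> P'" for x y
    using that by (auto simp: P'_def perp_def)
  have H_H3: "b x y = 0" if xy: "x \<in> pair_vectors H3" "y \<in> pair_vectors H" for x y
  proof (rule o_span[OF xy(1)])
    fix z assume "z \<in> F \<union> ?A"
    moreover have "y \<in> tail ?s" using xy(2) tail_sub by blast
    ultimately show "b z y = 0" using F_tail[of z y] D(13)[OF xy(2) span_base, of z] by auto
  qed
  have G_H3: "b x y = 0" if xy: "x \<in> pair_vectors H3" "y \<in> P'" for x y
  proof (rule o_span[OF xy(1)])
    fix z assume "z \<in> F \<union> ?A"
    then consider "z \<in> F" | "z \<in> tail ?s" using tail_sub by blast
    then show "b z y = 0" using F_P'[of z y] o_P_tail[of y z] b_commute[of z y] xy(2) by cases auto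
  qed
  have hH': "hyperbolic_pairs H'"
    unfolding H'_def
  proof (intro hyperbolic_pairs_Un D(1) G(1) H3)
    show "b x y = 0" if "x \<in> pair_vectors H" "y \<in> pair_vectors G" for x y
      using o_P_tail[of y x] that GB_sub tail_sub b_commute[of x y] by auto
    show "b x y = 0" if "x \<in> pair_vectors (H \<union> G)" "y \<in> pair_vectors H3" for x y
      using H_H3[of y x] G_H3[of y x] that GB_sub b_commute[of x y] by (auto simp: pair_vectors_Un)
  qed
  have wd': "witt_decomposition (tail k) H' B"
    unfolding witt_decomposition_def
  proof (intro conjI hH' G(2,3) ballI)
    fix x a assume xa: "x \<in> pair_vectors H'" "a \<in> B"
    then have aP: "a \<in> P'" using GB_sub by blast
    consider "x \<in> tail ?s" | "x \<in> pair_vectors G" | "x \<in> pair_vectors H3"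
      using xa(1) tail_sub by (auto simp: H'_def pair_vectors_Un)
    then show "b x a = 0"
      using G(12)[OF _ span_base[OF xa(2)]] G_H3[OF _ aP] o_P_tail[OF aP, of x] b_commute[of x a] by cases auto
  next
    let ?R = "span (pair_vectors H' \<union> B)"
    have sub: "pair_vectors H \<subseteq> ?R" "pair_vectors G \<union> B \<subseteq> ?R" "pair_vectors H3 \<subseteq> ?R"
      using span_superset[of "pair_vectors H' \<union> B"] by (auto simp: H'_def pair_vectors_Un)
    have s3: "F \<union> ?A \<subseteq> ?R" using F_span span_minimal[OF sub(3) subspace_span] by blast
    have P'R: "P' \<subseteq> ?R" using span_minimal[OF sub(2) subspace_span] G(4) by simp
    have "tail ?s \<subseteq> ?R" using span_minimal[of "pair_vectors H \<union> ?A" ?R] sub(1) s3 D(4) by auto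
    moreover have "?P \<subseteq> ?R" using P'(2) span_minimal[of "F \<union> P'" ?R] s3 P'R by auto
    ultimately have 1: "tail k \<subseteq> ?R" unfolding tail_eq[of k] by (intro span_minimal) auto
    have "?P \<subseteq> tail k" "tail ?s \<subseteq> tail k"
      using span_superset[of "?P \<union> tail ?s"] tail_eq[of k] by auto
    then have "F \<union> ?A \<subseteq> tail k" "pair_vectors G \<union> B \<subseteq> tail k" "pair_vectors H \<subseteq> tail k"
      using F_sub tail_sub GB_sub by (auto simp: P'_def)
    moreover from this(1) have "pair_vectors H3 \<subseteq> tail k" using H3_span span_minimal[of "F \<union> ?A" "tail k"] by auto
    ultimately have "?R \<subseteq> tail k" by (intro span_minimal) (auto simp: H'_def pair_vectors_Un)
    then show "?R = tail k" using 1 by blast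
  qed
  have "partial_splitting k A' H' X'"
    unfolding partial_splitting_def pushA'
    using A'_sub wd' sX' oX'A X'_sub cover by blast
  then show ?thesis by blast
qed

text \<open>At level 0 the unmatched strings have length 1, so \<open>u\<close> vanishes on them and
  \<open>v = 0\<close> is allowed. The strings of even length stay outside the induction and are
  added at the end.\<close>

lemma square_zero_sum_if_embeddings:
  assumes emb: "\<And>k H A. witt_decomposition (middle k) H A \<Longrightarrow> \<exists>f. level_embedding k A f"
  shows square_zero_sum
proof -
  have step: "\<exists>A H X. partial_splitting k A H X" if p: "\<exists>A H X. partial_splitting (Suc k) A H X" for k
  proof -
    from p obtain A H X where p: "partial_splitting (Suc k) A H X" by (elim exE)
    then have "witt_decomposition (middle k) H ((u ^^ Suc k) ` A)"
      unfolding partial_splitting_def by blast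
    from emb[OF this] obtain f where "level_embedding k ((u ^^ Suc k) ` A) f" by (elim exE)
    then show ?thesis by (rule partial_splitting_step[OF p])
  qed
  obtain K where "\<exists>A H X. partial_splitting K A H X" using partial_splitting_base by blast
  \<comment> \<open>Truncated subtraction stops at 0, and \<open>j = K\<close> reaches level
    0.\<close>
  then have "\<exists>A H X. partial_splitting (K - j) A H X" for j
  proof (induction j)
    case (Suc j)
    then show ?case using step[of "K - Suc j"] by (cases "j < K") (auto simp: Suc_diff_Suc)
  qed simp
  from this[of K] obtain A H X where p: "partial_splitting 0 A H X" by auto
  then have A: "A \<subseteq> level 0" and X: "splitting X" "u_orthogonal X A" "X \<subseteq> (\<Union>i. level i)" "\<And>i. level i \<subseteq> u_span (X \<union> A)"
    unfolding partial_splitting_def by auto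
  have sA: "splitting A" using level_top[of _ 0] A by (intro splitting_zero) auto
  have o: "u_orthogonal A {x \<in> S. odd (t x)}" "u_orthogonal X {x \<in> S. odd (t x)}"
    using A X(3) level_pairing_odd unfolding u_orthogonal_def by blast+
  let ?T = "X \<union> A \<union> {x \<in> S. odd (t x)}"
  have "splitting ?T"
    using X(1,2) o sA splitting_odd by (intro splitting_Un) (auto simp: u_orthogonal_Un)
  moreover have "u_span ?T = UNIV"
  proof -
    have "S \<subseteq> u_span ?T"
    proof
      fix x assume x: "x \<in> S"
      show "x \<in> u_span ?T"
      proof (cases "even (t x)")
        case True
        then have "x \<in> level (t x div 2)" using x by (intro level_base) auto
        then have "x \<in> u_span (X \<union> A)" using X(4) by blast
        moreover have "X \<union> A \<subseteq> u_span ?T" using subset_u_span[of ?T] by blast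
        ultimately show ?thesis using u_span_mono by blast
      next
        case False
        then show ?thesis using x subset_u_span[of ?T] by blast
      qed
    qed
    then show ?thesis using u_span_mono full by blast
  qed
  ultimately show ?thesis by (rule square_zero_sum_if_splitting)
qed

section \<open>The forms on the quotients\<close>

definition level_form :: "nat \<Rightarrow> ('a, 'b set) form_space" where
  "level_form i = scale_form (\<eta> ^ i) (t_form scale b u (2 * i + 1))"

definition coset :: "nat \<Rightarrow> 'b \<Rightarrow> 'b set" where
  "coset i x = (+) x ` t_radical u (Suc (2 * i))"

lemma t_radical_ker: "r \<in> t_radical u (Suc (2 * i)) \<Longrightarrow> (u ^^ Suc (2 * i)) r = 0"
  by (auto simp: t_radical_def ker_pow_def upow_add u_add)

lemma coset_eq: "coset i x = coset i y \<longleftrightarrow> x - y \<in> t_radical u (Suc (2 * i))"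
  unfolding coset_def by (rule coset_eq_iff[OF subspace_t_radical])

lemma level_form_simps:
  "carrier (level_form i) = coset i ` ker_pow u (Suc (2 * i))"
  "\<zero>\<^bsub>level_form i\<^esub> = coset i 0"
  "coset i x \<oplus>\<^bsub>level_form i\<^esub> coset i y = coset i (x + y)"
  "c \<odot>\<^bsub>level_form i\<^esub> coset i x = coset i (c *s x)"
  using coset_add[OF subspace_t_radical] coset_scale[OF subspace_t_radical]
  by (simp_all add: level_form_def scale_form_def t_form_def with_form_def quotient_module_def
      module.defs form_space.defs coset_def)

lemma level_form_linear_image: "linear_image (ker_pow u (Suc (2 * i))) (coset i) (level_form i)"
  unfolding linear_image_def by (simp add: level_form_simps subspace_ker_pow)

text \<open>Moving \<open>x\<close> and \<open>y\<close> by the radical does not change the pairing,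
  so the image in \<open>t_form\<close> is a singleton and \<open>the_elem\<close> returns its
  value.\<close>

lemma level_form_form:
  assumes "(u ^^ Suc (2 * i)) x = 0" "(u ^^ Suc (2 * i)) y = 0"
  shows "form (level_form i) (coset i x) (coset i y) = \<eta> ^ i * b x ((u ^^ (2 * i)) y)"
proof -
  let ?R = "t_radical u (Suc (2 * i))"
  have eq: "b x' ((u ^^ (2 * i)) y') = b x ((u ^^ (2 * i)) y)" if xy: "x' \<in> coset i x" "y' \<in> coset i y" for x' y'
  proof -
    obtain r r' where r: "r \<in> ?R" "r' \<in> ?R" "x' = x + r" "y' = y + r'"
      using xy by (auto simp: coset_def)
    have "b r ((u ^^ (2 * i)) y) = 0" by (rule t_radical_pairing[OF r(1) assms(2)])
    moreover have "b r ((u ^^ (2 * i)) r') = 0" by (rule t_radical_pairing[OF r(1) t_radical_ker[OF r(2)]])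
    moreover have "b x ((u ^^ (2 * i)) r') = 0"
      using t_radical_pairing[OF r(2) assms(1)] b_upow_swap[of x "2 * i" r'] by simp
    ultimately show ?thesis by (simp add: r upow_add b_add_left b_add_right)
  qed
  have "x \<in> coset i x" "y \<in> coset i y"
    using subspace_0[OF subspace_t_radical] by (auto simp: coset_def intro!: image_eqI[of _ _ 0])
  then have ne: "coset i x \<times> coset i y \<noteq> {}" by blast
  have "(\<lambda>(x, y). b x ((u ^^ (2 * i)) y)) ` (coset i x \<times> coset i y) =
      (\<lambda>_. b x ((u ^^ (2 * i)) y)) ` (coset i x \<times> coset i y)"
    by (intro image_cong refl) (clarsimp simp: eq)
  also have "\<dots> = {b x ((u ^^ (2 * i)) y)}" using ne by (simp only: image_constant_conv if_False)
  finally have "(\<lambda>(x, y). b x ((u ^^ (2 * i)) y)) ` (coset i x \<times> coset i y) = {b x ((u ^^ (2 * i)) y)}" .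
  then show ?thesis
    by (simp add: level_form_def scale_form_def t_form_def with_form_def form_space.defs module.defs)
qed

text \<open>Takes the middle coordinates of \<open>w\<close> at the strings of length
  \<open>2i + 1\<close> but attaches them to the generators, so that the result lies in
  \<open>level i\<close>.\<close>

definition component :: "nat \<Rightarrow> 'b \<Rightarrow> 'b" where
  "component i w = (\<Sum>x\<in>{x \<in> S. t x = 2 * i}. string_coeff t star x i w *s x)"

lemma component_linear:
  "component i (x + y) = component i x + component i y"
  "component i (c *s x) = c *s component i x"
  by (simp_all add: component_def string_coeff_linear[OF system] scale_left_distrib sum.distrib scale_sum_right)

lemma component_0 [simp]: "component i 0 = 0"
  using component_linear(2)[of i 0 0] by simp

lemma component_in: "component i w \<in> level i"
  unfolding component_def level_def by (intro span_sum span_scale span_base) auto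

lemma level_ker: "x \<in> level i \<Longrightarrow> x \<in> ker_pow u (Suc (2 * i))"
  using level_top by (simp add: ker_pow_def)

lemma component_level:
  assumes "l \<in> level j"
  shows "component i ((u ^^ j) l) = (if i = j then l else 0)"
proof -
  have "{x \<in> S. t x = 2 * j} \<subseteq> {l. component i ((u ^^ j) l) = (if i = j then l else 0)}"
  proof clarify
    fix x assume x: "x \<in> S" "t x = 2 * j"
    have "string_coeff t star y i ((u ^^ j) x) = (if y = x \<and> i = j then 1 else 0)" if "y \<in> {y \<in> S. t y = 2 * i}" for y
      using string_coeff_basis[OF system, of y x i j] that x by auto
    then have "component i ((u ^^ j) x) = (\<Sum>y\<in>{y \<in> S. t y = 2 * i}. if y = x then (if i = j then x else 0) else 0)"
      unfolding component_def by (intro sum.cong) auto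
    also have "\<dots> = (if i = j then x else 0)"
      using x string_finite[OF system] by auto
    finally show "component i ((u ^^ j) x) = (if i = j then x else 0)" .
  qed
  moreover have "subspace {l. component i ((u ^^ j) l) = (if i = j then l else 0)}"
    by (auto simp: subspace_def upow_add upow_scale component_linear)
  ultimately show ?thesis using assms span_minimal unfolding level_def by blast
qed

text \<open>The levels above \<open>k\<close> that actually occur. They replace the infinite index
  set of the orthogonal sum by a finite one.\<close>

definition indices :: "nat \<Rightarrow> nat set" where
  "indices k = {i. k < i \<and> (\<exists>x\<in>S. t x = 2 * i)}"

lemma finite_indices: "finite (indices k)"
proof -
  have "indices k \<subseteq> (\<lambda>x. t x div 2) ` S" by (force simp: indices_def image_iff)
  then show ?thesis using finite_subset string_finite[OF system] by blast
qed

lemma level_not_index: "k < i \<Longrightarrow> i \<notin> indices k \<Longrightarrow> x \<in> level i \<Longrightarrow> x = 0"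
proof -
  assume "k < i" "i \<notin> indices k" "x \<in> level i"
  moreover from this have "{x \<in> S. t x = 2 * i} = {}" by (auto simp: indices_def)
  ultimately show ?thesis unfolding level_def by simp
qed

lemma level_middle: "k < i \<Longrightarrow> x \<in> level i \<Longrightarrow> (u ^^ i) x \<in> middle k"
proof -
  assume i: "k < i" and x: "x \<in> level i"
  have "{x \<in> S. t x = 2 * i} \<subseteq> {x. (u ^^ i) x \<in> middle k}"
    unfolding tail_def using i by (auto intro!: span_base simp: Suc_le_eq)
  then have "level i \<subseteq> {x. (u ^^ i) x \<in> middle k}"
    unfolding level_def by (rule span_minimal[OF _ subspace_vimage_u[OF subspaces(2)]])
  then show ?thesis using x by blast
qed

lemma middle_expansion:
  assumes "w \<in> middle k"
  shows "w = (\<Sum>i\<in>indices k. (u ^^ i) (component i w))"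
proof -
  have "{(u ^^ i) x | x i. x \<in> S \<and> t x = 2 * i \<and> Suc k \<le> i} \<subseteq> {w. w = (\<Sum>i\<in>indices k. (u ^^ i) (component i w))}"
  proof clarify
    fix x j assume x: "x \<in> S" "t x = 2 * j" "Suc k \<le> j"
    have "(u ^^ i) (component i ((u ^^ j) x)) = (if i = j then (u ^^ j) x else 0)" for i
      using component_level[OF level_base[OF x(1,2)], of i] by simp
    then show "(u ^^ j) x = (\<Sum>i\<in>indices k. (u ^^ i) (component i ((u ^^ j) x)))"
      using x finite_indices by (auto simp: indices_def)
  qed
  moreover have "subspace {w. w = (\<Sum>i\<in>indices k. (u ^^ i) (component i w))}"
    by (simp add: subspace_def component_linear upow_add upow_scale sum.distrib flip: scale_sum_right)
  ultimately show ?thesis using assms span_minimal unfolding tail_def by blast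
qed

lemma middle_form:
  assumes "w \<in> middle k" "w' \<in> middle k"
  shows "b w w' = (\<Sum>i\<in>indices k. \<eta> ^ i * b (component i w) ((u ^^ (2 * i)) (component i w')))"
proof -
  have "b w w' = b (\<Sum>i\<in>indices k. (u ^^ i) (component i w)) (\<Sum>j\<in>indices k. (u ^^ j) (component j w'))"
    by (intro arg_cong2[where f = b] middle_expansion assms)
  also have "\<dots> = (\<Sum>i\<in>indices k. \<Sum>j\<in>indices k. b ((u ^^ i) (component i w)) ((u ^^ j) (component j w')))"
    by (simp only: b_sum_left b_sum_right) (rule sum.swap)
  also have "\<dots> = (\<Sum>i\<in>indices k. \<Sum>j\<in>indices k. if i = j then
      \<eta> ^ i * b (component i w) ((u ^^ (2 * i)) (component i w')) else 0)"
  proof (intro sum.cong refl)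
    fix i j
    show "b ((u ^^ i) (component i w)) ((u ^^ j) (component j w')) =
      (if i = j then \<eta> ^ i * b (component i w) ((u ^^ (2 * i)) (component i w')) else 0)"
      using level_pairing[OF component_in component_in, of i j "i + j" w w'] by (simp add: b_upow mult_2)
  qed
  also have "\<dots> = (\<Sum>i\<in>indices k. \<eta> ^ i * b (component i w) ((u ^^ (2 * i)) (component i w')))"
    using finite_indices by simp
  finally show ?thesis .
qed

lemma level_coset_inj: "x \<in> level i \<Longrightarrow> y \<in> level i \<Longrightarrow> coset i x = coset i y \<Longrightarrow> x = y"
proof -
  assume x: "x \<in> level i" and y: "y \<in> level i" and "coset i x = coset i y"
  then have "x - y \<in> t_radical u (Suc (2 * i))" by (simp add: coset_eq)
  then have "b (x - y) ((u ^^ (2 * i)) z) = 0" if "z \<in> level i" for z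
    using t_radical_pairing level_top that by blast
  then show ?thesis using level_nondegenerate[of "x - y" i] x y by (simp add: subspace_diff)
qed

definition family :: "nat \<Rightarrow> 'b \<Rightarrow> nat \<Rightarrow> 'b set" where
  "family k w = (\<lambda>i\<in>{k<..}. coset i (component i w))"

text \<open>Transports the sum of coset spaces to a subspace where Witt decompositions are
  available. Its form becomes \<open>b\<close> itself, since middle vectors satisfy \<open>b
  (u\<^sup>i l) (u\<^sup>i l') = \<eta>\<^sup>i b l (u\<^sup>2\<^sup>i l')\<close>: this is the
  origin of the factors \<open>\<eta> ^ i\<close>.\<close>

lemma middle_isometric_image:
  "isometric_image (middle k) (family k) (orth_Sum {k<..} level_form)"
  unfolding isometric_image_def linear_image_def
proof (intro conjI ballI allI)
  let ?X = "orth_Sum {k<..} level_form"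
  have support: "{i \<in> {k<..}. family k w i \<noteq> \<zero>\<^bsub>level_form i\<^esub>} \<subseteq> indices k" for w
  proof clarify
    fix i assume i: "k < i" "family k w i \<noteq> \<zero>\<^bsub>level_form i\<^esub>"
    then have "component i w \<noteq> 0" by (auto simp: family_def level_form_simps)
    then show "i \<in> indices k" using level_not_index[OF i(1)] component_in by blast
  qed
  show "subspace (middle k)" by simp
  show "carrier ?X = family k ` middle k"
  proof
    show "family k ` middle k \<subseteq> carrier ?X"
      using support finite_subset[OF support finite_indices] level_ker[OF component_in]
      by (auto simp: orth_Sum_def family_def level_form_simps)
  next
    show "carrier ?X \<subseteq> family k ` middle k"
    proof
      fix X assume X: "X \<in> carrier ?X"
      have "\<exists>l\<in>level i. X i = coset i l" if i: "i \<in> {k<..}" for i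
      proof -
        have "X i \<in> coset i ` ker_pow u (Suc (2 * i))"
          using X i by (auto simp: orth_Sum_def level_form_simps PiE_def Pi_def)
        then obtain x where x: "(u ^^ Suc (2 * i)) x = 0" "X i = coset i x" by (auto simp: ker_pow_def)
        then show ?thesis using ker_pow_level[OF x(1)] coset_eq by metis
      qed
      then obtain l where l: "\<And>i. i \<in> {k<..} \<Longrightarrow> l i \<in> level i \<and> X i = coset i (l i)" by metis
      define w where "w = (\<Sum>i\<in>indices k. (u ^^ i) (l i))"
      have ind: "i \<in> {k<..}" if "i \<in> indices k" for i using that by (simp add: indices_def)
      have "w \<in> middle k"
        unfolding w_def using l ind by (intro subspace_sum[OF subspaces(2)] level_middle) auto
      moreover have "component i w = l i" if i: "i \<in> {k<..}" for i
      proof -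
        have sum: "component i (\<Sum>j\<in>I. f j) = (\<Sum>j\<in>I. component i (f j))" for I :: "nat set" and f
          by (induction I rule: infinite_finite_induct) (auto simp: component_linear)
        have "component i w = (\<Sum>j\<in>indices k. if j = i then l i else 0)"
          unfolding w_def sum using component_level l ind by (intro sum.cong) auto
        also have "\<dots> = l i"
          using finite_indices level_not_index[of k i "l i"] l i by auto
        finally show ?thesis .
      qed
      then have "X = family k w"
        using X l by (auto simp: family_def orth_Sum_def fun_eq_iff PiE_def extensional_def)
      ultimately show "X \<in> family k ` middle k" by blast
    qed
  qed
  show "\<zero>\<^bsub>?X\<^esub> = family k 0"
    by (auto simp: orth_Sum_def family_def level_form_simps)
  show "inj_on (family k) (middle k)"
  proof (rule inj_onI)
    fix x y assume xy: "x \<in> middle k" "y \<in> middle k" "family k x = family k y"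
    have "component i x = component i y" if "i \<in> indices k" for i
    proof -
      have "k < i" using that by (simp add: indices_def)
      then have "coset i (component i x) = coset i (component i y)"
        using fun_cong[OF xy(3), of i] by (simp add: family_def)
      then show ?thesis using level_coset_inj component_in by blast
    qed
    then show "x = y" using middle_expansion[OF xy(1)] middle_expansion[OF xy(2)] by (metis (no_types, lifting) sum.cong)
  qed
  fix x y c assume x: "x \<in> middle k"
  show "c \<odot>\<^bsub>?X\<^esub> family k x = family k (c *s x)"
    by (rule ext) (simp add: orth_Sum_def family_def level_form_simps component_linear)
  assume y: "y \<in> middle k"
  show "family k x \<oplus>\<^bsub>?X\<^esub> family k y = family k (x + y)"
    by (rule ext) (simp add: orth_Sum_def family_def level_form_simps component_linear)
  let ?I = "{i \<in> {k<..}. family k x i \<noteq> \<zero>\<^bsub>level_form i\<^esub> \<and> family k y i \<noteq> \<zero>\<^bsub>level_form i\<^esub>}"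
  have "form ?X (family k x) (family k y) = (\<Sum>i\<in>?I. form (level_form i) (family k x i) (family k y i))"
    by (simp add: orth_Sum_def)
  also have "\<dots> = (\<Sum>i\<in>?I. \<eta> ^ i * b (component i x) ((u ^^ (2 * i)) (component i y)))"
    by (intro sum.cong refl) (simp add: family_def level_form_form level_top component_in del: funpow.simps)
  \<comment> \<open>\<open>orth_Sum\<close> only sums over the common support; the other members of
    \<open>indices k\<close> contribute zero.\<close>
  also have "\<dots> = (\<Sum>i\<in>indices k. \<eta> ^ i * b (component i x) ((u ^^ (2 * i)) (component i y)))"
  proof (intro sum.mono_neutral_left finite_indices ballI)
    show "?I \<subseteq> indices k" using support[of x] by blast
    fix i assume i: "i \<in> indices k - ?I"
    then have "k < i" by (simp add: indices_def)
    then have "coset i (component i x) = coset i 0 \<or> coset i (component i y) = coset i 0"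
      using i by (auto simp: family_def level_form_simps)
    then have "component i x = 0 \<or> component i y = 0"
      using level_coset_inj[OF component_in subspace_0[OF subspaces(1)]] by blast
    then show "\<eta> ^ i * b (component i x) ((u ^^ (2 * i)) (component i y)) = 0" by auto
  qed
  finally show "form ?X (family k x) (family k y) = b x y" using middle_form[OF x y] by simp
qed

section \<open>Witt-simplification expressed by embeddings\<close>

lemma embedding_if_witt_simplifies:
  assumes ws: "witt_simplifies (level_form k) (orth_Sum {k<..} level_form)"
    and HA: "witt_decomposition (middle k) H A"
  shows "\<exists>f. level_embedding k A f"
proof -
  let ?X = "orth_Sum {k<..} level_form" and ?\<phi> = "family k"
  let ?N = "subform ?X (?\<phi> ` span A)" and ?B = "scale_form (- 1) (level_form k)"
  have A: "A \<subseteq> span A" "span A \<subseteq> middle k"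
    using witt_decompositionD(16)[OF HA] span_superset by auto
  have "nonisotropic_part ?N ?X" by (rule nonisotropic_part_subform[OF middle_isometric_image HA])
  then obtain W where W: "VectorSpace.subspace class_ring W ?B" "isometric ?N (subform ?B W)"
    using ws unfolding witt_simplifies_def by blast
  then obtain h where h: "bij_betw h (carrier ?N) (carrier (subform ?B W))"
    "\<And>x y. x \<in> carrier ?N \<Longrightarrow> y \<in> carrier ?N \<Longrightarrow> form (subform ?B W) (h x) (h y) = form ?N x y"
    unfolding isometric_def by blast
  have "W \<subseteq> carrier ?B" using W(1) by (auto simp: VectorSpace.subspace_def submodule_def)
  then have WB: "W \<subseteq> coset k ` ker_pow u (Suc (2 * k))" by (simp add: scale_form_def level_form_simps)
  have N: "?\<phi> y \<in> carrier ?N" if "y \<in> A" for y using that A(1) by (auto simp: subform_def)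
  have "h (?\<phi> y) \<in> W" if "y \<in> A" for y
    using bij_betwE[OF h(1)] A(1) that by (auto simp: subform_def)
  then have "\<forall>y\<in>A. \<exists>x. (u ^^ Suc (2 * k)) x = 0 \<and> h (?\<phi> y) = coset k x"
    using WB by (fastforce simp: ker_pow_def simp del: funpow.simps)
  then obtain f where f: "\<And>y. y \<in> A \<Longrightarrow> (u ^^ Suc (2 * k)) (f y) = 0 \<and> h (?\<phi> y) = coset k (f y)"
    by metis
  have "\<eta> ^ k * b (f y) ((u ^^ (2 * k)) (f y')) = - b y y'" if y: "y \<in> A" and y': "y' \<in> A" for y y'
  proof -
    have "- (\<eta> ^ k * b (f y) ((u ^^ (2 * k)) (f y'))) = form (subform ?B W) (h (?\<phi> y)) (h (?\<phi> y'))"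
      using f[OF y] f[OF y'] by (simp add: subform_def scale_form_def level_form_form del: funpow.simps)
    also have "\<dots> = form ?X (?\<phi> y) (?\<phi> y')"
      using h(2)[OF N[OF y] N[OF y']] by (simp add: subform_def)
    also have "\<dots> = b y y'"
      using middle_isometric_image[of k] A y y' unfolding isometric_image_def by blast
    finally show ?thesis by (simp add: minus_equation_iff)
  qed
  then show ?thesis using f unfolding level_embedding_def by blast
qed

text \<open>An arbitrary nonisotropic part comes with an isometry to a hyperbolic space plus
  \<open>N\<close>. Pulling back one half of the hyperbolic space and the summand \<open>N\<close>
  gives a metabolic decomposition of \<open>middle k\<close>, whatever the choice of
  \<open>N\<close>.\<close>

lemma witt_simplifies_if_embeddings:
  assumes emb: "\<And>M N. metabolic_decomposition (middle k) M N \<Longrightarrow>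
    \<exists>f. endomorphism f \<and> level_embedding k N f"
  shows "witt_simplifies (level_form k) (orth_Sum {k<..} level_form)"
  unfolding witt_simplifies_def
proof (intro allI impI)
  let ?X = "orth_Sum {k<..} level_form" and ?\<phi> = "family k" and ?W = "middle k"
  let ?B = "scale_form (- 1) (level_form k)"
  fix N :: "('a, nat \<Rightarrow> 'b set) form_space"
  assume "nonisotropic_part N ?X"
  define m where "m = witt_index ?X"
  let ?Y = "orth_sum (hyperbolic_space m) N"
  have N: "symmetric_form_space N" "nonisotropic N" "isometric ?X ?Y"
    using \<open>nonisotropic_part N ?X\<close> by (auto simp: nonisotropic_part_def m_def)
  then obtain h where h: "h \<in> LinearCombinations.module_hom class_ring ?X ?Y"
    "bij_betw h (carrier ?X) (carrier ?Y)"
    "\<And>x y. x \<in> carrier ?X \<Longrightarrow> y \<in> carrier ?X \<Longrightarrow> form ?Y (h x) (h y) = form ?X x y"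
    unfolding isometric_def by blast
  interpret N: vectorspace class_ring N using N(1) by (simp add: symmetric_form_space_def)
  have N_form: "form N (c \<odot>\<^bsub>N\<^esub> x) y = c * form N x y" "form N x y = form N y x"
    if "x \<in> carrier N" "y \<in> carrier N" for c x y
    using N(1) that by (auto simp: symmetric_form_space_def)
  have N_zero: "form N \<zero>\<^bsub>N\<^esub> x = 0" "form N x \<zero>\<^bsub>N\<^esub> = 0" if "x \<in> carrier N" for x
  proof -
    have "0 \<odot>\<^bsub>N\<^esub> x = \<zero>\<^bsub>N\<^esub>" using N.smult_l_null[OF that] by simp
    then show "form N \<zero>\<^bsub>N\<^esub> x = 0" using N_form(1)[OF that that, of 0] by simp
    then show "form N x \<zero>\<^bsub>N\<^esub> = 0" using N_form(2)[OF that N.zero_closed] by simp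
  qed
  note X = isometric_imageD[OF middle_isometric_image[of k]]
  note Xd = linear_imageD[OF X(1)]
  define p where "p w = fst (fst (h (?\<phi> w)))" for w
  define q where "q w = snd (fst (h (?\<phi> w)))" for w
  define r where "r w = snd (h (?\<phi> w))" for w
  have pqr: "h (?\<phi> w) = ((p w, q w), r w)" for w by (simp add: p_def q_def r_def)
  have closed: "p w \<in> carrier_vec m" "q w \<in> carrier_vec m" "r w \<in> carrier N" if "w \<in> ?W" for w
    using bij_betwE[OF h(2)] that Xd(2) pqr[of w] by (auto simp: hyperbolic_orth_sum_simps)
  have W_add: "x + y \<in> ?W" if "x \<in> ?W" "y \<in> ?W" for x y using that by (simp add: subspace_add)
  have W_scale: "c *s x \<in> ?W" if "x \<in> ?W" for c x using that by (simp add: subspace_scale)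
  have add: "p (x + y) = p x + p y" "q (x + y) = q x + q y" "r (x + y) = r x \<oplus>\<^bsub>N\<^esub> r y"
    if "x \<in> ?W" "y \<in> ?W" for x y
  proof -
    have "h (?\<phi> (x + y)) = h (?\<phi> x) \<oplus>\<^bsub>?Y\<^esub> h (?\<phi> y)"
      using LinearCombinations.module_hom_add[OF h(1), of "?\<phi> x" "?\<phi> y"] Xd(2) Xd(4)[OF that] that by auto
    then show "p (x + y) = p x + p y" "q (x + y) = q x + q y" "r (x + y) = r x \<oplus>\<^bsub>N\<^esub> r y"
      unfolding pqr hyperbolic_orth_sum_simps by simp_all
  qed
  have scale: "p (c *s x) = c \<cdot>\<^sub>v p x" "q (c *s x) = c \<cdot>\<^sub>v q x" "r (c *s x) = c \<odot>\<^bsub>N\<^esub> r x"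
    if "x \<in> ?W" for x c
  proof -
    have "h (?\<phi> (c *s x)) = c \<odot>\<^bsub>?Y\<^esub> h (?\<phi> x)"
      using LinearCombinations.module_hom_smult[OF h(1), of c "?\<phi> x"] Xd(2) Xd(5)[OF that] that by auto
    then show "p (c *s x) = c \<cdot>\<^sub>v p x" "q (c *s x) = c \<cdot>\<^sub>v q x" "r (c *s x) = c \<odot>\<^bsub>N\<^esub> r x"
      unfolding pqr hyperbolic_orth_sum_simps by simp_all
  qed
  have form: "b x y = p x \<bullet> q y + q x \<bullet> p y + form N (r x) (r y)" if "x \<in> ?W" "y \<in> ?W" for x y
    using h(3)[of "?\<phi> x" "?\<phi> y"] X(3)[OF that] Xd(2) that
    unfolding pqr hyperbolic_orth_sum_simps by simp
  have surj: "\<exists>w\<in>?W. p w = x \<and> q w = y \<and> r w = n"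
    if "x \<in> carrier_vec m" "y \<in> carrier_vec m" "n \<in> carrier N" for x y n
  proof -
    have "((x, y), n) \<in> h ` ?\<phi> ` ?W"
      using bij_betw_imp_surj_on[OF h(2)] that unfolding Xd(2) hyperbolic_orth_sum_simps by simp
    then obtain w where "w \<in> ?W" "((p w, q w), r w) = ((x, y), n)" unfolding pqr[symmetric] by force
    then show ?thesis by blast
  qed
  have inj: "x = y" if "x \<in> ?W" "y \<in> ?W" "p x = p y" "q x = q y" "r x = r y" for x y
  proof -
    have "h (?\<phi> x) = h (?\<phi> y)" using that by (simp add: pqr)
    then have "?\<phi> x = ?\<phi> y" using h(2) that(1,2) Xd(2) unfolding bij_betw_def inj_on_def by blast
    then show ?thesis using X(2) that(1,2) unfolding inj_on_def by blast
  qed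
  have W0: "0 \<in> ?W" by (simp add: subspace_0)
  have zero: "p 0 = 0\<^sub>v m" "q 0 = 0\<^sub>v m" "r 0 = \<zero>\<^bsub>N\<^esub>"
  proof -
    have "0 \<cdot>\<^sub>v v = 0\<^sub>v m" if "v \<in> carrier_vec m" for v :: "'a vec" using that by (intro eq_vecI) auto
    moreover have "p 0 = 0 \<cdot>\<^sub>v p 0" "q 0 = 0 \<cdot>\<^sub>v q 0" "r 0 = 0 \<odot>\<^bsub>N\<^esub> r 0" using scale[OF W0, of 0] by simp_all
    ultimately show "p 0 = 0\<^sub>v m" "q 0 = 0\<^sub>v m" "r 0 = \<zero>\<^bsub>N\<^esub>"
      using closed[OF W0] N.smult_l_null[OF closed(3)[OF W0]] by simp_all
  qed
  define M where "M = {w \<in> ?W. q w = 0\<^sub>v m \<and> r w = \<zero>\<^bsub>N\<^esub>}"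
  define N0 where "N0 = {w \<in> ?W. p w = 0\<^sub>v m \<and> q w = 0\<^sub>v m}"
  have sM: "subspace M"
    unfolding subspace_def M_def using W0 W_add W_scale by (auto simp: zero add scale)
  have sN0: "subspace N0"
    unfolding subspace_def N0_def using W0 W_add W_scale by (auto simp: zero add scale)
  have sub: "M \<subseteq> ?W" "N0 \<subseteq> ?W" by (auto simp: M_def N0_def)
  have aniso: "anisotropic N0"
    unfolding anisotropic_def
  proof (intro ballI impI)
    fix x assume x: "x \<in> N0" "b x x = 0"
    then have xW: "x \<in> ?W" using sub by blast
    have "form N (r x) (r x) = 0" using form[OF xW xW] x by (auto simp: N0_def)
    then have "r x = \<zero>\<^bsub>N\<^esub>" using N(2) closed(3)[OF xW] by (auto simp: nonisotropic_def)
    then show "x = 0" using inj[OF xW W0] x(1) zero by (auto simp: N0_def)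
  qed
  have MN: "\<exists>m\<in>M. \<exists>n\<in>N0. w = m + n" if w: "w \<in> ?W" "\<And>x. x \<in> M \<Longrightarrow> b x w = 0" for w
  proof -
    \<comment> \<open>This coordinate is the pairing of \<open>w\<close> with the vector of
      \<open>M\<close> whose \<open>p\<close> part is the \<open>i\<close>-th unit vector.\<close>
    have "q w $ i = 0" if i: "i < m" for i
    proof -
      obtain x where x: "x \<in> ?W" "p x = unit_vec m i" "q x = 0\<^sub>v m" "r x = \<zero>\<^bsub>N\<^esub>"
        using surj[of "unit_vec m i" "0\<^sub>v m" "\<zero>\<^bsub>N\<^esub>"] by auto
      then have "b x w = 0" using w(2) by (simp add: M_def)
      then show ?thesis
        using form[OF x(1) w(1)] x closed[OF w(1)] N_zero i by simp
    qed
    then have qw: "q w = 0\<^sub>v m" using closed(2)[OF w(1)] by (intro eq_vecI) auto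
    obtain n where n: "n \<in> ?W" "p n = 0\<^sub>v m" "q n = 0\<^sub>v m" "r n = r w"
      using surj[of "0\<^sub>v m" "0\<^sub>v m" "r w"] closed(3)[OF w(1)] by auto
    define x where "x = w + (- 1) *s n"
    have "q x = 0\<^sub>v m"
      unfolding x_def add(2)[OF w(1) W_scale[OF n(1)]] scale(2)[OF n(1)] qw n(3) by (intro eq_vecI) auto
    moreover have "r x = \<zero>\<^bsub>N\<^esub>"
    proof -
      have "r x = r w \<oplus>\<^bsub>N\<^esub> (- 1) \<odot>\<^bsub>N\<^esub> r w"
        unfolding x_def add(3)[OF w(1) W_scale[OF n(1)]] scale(3)[OF n(1)] n(4) ..
      also have "\<dots> = (1 + - 1) \<odot>\<^bsub>N\<^esub> r w"
        using N.smult_l_distr[of 1 "- 1" "r w"] N.smult_one[of "r w"] closed(3)[OF w(1)] by simp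
      finally show ?thesis using N.smult_l_null closed(3)[OF w(1)] by simp
    qed
    moreover have "x \<in> ?W" unfolding x_def by (rule W_add[OF w(1) W_scale[OF n(1)]])
    ultimately have "x \<in> M" by (simp add: M_def)
    moreover have "n \<in> N0" using n by (simp add: N0_def)
    moreover have "w = x + n" by (simp add: x_def)
    ultimately show ?thesis by blast
  qed
  have isoM: "b x y = 0" if "x \<in> M" "y \<in> M" for x y
    using form[of x y] that closed[of x] closed[of y] N_zero by (auto simp: M_def)
  have orthMN: "b x y = 0" if "x \<in> M" "y \<in> N0" for x y
    using form[of x y] that closed[of x] closed[of y] N_zero by (auto simp: M_def N0_def)
  have "metabolic_decomposition ?W M N0"
    unfolding metabolic_decomposition_def using sM sub isoM sN0 orthMN aniso MN by simp
  from emb[OF this] obtain f where f1: "endomorphism f" "level_embedding k N0 f"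
    by (elim exE conjE)
  have f2: "(u ^^ Suc (2 * k)) (f y) = 0" if "y \<in> N0" for y
    using f1(2) that unfolding level_embedding_def by blast
  have f3: "\<eta> ^ k * b (f y) ((u ^^ (2 * k)) (f y')) = - b y y'" if "y \<in> N0" "y' \<in> N0" for y y'
    using f1(2) that unfolding level_embedding_def by blast
  note f = f1(1) f2 f3
  note f_lin = endomorphismD[OF f(1)]
  have N_image: "isometric_image N0 r N"
    unfolding isometric_image_def linear_image_def
  proof (intro conjI ballI allI sN0)
    show "carrier N = r ` N0"
    proof
      show "carrier N \<subseteq> r ` N0" using surj[of "0\<^sub>v m" "0\<^sub>v m"] by (force simp: N0_def)
      show "r ` N0 \<subseteq> carrier N" using closed sub by blast
    qed
    show "\<zero>\<^bsub>N\<^esub> = r 0" by (simp add: zero)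
    show "inj_on r N0" using inj by (auto simp: inj_on_def N0_def)
  next
    fix x y assume "x \<in> N0" "y \<in> N0"
    then have xy: "x \<in> ?W" "y \<in> ?W" "p x = 0\<^sub>v m" "q x = 0\<^sub>v m" "p y = 0\<^sub>v m" "q y = 0\<^sub>v m"
      by (auto simp: N0_def)
    show "r x \<oplus>\<^bsub>N\<^esub> r y = r (x + y)" using add(3) xy by simp
    show "form N (r x) (r y) = b x y" using form[OF xy(1,2)] xy by simp
  next
    fix c x assume "x \<in> N0"
    then show "c \<odot>\<^bsub>N\<^esub> r x = r (c *s x)" using scale(3) sub by auto
  qed
  have B: "linear_image (ker_pow u (Suc (2 * k))) (coset k) ?B"
    using level_form_linear_image[of k] unfolding linear_image_def scale_form_def by simp
  have fN: "f ` N0 \<subseteq> ker_pow u (Suc (2 * k))" using f(2) by (auto simp: ker_pow_def simp del: funpow.simps)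
  have sfN: "subspace (f ` N0)" using self.linear_subspace_image[OF f(1) sN0] .
  note C = linear_image_subspace[OF B sfN fN]
  note Cd = linear_imageD[OF C(2)]
  have f_form: "form ?B (coset k (f x)) (coset k (f y)) = b x y" if "x \<in> N0" "y \<in> N0" for x y
    using level_form_form[OF f(2)[OF that(1)] f(2)[OF that(2)]] f(3)[OF that] by (simp add: scale_form_def)
  have "isometric_image N0 (\<lambda>x. coset k (f x)) (subform ?B (coset k ` f ` N0))"
    unfolding isometric_image_def linear_image_def
  proof (intro conjI ballI allI sN0)
    let ?C = "subform ?B (coset k ` f ` N0)"
    show "carrier ?C = (\<lambda>x. coset k (f x)) ` N0" by (auto simp: subform_def)
    show "\<zero>\<^bsub>?C\<^esub> = coset k (f 0)" using Cd(3) by (simp add: subform_def f_lin)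
    \<comment> \<open>Injectivity survives the passage to cosets because the map preserves the
      anisotropic form of \<open>N0\<close>.\<close>
    show "inj_on (\<lambda>x. coset k (f x)) N0"
    proof (rule inj_onI)
      fix x y assume xy: "x \<in> N0" "y \<in> N0" "coset k (f x) = coset k (f y)"
      have d: "x - y \<in> N0" using xy sN0 by (simp add: subspace_diff)
      have "b x z = b y z" if "z \<in> N0" for z using f_form[OF xy(1) that] f_form[OF xy(2) that] xy(3) by simp
      then have "b (x - y) (x - y) = 0" using d by (simp add: b_diff_left)
      then show "x = y" using aniso d by (auto simp: anisotropic_def)
    qed
  next
    let ?C = "subform ?B (coset k ` f ` N0)"
    fix x y assume xy: "x \<in> N0" "y \<in> N0"
    show "coset k (f x) \<oplus>\<^bsub>?C\<^esub> coset k (f y) = coset k (f (x + y))"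
      using Cd(4)[of "f x" "f y"] xy by (simp add: subform_def f_lin)
    show "form ?C (coset k (f x)) (coset k (f y)) = b x y"
      using f_form[OF xy] by (simp add: subform_def)
  next
    let ?C = "subform ?B (coset k ` f ` N0)"
    fix c x assume x: "x \<in> N0"
    show "c \<odot>\<^bsub>?C\<^esub> coset k (f x) = coset k (f (c *s x))"
      using Cd(5)[of "f x" c] x by (simp add: subform_def f_lin)
  qed
  then have "isometric N (subform ?B (coset k ` f ` N0))"
    by (rule isometric_if_isometric_images[OF N_image])
  then show "\<exists>W. VectorSpace.subspace class_ring W ?B \<and> isometric N (subform ?B W)"
    using C(1) by blast
qed

theorem square_zero_sum_iff_witt_simplifies:
  "square_zero_sum \<longleftrightarrow> (\<forall>k. witt_simplifies (level_form k) (orth_Sum {k<..} level_form))"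
proof
  assume square_zero_sum
  then obtain a1 a2 where a: "endomorphism a1" "endomorphism a2"
    "\<And>x y. b (a1 x) y = \<eta> * b x (a1 y)" "\<And>x y. b (a2 x) y = \<eta> * b x (a2 y)"
    "\<And>x. a1 (a1 x) = 0" "\<And>x. a2 (a2 x) = 0" "\<And>x. u x = a1 x + a2 x"
    by (auto simp: square_zero_sum_def fun_eq_iff)
  show "\<forall>k. witt_simplifies (level_form k) (orth_Sum {k<..} level_form)"
    by (intro allI witt_simplifies_if_embeddings embedding_if_square_zero_sum[OF a(1,3,5) a(2,4,6,7)])
next
  assume "\<forall>k. witt_simplifies (level_form k) (orth_Sum {k<..} level_form)"
  then show square_zero_sum
    by (intro square_zero_sum_if_embeddings) (auto intro: embedding_if_witt_simplifies)
qed

end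

theorem theorem1p14:
  fixes scale :: "'f::field \<Rightarrow> 'v::ab_group_add \<Rightarrow> 'v"
    and Basis :: "'v set"
    and b :: "'v \<Rightarrow> 'v \<Rightarrow> 'f"
    and u :: "'v \<Rightarrow> 'v"
    and \<eta> :: 'f
  assumes char: "CHAR('f) \<noteq> 2"
    and eta: "\<eta> \<in> {-1, 1}"
    and V: "finite_dimensional_vector_space scale Basis"
    and b: "bilinear_form scale b" "symmetric_form b" "nondegenerate_form b"
    and u: "Vector_Spaces.linear scale scale u" "\<exists>n. u ^^ n = (\<lambda>_. 0)"
      "\<eta> = 1 \<longrightarrow> selfadjoint b u" "\<eta> = -1 \<longrightarrow> skew_selfadjoint b u"
  shows "(\<exists>a1 a2.
            Vector_Spaces.linear scale scale a1 \<and> Vector_Spaces.linear scale scale a2 \<and>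
            (\<eta> = 1 \<longrightarrow> selfadjoint b a1 \<and> selfadjoint b a2) \<and>
            (\<eta> = -1 \<longrightarrow> skew_selfadjoint b a1 \<and> skew_selfadjoint b a2) \<and>
            a1 \<circ> a1 = (\<lambda>_. 0) \<and> a2 \<circ> a2 = (\<lambda>_. 0) \<and>
            u = (\<lambda>x. a1 x + a2 x))
      \<longleftrightarrow>
         (\<forall>k::nat. witt_simplifies
            (scale_form (\<eta> ^ k) (t_form scale b u (2 * k + 1)))
            (orth_Sum {k<..} (\<lambda>i. scale_form (\<eta> ^ i) (t_form scale b u (2 * i + 1)))))"
proof -
  have two: "(2::'f) \<noteq> 0"
  proof
    assume "(2::'f) = 0"
    then have "CHAR('f) dvd 2" using of_nat_eq_0_iff_char_dvd[where 'a = 'f, of 2] by simp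
    then have "CHAR('f) = 1 \<or> CHAR('f) = 2" using two_is_prime_nat unfolding prime_nat_iff by blast
    then show False using char CHAR_not_1 by simp
  qed
  then have ne: "(1::'f) \<noteq> - 1"
    by (metis add.left_inverse one_add_one)
  \<comment> \<open>In characteristic other than 2 the two values of \<open>\<eta>\<close> differ,
    so exactly one implication is active and both cases become one equation.\<close>
  have adj: "(\<forall>x y. b (a x) y = \<eta> * b x (a y)) \<longleftrightarrow>
      (\<eta> = 1 \<longrightarrow> selfadjoint b a) \<and> (\<eta> = -1 \<longrightarrow> skew_selfadjoint b a)" for a
    using eta ne by (auto simp: selfadjoint_def skew_selfadjoint_def)
  interpret F: finite_dimensional_vector_space scale Basis by (rule V)
  interpret L: Vector_Spaces.linear scale scale u by (rule u(1))
  interpret V: nilpotent_adjoint_space scale Basis b u \<eta>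
  proof unfold_locales
    show "b (u x) y = \<eta> * b x (u y)" for x y using adj[of u] u(3,4) by blast
    show "\<eta> * \<eta> = 1" using eta by auto
  qed (use b u two in auto)
  \<comment> \<open>The string system is an auxiliary choice: neither side of the equivalence
    mentions it.\<close>
  from V.string_system_exists obtain S t star where st: "V.string_system S t star"
    "\<forall>x\<in>S. even (t x) \<longrightarrow> star x = x" "V.u_span S = UNIV" by (elim exE conjE)
  interpret S: string_space scale Basis b u \<eta> S t star
    by unfold_locales (use st in simp_all)
  have lhs: "(A1 \<and> A2 \<and> (\<eta> = 1 \<longrightarrow> selfadjoint b a1 \<and> selfadjoint b a2) \<and>
        (\<eta> = -1 \<longrightarrow> skew_selfadjoint b a1 \<and> skew_selfadjoint b a2) \<and> R) \<longleftrightarrow>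
      (A1 \<and> A2 \<and> (\<forall>x y. b (a1 x) y = \<eta> * b x (a1 y)) \<and> (\<forall>x y. b (a2 x) y = \<eta> * b x (a2 y)) \<and> R)"
    for A1 A2 R a1 a2
    unfolding adj by blast
  show ?thesis
    unfolding lhs S.level_form_def[symmetric]
    by (rule S.square_zero_sum_iff_witt_simplifies[unfolded V.square_zero_sum_def])
qed

end
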